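(* Let $0<p<q<1$ and let $c_0$ be the constant defined in the context. If $c>c_0\tfrac{\sqrt{p(1-p)}}{q-p}$, then there exist $0<\alpha<1$ and $\beta>0$ (and a number of iterations $t$ as in the context) for which, given a graph $G\in G(n,p,c\sqrt n,q)$, the algorithm described in the context finds the hidden dense graph (outputs $K^*=K$) with probability at least $1-\mathrm{e}^{-\Theta(n^{\varepsilon_0})}$ for some $\varepsilon_0=\varepsilon_0(c)>0$.
   Context: Model $G(n,p,k,q)$ with $0<p<q<1$: on $n$ vertices choose a uniformly random subset $K$ of $k$ vertices (the hidden dense graph); each pair $(u,v)$ is an edge independently with probability $q$ if both $u,v\in K$ and with probability $p$ otherwise. $d_S(v)$ is the number of neighbors of $v$ in $S$; $\bar\Phi=1-\Phi$, $\Phi$ the standard Gaussian CDF; logarithms base 2. For $0<\alpha<1$, $\beta>0$, $c>0$ put $\tau=(1-\alpha)\bar\Phi(\beta)$, $\rho=(1-\alpha)\bar\Phi(\beta-c\sqrt\alpha)$; $\tilde c(\alpha,\beta)$ is the minimal $c$ with $\rho\ge\sqrt\tau$, and $c_0=\inf_{0<\alpha<1,\beta>0}\tilde c(\alpha,\beta)$. Also put $\rho'=(1-\alpha)\bar\Phi\big(\beta-c\sqrt\alpha\tfrac{q-p}{\sqrt{p(1-p)}}\big)$. Algorithm: Phase 1: $G_0=G$; given $G_i$, choose $S_i\subseteq V(G_i)$ containing each vertex independently with probability $\alpha$, let $\tilde V_i=\{v\in V(G_i)\setminus S_i: d_{S_i}(v)\ge p|S_i|+\beta\sqrt{p(1-p)|S_i|}\}$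 and $G_{i+1}$ the subgraph of $G_i$ induced on $\tilde V_i$; repeat for $i=0,\dots,t-1$, where $t=\varepsilon_4\log n/\log(\rho'^2/\tau)$ for a suitable constant $\varepsilon_4>0$. Phase 2: let $K'$ be the $\rho'^tk$ largest degree vertices of $G_t$ and $\tilde K$ the vertices of $G_t$ with at least $\tfrac12(p+q)\rho'^tk$ neighbors in $K'$. Phase 3: let $K''$ consist of $\tilde K$ together with all vertices of $G$ having at least $\tfrac12(p+q)|\tilde K|$ neighbors in $\tilde K$; output $K^*$, the set of vertices of $G$ with at least $\tfrac12(p+q)k$ neighbors in $K''$. *)

theory Defs
  imports "HOL-Probability.Probability" "HOL-Library.Landau_Symbols"
begin

definition gaussian_tail :: "real \<Rightarrow> real" where
  "gaussian_tail x = 1 - cdf std_normal_distribution x"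

definition tau :: "real \<Rightarrow> real \<Rightarrow> real" where
  "tau \<alpha> \<beta> = (1 - \<alpha>) * gaussian_tail \<beta>"

definition rho :: "real \<Rightarrow> real \<Rightarrow> real \<Rightarrow> real" where
  "rho \<alpha> \<beta> c = (1 - \<alpha>) * gaussian_tail (\<beta> - c * sqrt \<alpha>)"

definition rho' :: "real \<Rightarrow> real \<Rightarrow> real \<Rightarrow> real \<Rightarrow> real \<Rightarrow> real" where
  "rho' p q \<alpha> \<beta> c =
     (1 - \<alpha>) * gaussian_tail (\<beta> - c * sqrt \<alpha> * ((q - p) / sqrt (p * (1 - p))))"

definition c_tilde :: "real \<Rightarrow> real \<Rightarrow> real" where
  "c_tilde \<alpha> \<beta> = (LEAST c. 0 < c \<and> rho \<alpha> \<beta> c \<ge> sqrt (tau \<alpha> \<beta>))"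

text \<open>
  As \<open>rho \<alpha> \<beta> c < 1 - \<alpha>\<close> for every \<open>c\<close>, for some pairs \<open>(\<alpha>, \<beta>)\<close> there is no admissible
  \<open>c\<close> at all.  For those pairs \<open>c_tilde \<alpha> \<beta>\<close> is to be read as infinity, so they
  do not take part in the infimum.
\<close>

definition c0 :: real where
  "c0 = Inf {c_tilde \<alpha> \<beta> | \<alpha> \<beta>. 0 < \<alpha> \<and> \<alpha> < 1 \<and> 0 < \<beta> \<and>
                (\<exists>c>0. rho \<alpha> \<beta> c \<ge> sqrt (tau \<alpha> \<beta>))}"

text \<open>
  The vertex set is \<open>{..<n}\<close> and a graph is given by its set of edges, which are
  two-element sets of vertices.
\<close>

definition vertex_pairs :: "nat \<Rightarrow> nat set set" where
  "vertex_pairs n = {e. e \<subseteq> {..<n} \<and> card e = 2}"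

definition random_edges :: "nat \<Rightarrow> real \<Rightarrow> real \<Rightarrow> nat set \<Rightarrow> nat set set pmf" where
  "random_edges n p q K =
     map_pmf (\<lambda>X. {e \<in> vertex_pairs n. X e})
       (Pi_pmf (vertex_pairs n) False (\<lambda>e. bernoulli_pmf (if e \<subseteq> K then q else p)))"

text \<open>
  The hidden set is kept next to the edge set.  The first draw is meaningful only
  for \<open>k \<le> n\<close>.
\<close>

definition planted_graph ::
    "nat \<Rightarrow> real \<Rightarrow> nat \<Rightarrow> real \<Rightarrow> (nat set \<times> nat set set) pmf" where
  "planted_graph n p k q = do {
     K \<leftarrow> pmf_of_set {K. K \<subseteq> {..<n} \<and> card K = k};
     E \<leftarrow> random_edges n p q K;
     return_pmf (K, E)
   }"

definition deg_in :: "nat set set \<Rightarrow> nat set \<Rightarrow> nat \<Rightarrow> nat" where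
  "deg_in E S v = card {u \<in> S. {u, v} \<in> E}"

text \<open>
  An induced subgraph of \<open>G\<close> is represented by its vertex set \<open>V\<close> alone: for
  \<open>v \<in> V\<close> and \<open>S \<subseteq> V\<close>, the number of neighbours of \<open>v\<close> in \<open>S\<close> is the same in the
  induced subgraph as in \<open>G\<close>, and the degree of \<open>v\<close> in it is \<open>deg_in E V v\<close>.
\<close>

definition random_subset :: "real \<Rightarrow> nat set \<Rightarrow> nat set pmf" where
  "random_subset \<alpha> V =
     map_pmf (\<lambda>X. {v \<in> V. X v}) (Pi_pmf V False (\<lambda>_. bernoulli_pmf \<alpha>))"

definition refine ::
    "real \<Rightarrow> real \<Rightarrow> nat set set \<Rightarrow> nat set \<Rightarrow> nat set \<Rightarrow> nat set" where
  "refine p \<beta> E V S =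
     {v \<in> V - S. real (deg_in E S v)
                  \<ge> p * real (card S) + \<beta> * sqrt (p * (1 - p) * real (card S))}"

primrec phase1 ::
    "real \<Rightarrow> real \<Rightarrow> real \<Rightarrow> nat set set \<Rightarrow> nat set \<Rightarrow> nat \<Rightarrow> nat set pmf" where
  "phase1 p \<alpha> \<beta> E V 0 = return_pmf V"
| "phase1 p \<alpha> \<beta> E V (Suc i) = do {
     V\<^sub>i \<leftarrow> phase1 p \<alpha> \<beta> E V i;
     S\<^sub>i \<leftarrow> random_subset \<alpha> V\<^sub>i;
     return_pmf (refine p \<beta> E V\<^sub>i S\<^sub>i)
   }"

text \<open>
  \<open>W\<close> consists of \<open>m\<close> largest degree vertices of the subgraph induced on \<open>V\<close>, and is
  all of \<open>V\<close> if there are fewer than \<open>m\<close> vertices.  Ties make \<open>W\<close> non-unique; a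
  selection rule resolves them in an arbitrary way.
\<close>

definition largest_degree :: "nat set set \<Rightarrow> nat set \<Rightarrow> nat \<Rightarrow> nat set \<Rightarrow> bool" where
  "largest_degree E V m W \<longleftrightarrow>
     W \<subseteq> V \<and> card W = min m (card V) \<and>
     (\<forall>u\<in>W. \<forall>v\<in>V - W. deg_in E V v \<le> deg_in E V u)"

definition selection_rule :: "(nat set set \<Rightarrow> nat set \<Rightarrow> nat \<Rightarrow> nat set) \<Rightarrow> bool" where
  "selection_rule sel \<longleftrightarrow> (\<forall>E V m. finite V \<longrightarrow> largest_degree E V m (sel E V m))"

text \<open>The argument \<open>r\<close> of the second phase stands for the real number \<open>rho' ^ t * k\<close>.\<close>

definition phase2 ::
    "(nat set set \<Rightarrow> nat set \<Rightarrow> nat \<Rightarrow> nat set) \<Rightarrow> real \<Rightarrow> real \<Rightarrow> real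
      \<Rightarrow> nat set set \<Rightarrow> nat set \<Rightarrow> nat set" where
  "phase2 sel p q r E V =
     (let K' = sel E V (nat \<lfloor>r\<rfloor>)
      in {v \<in> V. real (deg_in E K' v) \<ge> (p + q) / 2 * r})"

definition phase3 ::
    "nat \<Rightarrow> real \<Rightarrow> real \<Rightarrow> nat \<Rightarrow> nat set set \<Rightarrow> nat set \<Rightarrow> nat set" where
  "phase3 n p q k E Kt =
     (let K'' = Kt \<union> {v \<in> {..<n}. real (deg_in E Kt v) \<ge> (p + q) / 2 * real (card Kt)}
      in {v \<in> {..<n}. real (deg_in E K'' v) \<ge> (p + q) / 2 * real k})"

definition dense_graph_alg ::
    "(nat set set \<Rightarrow> nat set \<Rightarrow> nat \<Rightarrow> nat set) \<Rightarrow> nat \<Rightarrow> real \<Rightarrow> real \<Rightarrow> real \<Rightarrow> nat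
      \<Rightarrow> real \<Rightarrow> real \<Rightarrow> nat \<Rightarrow> nat set set \<Rightarrow> nat set pmf" where
  "dense_graph_alg sel n p q c k \<alpha> \<beta> t E = do {
     V\<^sub>t \<leftarrow> phase1 p \<alpha> \<beta> E {..<n} t;
     return_pmf (phase3 n p q k E (phase2 sel p q (rho' p q \<alpha> \<beta> c ^ t * real k) E V\<^sub>t))
   }"

definition num_iterations ::
    "real \<Rightarrow> real \<Rightarrow> real \<Rightarrow> real \<Rightarrow> real \<Rightarrow> real \<Rightarrow> nat \<Rightarrow> nat" where
  "num_iterations \<epsilon>\<^sub>4 p q \<alpha> \<beta> c n =
     nat \<lfloor>\<epsilon>\<^sub>4 * log 2 (real n) / log 2 ((rho' p q \<alpha> \<beta> c)\<^sup>2 / tau \<alpha> \<beta>)\<rfloor>"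

definition success_prob ::
    "(nat set set \<Rightarrow> nat set \<Rightarrow> nat \<Rightarrow> nat set) \<Rightarrow> nat \<Rightarrow> real \<Rightarrow> real \<Rightarrow> real \<Rightarrow> nat
      \<Rightarrow> real \<Rightarrow> real \<Rightarrow> nat \<Rightarrow> real" where
  "success_prob sel n p q c k \<alpha> \<beta> t =
     measure_pmf.prob
       (do {
          (K, E) \<leftarrow> planted_graph n p k q;
          K_out \<leftarrow> dense_graph_alg sel n p q c k \<alpha> \<beta> t E;
          return_pmf (K, K_out)
        })
       {(K, K_out). K_out = K}"

end

theory Submission
  imports Defs "HOL-Real_Asymp.Real_Asymp"
begin

text \<open>
  Write \<open>n\<^sub>i\<close> and \<open>k\<^sub>i\<close> for the number of all vertices and of planted vertices after \<open>i\<close> steps of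
  phase 1.  A step only looks at the edges between \<open>S\<^sub>i\<close> and its complement, so the edges inside the
  next vertex set can be redrawn afterwards, and phase 1 becomes a Markov chain on vertex sets.  By the
  central limit theorem an unplanted vertex passes with probability about \<open>gaussian_tail \<beta>\<close>, while a
  planted one passes with a probability that increases with \<open>k\<^sub>i / sqrt n\<^sub>i\<close>.  As \<open>rho'\<^sup>2 > tau\<close>, the
  first step already raises this ratio by a constant factor.  All later steps therefore have
  slack, no rate of convergence in the central limit theorem is needed, and Hoeffding's inequality keeps
  the failure probability of each step exponentially small.

  After logarithmically many steps, the planted vertices have the largest degrees.  Phases 2 and 3 reuse
  edges that were already seen.  This is harmless because of a union bound over all large sets
  \<open>A \<subseteq> K\<close>: with overwhelming probability, for each of them only few vertices have an atypical number
  of neighbours in \<open>A\<close>.  From then on the argument is deterministic.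
\<close>

section \<open>Random subsets with independent inclusion\<close>

text \<open>The counts are tracked only through an upper bound \<open>M\<close> for all vertices and
  a lower bound \<open>L\<close> for planted ones. Both change geometrically while
  \<open>L / sqrt M\<close> stays above a fixed \<open>x\<close>. The pass probability of a planted
  vertex is monotone in that ratio, so one set of constants serves every step after the first. This
  is why a limit theorem suffices: its threshold does not depend on the step.

  The number of steps is a small multiple of ln n, so the survival of planted vertices costs at most
  about a factor n powr (1/16), and about n powr (7/16) of them remain. The union bound needs this:
  \<open>K\<close> has exp (O (sqrt n)) subsets, while \<open>s\<close> exceptional vertices for a
  set of size \<open>l\<close> occur with probability exp (- \<Omega> (l * s)). With
  \<open>l\<close> of order n powr (7/16) and \<open>s\<close> of order n powr (1/4), the exponent
  11/16 beats 1/2, and \<open>s\<close> is still negligible against \<open>l\<close>.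

  Strictness originates in \<open>c > c0\<close>: the rate \<open>rho\<close> is strictly monotone,
  so beyond an attained least admissible value it strictly exceeds \<open>sqrt tau\<close>.\<close>

definition random_sub :: "'a set \<Rightarrow> ('a \<Rightarrow> real) \<Rightarrow> 'a set pmf" where
  "random_sub A w = map_pmf (\<lambda>X. {x \<in> A. X x}) (Pi_pmf A False (\<lambda>x. bernoulli_pmf (w x)))"

lemma set_random_subD: "X \<in> set_pmf (random_sub A w) \<Longrightarrow> X \<subseteq> A"
  by (auto simp: random_sub_def)

lemma random_sub_empty [simp]: "random_sub {} w = return_pmf {}"
  by (simp add: random_sub_def)

lemma random_sub_cong:
  assumes "\<And>x. x \<in> A \<Longrightarrow> w x = w' x"
  shows "random_sub A w = random_sub A w'"
  unfolding random_sub_def by (subst Pi_pmf_cong[where A' = A]) (use assms in auto)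

lemma random_sub_union:
  assumes "finite A" "finite B" "A \<inter> B = {}"
  shows "random_sub (A \<union> B) w =
    bind_pmf (random_sub A w) (\<lambda>X. map_pmf (\<lambda>Y. X \<union> Y) (random_sub B w))"
proof -
  have eq: "{x. (x \<in> A \<longrightarrow> f x) \<and> (x \<notin> A \<longrightarrow> x \<in> B \<and> g x)} = {x \<in> A. f x} \<union> {x \<in> B. g x}" for f g
    using assms(3) by auto
  show ?thesis
    unfolding random_sub_def Pi_pmf_union[OF assms]
    by (simp add: map_pmf_def pair_pmf_def bind_assoc_pmf bind_return_pmf eq)
qed

lemma random_sub_restrict:
  assumes "finite B" "A \<subseteq> B"
  shows "map_pmf (\<lambda>X. X \<inter> A) (random_sub B w) = random_sub A w"
proof -
  have eq: "{x \<in> B. f x} \<inter> A = {x \<in> A. if x \<in> A then f x else False}" for f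
    using assms(2) by auto
  show ?thesis
    unfolding random_sub_def Pi_pmf_subset[OF assms]
    by (simp add: map_pmf_comp eq)
qed

lemma random_sub_singleton:
  "random_sub {x} w = map_pmf (\<lambda>b. if b then {x} else {}) (bernoulli_pmf (w x))"
proof -
  have eq: "{y. y = x \<and> (if y = x then b else False)} = (if b then {x} else {})" for b
    by auto
  show ?thesis
    by (simp add: random_sub_def Pi_pmf_singleton map_pmf_comp eq)
qed

lemma random_sub_insert:
  assumes "finite A" "x \<notin> A"
  shows "random_sub (insert x A) w =
    bind_pmf (bernoulli_pmf (w x)) (\<lambda>b. map_pmf (\<lambda>Y. if b then insert x Y else Y) (random_sub A w))"
proof -
  have "random_sub ({x} \<union> A) w =
    bind_pmf (random_sub {x} w) (\<lambda>X. map_pmf (\<lambda>Y. X \<union> Y) (random_sub A w))"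
    by (rule random_sub_union) (use assms in auto)
  also have "\<dots> = bind_pmf (bernoulli_pmf (w x))
      (\<lambda>b. map_pmf (\<lambda>Y. if b then insert x Y else Y) (random_sub A w))"
    unfolding random_sub_singleton bind_map_pmf
    by (intro bind_pmf_cong refl map_pmf_cong) auto
  finally show ?thesis by simp
qed

text \<open>Bits that depend on disjoint blocks of independent choices are independent, so reducing
  each block to one bit gives independent inclusion again. Later the block of \<open>v\<close> is
  its star to the sample, and the bit tells whether \<open>v\<close> passes.\<close>

lemma random_sub_blocks:
  assumes "finite T" "\<And>v. v \<in> T \<Longrightarrow> finite (D v)"
    and "\<And>u v. u \<in> T \<Longrightarrow> v \<in> T \<Longrightarrow> u \<noteq> v \<Longrightarrow> D u \<inter> D v = {}"
  shows "map_pmf (\<lambda>X. {v \<in> T. Q v (X \<inter> D v)}) (random_sub (\<Union>v\<in>T. D v) w) =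
    random_sub T (\<lambda>v. measure_pmf.prob (random_sub (D v) w) {Y. Q v Y})"
  using assms
proof (induction T rule: finite_induct)
  case empty
  then show ?case by simp
next
  case (insert x T)
  let ?R = "random_sub (\<Union>v\<in>T. D v) w"
  let ?\<pi> = "\<lambda>v. measure_pmf.prob (random_sub (D v) w) {Y. Q v Y}"
  have IH: "map_pmf (\<lambda>X. {v \<in> T. Q v (X \<inter> D v)}) ?R = random_sub T ?\<pi>"
    by (rule insert.IH) (use insert.prems in auto)
  have disj: "D x \<inter> (\<Union>v\<in>T. D v) = {}"
    using insert.prems(2)[of x] insert.hyps(2) by auto
  have "random_sub (\<Union>v\<in>insert x T. D v) w =
    bind_pmf (random_sub (D x) w) (\<lambda>X. map_pmf (\<lambda>Y. X \<union> Y) ?R)"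
    using random_sub_union[of "D x" "\<Union>v\<in>T. D v" w] disj insert by auto
  then have "map_pmf (\<lambda>X. {v \<in> insert x T. Q v (X \<inter> D v)}) (random_sub (\<Union>v\<in>insert x T. D v) w) =
    bind_pmf (random_sub (D x) w) (\<lambda>X. map_pmf (\<lambda>Y. {v \<in> insert x T. Q v ((X \<union> Y) \<inter> D v)}) ?R)"
    by (simp add: map_bind_pmf map_pmf_comp)
  also have "\<dots> = bind_pmf (random_sub (D x) w) (\<lambda>X. map_pmf (\<lambda>Y.
      if Q x X then insert x {v \<in> T. Q v (Y \<inter> D v)} else {v \<in> T. Q v (Y \<inter> D v)}) ?R)"
  proof (intro bind_pmf_cong refl map_pmf_cong)
    fix X Y assume "X \<in> set_pmf (random_sub (D x) w)" "Y \<in> set_pmf ?R"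
    then have XY: "X \<subseteq> D x" "Y \<subseteq> (\<Union>v\<in>T. D v)" by (auto dest: set_random_subD)
    have 1: "(X \<union> Y) \<inter> D x = X" using XY disj by auto
    have 2: "(X \<union> Y) \<inter> D v = Y \<inter> D v" if "v \<in> T" for v
      using XY disj that by auto
    show "{v \<in> insert x T. Q v ((X \<union> Y) \<inter> D v)} =
       (if Q x X then insert x {v \<in> T. Q v (Y \<inter> D v)} else {v \<in> T. Q v (Y \<inter> D v)})"
      using 1 2 by auto
  qed
  also have "\<dots> = bind_pmf (map_pmf (Q x) (random_sub (D x) w)) (\<lambda>b. map_pmf (\<lambda>Y.
      if b then insert x Y else Y) (map_pmf (\<lambda>X. {v \<in> T. Q v (X \<inter> D v)}) ?R))"
    by (simp add: bind_map_pmf map_pmf_comp if_distrib cong: if_cong)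
  also have "map_pmf (Q x) (random_sub (D x) w) = bernoulli_pmf (?\<pi> x)"
  proof (rule pmf_eqI)
    fix b
    have "pmf (map_pmf (Q x) (random_sub (D x) w)) True = ?\<pi> x"
      by (simp add: pmf_map vimage_def)
    moreover have "pmf (map_pmf (Q x) (random_sub (D x) w)) False = 1 - ?\<pi> x"
    proof -
      have "- {Y. Q x Y} = {Y. \<not> Q x Y}" by auto
      then show ?thesis
        using measure_pmf.prob_compl[of "{Y. Q x Y}" "random_sub (D x) w"]
        by (simp add: pmf_map vimage_def Compl_eq_Diff_UNIV)
    qed
    ultimately show "pmf (map_pmf (Q x) (random_sub (D x) w)) b = pmf (bernoulli_pmf (?\<pi> x)) b"
      by (cases b) (auto simp: pmf_bernoulli_True pmf_bernoulli_False)
  qed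
  also have "bind_pmf (bernoulli_pmf (?\<pi> x)) (\<lambda>b. map_pmf (\<lambda>Y.
      if b then insert x Y else Y) (map_pmf (\<lambda>X. {v \<in> T. Q v (X \<inter> D v)}) ?R)) = random_sub (insert x T) ?\<pi>"
    unfolding IH by (rule random_sub_insert[symmetric]) (use insert in auto)
  finally show ?case .
qed

section \<open>Sequential draws, monotonicity and concentration\<close>

text \<open>Failure probabilities add along successive draws, with no independence between them: the
  second bound only has to hold conditionally on every good first outcome.\<close>

lemma prob_bind_pmf_ge:
  assumes "measure_pmf.prob M A \<ge> 1 - a" "a \<ge> 0" "b \<ge> 0"
    and "\<And>x. x \<in> set_pmf M \<Longrightarrow> x \<in> A \<Longrightarrow> measure_pmf.prob (f x) B \<ge> 1 - b"
  shows "measure_pmf.prob (bind_pmf M f) B \<ge> 1 - a - b"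
\<comment> \<open>For \<open>b > 1\<close> the claimed bound is negative. For
  \<open>b \<le> 1\<close> the factor \<open>1 - b\<close> is nonnegative, which the monotonicity
  arguments require.\<close>
proof (cases "b \<le> 1")
  case False
  then show ?thesis using measure_nonneg[of "measure_pmf (bind_pmf M f)" B] assms by linarith
next
  case True
  have "measure_pmf.prob (bind_pmf M f) B = measure_pmf.expectation M (\<lambda>x. measure_pmf.prob (f x) B)"
    unfolding measure_pmf_bind
    by (subst measure_pmf.measure_bind[where N = "count_space UNIV"])
       (auto simp: space_subprob_algebra intro!: measure_pmf.subprob_space_axioms)
  also have "\<dots> \<ge> measure_pmf.expectation M (\<lambda>x. (1 - b) * indicator A x)"
    by (intro integral_mono_AE measure_pmf.integrable_const_bound[where B = 1])
       (use assms True in \<open>auto simp: AE_measure_pmf_iff indicator_def\<close>)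
  also have "measure_pmf.expectation M (\<lambda>x. (1 - b) * indicator A x) = (1 - b) * measure_pmf.prob M A"
    by simp
  also have "(1 - b) * measure_pmf.prob M A \<ge> (1 - b) * (1 - a)"
    using assms True by (intro mult_left_mono) auto
  also have "(1 - b) * (1 - a) \<ge> 1 - a - b"
    using assms by (simp add: algebra_simps)
  finally show ?thesis by simp
qed

lemma prob_bind_bernoulli:
  assumes "0 \<le> r" "r \<le> 1"
  shows "measure_pmf.prob (bind_pmf (bernoulli_pmf r) f) B =
    r * measure_pmf.prob (f True) B + (1 - r) * measure_pmf.prob (f False) B"
proof -
  have "measure_pmf.prob (bind_pmf (bernoulli_pmf r) f) B =
      measure_pmf.expectation (bernoulli_pmf r) (\<lambda>x. measure_pmf.prob (f x) B)"
    unfolding measure_pmf_bind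
    by (subst measure_pmf.measure_bind[where N = "count_space UNIV"])
       (auto simp: space_subprob_algebra intro!: measure_pmf.subprob_space_axioms)
  then show ?thesis using assms by simp
qed

text \<open>Induction takes the place of a coupling. Conditioning on one element replaces the
  threshold \<open>s\<close> by the weaker \<open>s - 1\<close> when the element is present, so a
  larger weight favours the event; \<open>s\<close> therefore varies in the induction.\<close>

lemma random_sub_card_mono:
  fixes s :: real
  assumes "finite A" "\<And>x. x \<in> A \<Longrightarrow> 0 \<le> w x \<and> w x \<le> w' x \<and> w' x \<le> 1"
  shows "measure_pmf.prob (random_sub A w) {X. s \<le> real (card X)} \<le>
         measure_pmf.prob (random_sub A w') {X. s \<le> real (card X)}"
  using assms
proof (induction A arbitrary: s rule: finite_induct)
  case empty
  then show ?case by simp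
next
  case (insert x A)
  define F where "F w s = measure_pmf.prob (random_sub A w) {X. s \<le> real (card X)}" for w s
  have step: "measure_pmf.prob (random_sub (insert x A) u) {X. s \<le> real (card X)} =
     u x * F u (s - 1) + (1 - u x) * F u s" if "0 \<le> u x" "u x \<le> 1" for u
  proof -
    have "measure_pmf.prob (map_pmf (insert x) (random_sub A u)) {X. s \<le> real (card X)} = F u (s - 1)"
      unfolding F_def measure_map_pmf
    proof (rule measure_pmf.finite_measure_eq_AE)
      show "AE X in measure_pmf (random_sub A u).
        (X \<in> insert x -` {X. s \<le> real (card X)}) = (X \<in> {X. s - 1 \<le> real (card X)})"
        unfolding AE_measure_pmf_iff
      proof
        fix X assume "X \<in> set_pmf (random_sub A u)"
        then have "X \<subseteq> A" by (rule set_random_subD)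
        then have "finite X" "x \<notin> X" using insert.hyps finite_subset by auto
        then show "(X \<in> insert x -` {X. s \<le> real (card X)}) = (X \<in> {X. s - 1 \<le> real (card X)})"
          by auto
      qed
    qed auto
    then show ?thesis
      unfolding random_sub_insert[OF insert.hyps] using that
      by (subst prob_bind_bernoulli) (simp_all add: F_def)
  qed
  have IH: "F w r \<le> F w' r" for r
    unfolding F_def by (rule insert.IH) (use insert.prems in auto)
  have mono: "F w s \<le> F w (s - 1)"
    unfolding F_def by (rule measure_pmf.finite_measure_mono) auto
  \<comment> \<open>In this form the coefficient of \<open>w x\<close> is nonnegative, so
    \<open>w x\<close> may be raised to \<open>w' x\<close> first; the induction hypothesis then
    changes the weights of the other elements.\<close>
  have "w x * F w (s - 1) + (1 - w x) * F w s = F w s + w x * (F w (s - 1) - F w s)"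
    by (simp add: algebra_simps)
  also have "\<dots> \<le> F w s + w' x * (F w (s - 1) - F w s)"
    using insert.prems[of x] mono by (intro add_left_mono mult_right_mono) auto
  also have "\<dots> = w' x * F w (s - 1) + (1 - w' x) * F w s"
    by (simp add: algebra_simps)
  also have "\<dots> \<le> w' x * F w' (s - 1) + (1 - w' x) * F w' s"
    using insert.prems[of x] IH by (intro add_mono mult_left_mono) auto
  finally show ?case
    using insert.prems[of x] by (simp add: step)
qed

text \<open>Hoeffding's inequality with any positive upper bound \<open>N\<close> in place of
  \<open>card A\<close>: later the sets are known only up to such a bound, and the empty set needs
  no separate treatment by the caller.\<close>

lemma
  fixes w :: "'a \<Rightarrow> real"
  assumes A: "finite A" "real (card A) \<le> N" "N > 0"
    and w: "\<And>x. x \<in> A \<Longrightarrow> 0 \<le> w x \<and> w x \<le> 1" and t: "t \<ge> 0"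
  shows random_sub_card_upper:
      "measure_pmf.prob (random_sub A w) {X. real (card X) < sum w A + t} \<ge> 1 - exp (-2 * t\<^sup>2 / N)"
    and random_sub_card_lower:
      "measure_pmf.prob (random_sub A w) {X. real (card X) > sum w A - t} \<ge> 1 - exp (-2 * t\<^sup>2 / N)"
proof -
  let ?P = "Pi_pmf A False (\<lambda>x. bernoulli_pmf (w x))"
  define X :: "'a \<Rightarrow> ('a \<Rightarrow> bool) \<Rightarrow> real" where "X = (\<lambda>i f. if f i then 1 else (0::real))"
  have card_eq: "real (card {x \<in> A. f x}) = (\<Sum>i\<in>A. X i f)" for f
  proof -
    have "(\<Sum>i\<in>A. X i f) = (\<Sum>i\<in>{x \<in> A. f x}. 1)"
      unfolding X_def by (intro sum.mono_neutral_cong_right) (use A in auto)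
    then show ?thesis by simp
  qed
  have ex: "measure_pmf.expectation ?P (X i) = w i" if "i \<in> A" for i
  proof -
    have "measure_pmf.expectation ?P (X i) =
      measure_pmf.expectation (map_pmf (\<lambda>f. f i) ?P) (\<lambda>b. if b then 1 else 0 :: real)"
      by (simp add: X_def)
    also have "map_pmf (\<lambda>f. f i) ?P = bernoulli_pmf (w i)"
      using that A by (simp add: Pi_pmf_component)
    finally show ?thesis using w[OF that] by simp
  qed
  interpret H: Hoeffding_ineq ?P A X "\<lambda>_. 0" "\<lambda>_. 1" "sum w A"
  proof unfold_locales
    show "prob_space.indep_vars (measure_pmf ?P) (\<lambda>_. borel) X A"
      unfolding X_def
      by (intro prob_space.indep_vars_compose2[OF _ indep_vars_Pi_pmf])
       (auto simp: measure_pmf.prob_space_axioms A)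
    show "sum w A \<equiv> \<Sum>i\<in>A. measure_pmf.expectation ?P (X i)"
      using ex by (intro eq_reflection) simp
  qed (auto simp: A X_def)
  have bd: "exp (-2 * t\<^sup>2 / real (card A)) \<le> exp (-2 * t\<^sup>2 / N)" if "A \<noteq> {}"
  proof -
    have "card A > 0" using A that by (simp add: card_gt_0_iff)
    then have "2 * t\<^sup>2 / N \<le> 2 * t\<^sup>2 / real (card A)"
      using A by (intro divide_left_mono) auto
    then show ?thesis by simp
  qed
  show "measure_pmf.prob (random_sub A w) {X. real (card X) < sum w A + t} \<ge> 1 - exp (-2 * t\<^sup>2 / N)"
  proof (cases "A = {}")
    case True
    then show ?thesis using t A by (cases "t = 0") auto
  next
    case False
    have "measure_pmf.prob ?P {f. (\<Sum>i\<in>A. X i f) \<ge> sum w A + t} \<le> exp (-2 * t\<^sup>2 / real (card A))"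
      using H.Hoeffding_ineq_ge[of t] t A False by (simp add: card_gt_0_iff)
    with bd[OF False] have *: "measure_pmf.prob ?P {f. (\<Sum>i\<in>A. X i f) \<ge> sum w A + t} \<le> exp (-2 * t\<^sup>2 / N)"
      by linarith
    have "measure_pmf.prob (random_sub A w) {X. real (card X) < sum w A + t} =
      measure_pmf.prob ?P (- {f. (\<Sum>i\<in>A. X i f) \<ge> sum w A + t})"
      unfolding random_sub_def measure_map_pmf
      by (intro arg_cong2[where f = measure] refl) (auto simp: card_eq)
    also have "\<dots> = 1 - measure_pmf.prob ?P {f. (\<Sum>i\<in>A. X i f) \<ge> sum w A + t}"
      by (subst measure_pmf.prob_compl[symmetric]) (auto simp: Compl_eq_Diff_UNIV)
    finally show ?thesis using * by linarith
  qed
  show "measure_pmf.prob (random_sub A w) {X. real (card X) > sum w A - t} \<ge> 1 - exp (-2 * t\<^sup>2 / N)"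
  proof (cases "A = {}")
    case True
    then show ?thesis using t A by (cases "t = 0") auto
  next
    case False
    have "measure_pmf.prob ?P {f. (\<Sum>i\<in>A. X i f) \<le> sum w A - t} \<le> exp (-2 * t\<^sup>2 / real (card A))"
      using H.Hoeffding_ineq_le[of t] t A False by (simp add: card_gt_0_iff)
    with bd[OF False] have *: "measure_pmf.prob ?P {f. (\<Sum>i\<in>A. X i f) \<le> sum w A - t} \<le> exp (-2 * t\<^sup>2 / N)"
      by linarith
    have "measure_pmf.prob (random_sub A w) {X. real (card X) > sum w A - t} =
      measure_pmf.prob ?P (- {f. (\<Sum>i\<in>A. X i f) \<le> sum w A - t})"
      unfolding random_sub_def measure_map_pmf
      by (intro arg_cong2[where f = measure] refl) (auto simp: card_eq)
    also have "\<dots> = 1 - measure_pmf.prob ?P {f. (\<Sum>i\<in>A. X i f) \<le> sum w A - t}"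
      by (subst measure_pmf.prob_compl[symmetric]) (auto simp: Compl_eq_Diff_UNIV)
    finally show ?thesis using * by linarith
  qed
qed

section \<open>The Gaussian tail and the central limit theorem\<close>

interpretation std_normal: real_distribution std_normal_distribution
  by (rule real_dist_normal_dist)

lemma std_normal_measure_singleton: "measure std_normal_distribution {x} = 0"
proof -
  have "emeasure std_normal_distribution {x} = (\<integral>\<^sup>+y. ennreal (std_normal_density y) * indicator {x} y \<partial>lborel)"
    by (rule emeasure_density) auto
  also have "\<dots> = (\<integral>\<^sup>+y. 0 \<partial>(lborel :: real measure))"
    by (rule nn_integral_cong_AE) (use AE_lborel_singleton[of x] in eventually_elim, auto)
  finally show ?thesis by (simp add: measure_def)
qed

lemma isCont_gaussian_tail: "isCont gaussian_tail x"
  unfolding gaussian_tail_def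
  using std_normal.isCont_cdf[of x] std_normal_measure_singleton[of x]
  by (auto intro!: continuous_intros)

text \<open>The density is positive, so an interval of measure zero would be Lebesgue null.
  Strictness is what turns a gain in the planted ratio into a gain in the survival rate.\<close>

lemma gaussian_tail_strict_antimono:
  assumes "x < y"
  shows "gaussian_tail y < gaussian_tail x"
proof -
  have "measure std_normal_distribution {x<..y} \<noteq> 0"
  proof
    assume "measure std_normal_distribution {x<..y} = 0"
    then have "emeasure std_normal_distribution {x<..y} = 0"
      by (simp add: std_normal.emeasure_eq_measure)
    then have "(\<integral>\<^sup>+z. ennreal (std_normal_density z) * indicator {x<..y} z \<partial>lborel) = 0"
      by (subst (asm) emeasure_density) auto
    then have "AE z in lborel. ennreal (std_normal_density z) * indicator {x<..y} z = 0"
      by (subst (asm) nn_integral_0_iff_AE) auto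
    then have "AE z in lborel. z \<notin> {x<..y}"
    proof eventually_elim
      case (elim z)
      then show ?case
        using normal_density_pos[of 1 0 z] by (auto simp: indicator_def ennreal_eq_0_iff split: if_splits)
    qed
    then have "emeasure lborel {x<..y} = 0"
      by (subst (asm) AE_iff_measurable[where N = "{x<..y}"]) auto
    then show False using assms by simp
  qed
  then have "measure std_normal_distribution {x<..y} > 0"
    using measure_nonneg[of std_normal_distribution "{x<..y}"] by linarith
  then show ?thesis
    using std_normal.cdf_diff_eq[OF assms] by (simp add: gaussian_tail_def)
qed

lemma gaussian_tail_pos: "gaussian_tail x > 0"
  using gaussian_tail_strict_antimono[of x "x + 1"] std_normal.cdf_bounded_prob[of "x + 1"]
  by (simp add: gaussian_tail_def)

lemma gaussian_tail_less_1: "gaussian_tail x < 1"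
  using gaussian_tail_strict_antimono[of "x - 1" x] std_normal.cdf_nonneg[of "x - 1"]
  by (simp add: gaussian_tail_def)

lemma gaussian_tail_at_bot: "(gaussian_tail \<longlongrightarrow> 1) at_bot"
  unfolding gaussian_tail_def
  using tendsto_diff[OF tendsto_const[of 1] std_normal.cdf_lim_at_bot] by simp

text \<open>The central limit theorem concerns one infinite independent sequence, whereas each
  \<open>Pi_pmf\<close> lives on finitely many coordinates. The infinite product \<open>M\<close>
  supplies the sequence, and only the laws of its partial sums are transferred.\<close>

lemma weak_conv_bernoulli_sums:
  fixes p :: real
  assumes "0 < p" "p < 1"
  shows "weak_conv_m (\<lambda>n. distr (measure_pmf (Pi_pmf {..<n} False (\<lambda>_. bernoulli_pmf p))) borel
    (\<lambda>f. ((\<Sum>i<n. if f i then 1 else 0) - real n * p) / sqrt (real n * (p * (1 - p))))) std_normal_distribution"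
proof -
  define B where "B = (\<lambda>i::nat. measure_pmf (bernoulli_pmf p))"
  define M where "M = PiM UNIV B"
  define X :: "nat \<Rightarrow> (nat \<Rightarrow> bool) \<Rightarrow> real" where "X = (\<lambda>i f. if f i then 1 else 0)"
  define D where "D = distr (measure_pmf (bernoulli_pmf p)) borel (\<lambda>b. if b then 1 else (0::real))"
  interpret P: product_prob_space B UNIV
    unfolding B_def by unfold_locales
  interpret M: prob_space M
    unfolding M_def B_def by (intro prob_space_PiM measure_pmf.prob_space_axioms)
  have comp_meas: "(\<lambda>f. f i) \<in> measurable M (count_space UNIV)" for i
    using measurable_component_singleton[of i UNIV B] by (simp add: M_def B_def measurable_def)
  have comp_distr: "distr M (B i) (\<lambda>f. f i) = B i" for i
    unfolding M_def by (rule P.PiM_component) simp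
  have cdistr: "distr M (count_space UNIV) (\<lambda>f. f i) = B i" for i
  proof -
    have "distr M (count_space UNIV) (\<lambda>f. f i) = distr M (B i) (\<lambda>f. f i)"
      by (intro distr_cong) (auto simp: B_def)
    then show ?thesis by (simp only: comp_distr)
  qed
  have Xm: "X i \<in> borel_measurable M" for i
    unfolding X_def using measurable_compose[OF comp_meas[of i], of "\<lambda>b. if b then 1 else (0::real)" borel] by simp
  have indep0: "M.indep_vars (\<lambda>_. count_space UNIV) (\<lambda>i f. f i) UNIV"
  proof (subst M.indep_vars_iff_distr_eq_PiM')
    have "distr M (PiM UNIV (\<lambda>_. count_space UNIV)) (\<lambda>x. \<lambda>i\<in>UNIV. x i) = distr M M (\<lambda>x. x)"
      by (intro distr_cong) (auto simp: M_def B_def restrict_def intro!: sets_PiM_cong)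
    also have "\<dots> = M" by (simp add: distr_id2)
    finally show "distr M (PiM UNIV (\<lambda>_. count_space UNIV)) (\<lambda>x. \<lambda>i\<in>UNIV. x i) =
      PiM UNIV (\<lambda>i. distr M (count_space UNIV) (\<lambda>f. f i))"
      unfolding cdistr by (simp add: M_def)
  qed (use comp_meas in auto)
  have indep: "M.indep_vars (\<lambda>_. borel) X UNIV"
    unfolding X_def by (rule M.indep_vars_compose2[OF indep0]) auto
  have XD: "distr M borel (X i) = D" for i
  proof -
    have "D = distr (distr M (count_space UNIV) (\<lambda>f. f i)) borel (\<lambda>b. if b then 1 else (0::real))"
      unfolding D_def cdistr by (simp add: B_def)
    also have "\<dots> = distr M borel (X i)"
      by (subst distr_distr) (auto simp: comp_meas X_def o_def)
    finally show ?thesis by simp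
  qed
  have int_eq: "integral\<^sup>L M (\<lambda>x. g (X i x)) = p * g 1 + (1 - p) * g 0" if "g \<in> borel_measurable borel"
    for g :: "real \<Rightarrow> real" and i
  proof -
    have "integral\<^sup>L M (\<lambda>x. g (X i x)) = integral\<^sup>L D g"
      using integral_distr[OF Xm[of i] that] XD by simp
    also have "\<dots> = integral\<^sup>L (bernoulli_pmf p) (\<lambda>b. g (if b then 1 else 0))"
      unfolding D_def by (rule integral_distr) (use that in auto)
    also have "\<dots> = p * g 1 + (1 - p) * g 0" using assms by simp
    finally show ?thesis .
  qed
  have E: "M.expectation (X i) = p" for i
    using int_eq[of "\<lambda>x. x" i] by simp
  have V: "M.variance (X i) = (sqrt (p * (1 - p)))\<^sup>2" for i
    using int_eq[of "\<lambda>x. (x - p)\<^sup>2" i] assms unfolding E by (simp add: power2_eq_square algebra_simps)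
  have sq: "integrable M (\<lambda>x. (X i x)\<^sup>2)" for i
    using Xm[of i] by (intro M.integrable_const_bound[where B = 1]) (auto simp: X_def)
  have "weak_conv_m (\<lambda>n. distr M borel (\<lambda>x. (\<Sum>i<n. X i x - p) / sqrt (real n * (sqrt (p * (1 - p)))\<^sup>2))) std_normal_distribution"
    by (rule M.central_limit_theorem[where \<mu> = D]) (use assms indep E V sq XD in auto)
  moreover have "distr M borel (\<lambda>x. (\<Sum>i<n. X i x - p) / sqrt (real n * (sqrt (p * (1 - p)))\<^sup>2)) =
    distr (measure_pmf (Pi_pmf {..<n} False (\<lambda>_. bernoulli_pmf p))) borel
    (\<lambda>f. ((\<Sum>i<n. if f i then 1 else 0) - real n * p) / sqrt (real n * (p * (1 - p))))" for n
  proof -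
    let ?P = "Pi_pmf {..<n} False (\<lambda>_. bernoulli_pmf p)"
    have PX: "distr ?P borel (X i) = D" if "i < n" for i
    proof -
      have "distr ?P borel (X i) = distr (map_pmf (\<lambda>f. f i) ?P) borel (\<lambda>b. if b then 1 else 0)"
        unfolding map_pmf_rep_eq by (subst distr_distr) (auto simp: o_def X_def)
      also have "map_pmf (\<lambda>f. f i) ?P = bernoulli_pmf p"
        using that by (subst Pi_pmf_component) auto
      finally show ?thesis by (simp add: D_def)
    qed
    have Pindep: "prob_space.indep_vars ?P (\<lambda>_. borel) X {..<n}"
      unfolding X_def
      by (intro prob_space.indep_vars_compose2[OF _ indep_vars_Pi_pmf])
         (auto simp: measure_pmf.prob_space_axioms)
    have Mindep: "M.indep_vars (\<lambda>_. borel) X {..<n}"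
      by (rule M.indep_vars_subset[OF indep]) auto
    \<comment> \<open>On both spaces this is a sum of \<open>n\<close> independent variables with
      law \<open>D\<close>, so the characteristic functions coincide.\<close>
    have "distr M borel (\<lambda>x. \<Sum>i<n. X i x) = distr ?P borel (\<lambda>x. \<Sum>i<n. X i x)"
    proof (rule Levy_uniqueness)
      show "real_distribution (distr M borel (\<lambda>x. \<Sum>i<n. X i x))"
        using Xm by (intro M.real_distribution_distr) auto
      show "real_distribution (distr (measure_pmf ?P) borel (\<lambda>x. \<Sum>i<n. X i x))"
        by (intro prob_space.real_distribution_distr measure_pmf.prob_space_axioms) auto
      show "char (distr M borel (\<lambda>x. \<Sum>i<n. X i x)) = char (distr ?P borel (\<lambda>x. \<Sum>i<n. X i x))"
        unfolding M.char_distr_sum[OF Mindep] prob_space.char_distr_sum[OF measure_pmf.prob_space_axioms Pindep] fun_eq_iff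
        by (simp add: XD PX)
    qed
    then have "distr (distr M borel (\<lambda>x. \<Sum>i<n. X i x)) borel (\<lambda>s. (s - real n * p) / sqrt (real n * (p * (1 - p)))) =
      distr (distr ?P borel (\<lambda>x. \<Sum>i<n. X i x)) borel (\<lambda>s. (s - real n * p) / sqrt (real n * (p * (1 - p))))"
      by simp
    then show ?thesis
      using Xm assms by (subst (asm) (1 2) distr_distr) (auto simp: o_def sum_subtractf X_def)
  qed
  ultimately show ?thesis by simp
qed

text \<open>Weak convergence speaks of strict inequalities at fixed points. The event with threshold
  \<open>y n\<close> is squeezed between such events at points \<open>z\<close> on either side of
  \<open>x\<close>, and continuity of the tail lets \<open>z\<close> approach
  \<open>x\<close>.\<close>

lemma binomial_clt:
  fixes p x :: real and y :: "nat \<Rightarrow> real"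
  assumes "0 < p" "p < 1" and y: "y \<longlonglongrightarrow> x"
  shows "(\<lambda>n. measure_pmf.prob (binomial_pmf n p) {j. p * real n + y n * sqrt (p * (1 - p) * real n) \<le> real j})
    \<longlonglongrightarrow> gaussian_tail x"
proof -
  define Z where "Z n f = ((\<Sum>i<n. if f i then 1 else 0) - real n * p) / sqrt (real n * (p * (1 - p)))"
    for n and f :: "nat \<Rightarrow> bool"
  define P where "P n = Pi_pmf {..<n} False (\<lambda>_::nat. bernoulli_pmf p)" for n
  define b where "b n = measure_pmf.prob (binomial_pmf n p) {j. p * real n + y n * sqrt (p * (1 - p) * real n) \<le> real j}" for n
  have b_eq: "b n = measure_pmf.prob (P n) {f. y n \<le> Z n f}" if "n > 0" for n
  proof -
    have pos: "sqrt (p * (1 - p) * real n) > 0" using assms that by simp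
    have "binomial_distribution p" using assms by unfold_locales auto
    then have "b n = measure_pmf.prob (P n)
       {f. p * real n + y n * sqrt (p * (1 - p) * real n) \<le> (\<Sum>i<n. if f i then 1 else 0)}"
      unfolding b_def P_def by (rule binomial_distribution.prob_binomial_pmf_conv_coins) fact
    also have "{f. p * real n + y n * sqrt (p * (1 - p) * real n) \<le> (\<Sum>i<n. if f i then 1 else 0)} = {f. y n \<le> Z n f}"
      unfolding Z_def using pos by (subst pos_le_divide_eq) (auto simp: mult_ac)
    finally show ?thesis .
  qed
  have lim: "(\<lambda>n. measure_pmf.prob (P n) {f. Z n f > z}) \<longlonglongrightarrow> gaussian_tail z" for z
  proof -
    have "isCont (cdf std_normal_distribution) z"
      using std_normal.isCont_cdf std_normal_measure_singleton by simp
    then have "(\<lambda>n. cdf (distr (measure_pmf (P n)) borel (Z n)) z) \<longlonglongrightarrow> cdf std_normal_distribution z"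
      using weak_conv_bernoulli_sums[OF assms(1,2)]
      unfolding weak_conv_m_def weak_conv_def P_def Z_def by blast
    then have "(\<lambda>n. 1 - cdf (distr (measure_pmf (P n)) borel (Z n)) z) \<longlonglongrightarrow> gaussian_tail z"
      unfolding gaussian_tail_def by (intro tendsto_intros)
    also have "(\<lambda>n. 1 - cdf (distr (measure_pmf (P n)) borel (Z n)) z) = (\<lambda>n. measure_pmf.prob (P n) {f. Z n f > z})"
    proof
      fix n
      have "cdf (distr (measure_pmf (P n)) borel (Z n)) z = measure_pmf.prob (P n) {f. Z n f \<le> z}"
        by (simp add: cdf_def measure_distr vimage_def)
      then show "1 - cdf (distr (measure_pmf (P n)) borel (Z n)) z = measure_pmf.prob (P n) {f. Z n f > z}"
        using measure_pmf.prob_compl[of "{f. Z n f \<le> z}" "P n"]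
        by (simp add: Collect_neg_eq[symmetric] Compl_eq_Diff_UNIV[symmetric] not_le)
    qed
    finally show ?thesis .
  qed
  have "b \<longlonglongrightarrow> gaussian_tail x"
  proof (rule order_tendstoI)
    fix a assume a: "a < gaussian_tail x"
    have "\<forall>\<^sub>F z in at x. a < gaussian_tail z"
      using isCont_gaussian_tail[of x] a unfolding isCont_def by (rule order_tendstoD)
    then have "\<forall>\<^sub>F z in at_right x. a < gaussian_tail z"
      using filter_leD[OF at_le[of "{x<..}" UNIV x]] by simp
    moreover have "\<forall>\<^sub>F z in at_right x. x < z" by (rule eventually_at_right_less)
    ultimately obtain z where z: "x < z" "a < gaussian_tail z"
      using eventually_happens'[of "at_right x" "\<lambda>z. a < gaussian_tail z \<and> x < z"] eventually_conj
      by fastforce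
    have "\<forall>\<^sub>F n in sequentially. a < measure_pmf.prob (P n) {f. Z n f > z}"
      using lim z(2) by (rule order_tendstoD)
    moreover have "\<forall>\<^sub>F n in sequentially. y n < z"
      using y z(1) by (rule order_tendstoD)
    ultimately show "\<forall>\<^sub>F n in sequentially. a < b n"
      using eventually_gt_at_top[of 0]
    proof eventually_elim
      case (elim n)
      have "measure_pmf.prob (P n) {f. Z n f > z} \<le> measure_pmf.prob (P n) {f. y n \<le> Z n f}"
        by (rule measure_pmf.finite_measure_mono) (use elim in auto)
      then show ?case using elim b_eq by simp
    qed
  next
    fix a assume a: "a > gaussian_tail x"
    have "\<forall>\<^sub>F z in at x. a > gaussian_tail z"
      using isCont_gaussian_tail[of x] a unfolding isCont_def by (rule order_tendstoD)
    then have "\<forall>\<^sub>F z in at_left x. a > gaussian_tail z"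
      using filter_leD[OF at_le[of "{..<x}" UNIV x]] by simp
    moreover have "\<forall>\<^sub>F z in at_left x. z < x" by (simp add: eventually_at_filter)
    ultimately obtain z where z: "z < x" "a > gaussian_tail z"
      using eventually_happens'[of "at_left x" "\<lambda>z. a > gaussian_tail z \<and> z < x"] eventually_conj
      by fastforce
    have "\<forall>\<^sub>F n in sequentially. a > measure_pmf.prob (P n) {f. Z n f > z}"
      using lim z(2) by (rule order_tendstoD)
    moreover have "\<forall>\<^sub>F n in sequentially. y n > z"
      using y z(1) by (rule order_tendstoD)
    ultimately show "\<forall>\<^sub>F n in sequentially. a > b n"
      using eventually_gt_at_top[of 0]
    proof eventually_elim
      case (elim n)
      have "measure_pmf.prob (P n) {f. Z n f > z} \<ge> measure_pmf.prob (P n) {f. y n \<le> Z n f}"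
        by (rule measure_pmf.finite_measure_mono) (use elim in auto)
      then show ?case using elim b_eq by simp
    qed
  qed
  then show ?thesis unfolding b_def .
qed

section \<open>A strict gap between \<open>rho\<close> and \<open>sqrt tau\<close> above
  \<open>c0\<close>\<close>

text \<open>Two points must be settled before the definitions can be used: the infimum runs over a
  nonempty set, and the least admissible \<open>c\<close> exists, since \<open>LEAST\<close> over
  the reals says nothing otherwise. Strict monotonicity beyond that least value then gives the
  strict inequality.\<close>

lemma rho_gt_sqrt_tau_exists:
  fixes x :: real
  assumes "c0 < x"
  shows "\<exists>\<alpha> \<beta>. 0 < \<alpha> \<and> \<alpha> < 1 \<and> 0 < \<beta> \<and> 0 < x \<and> sqrt (tau \<alpha> \<beta>) < rho \<alpha> \<beta> x"
proof -
  let ?adm = "\<lambda>\<alpha> \<beta> c. 0 < c \<and> rho \<alpha> \<beta> c \<ge> sqrt (tau \<alpha> \<beta>)"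
  let ?S = "{c_tilde \<alpha> \<beta> | \<alpha> \<beta>. 0 < \<alpha> \<and> \<alpha> < 1 \<and> 0 < \<beta> \<and>
                (\<exists>c>0. rho \<alpha> \<beta> c \<ge> sqrt (tau \<alpha> \<beta>))}"
  have "?S \<noteq> {}"
  proof -
    define g where "g = gaussian_tail 1"
    have g: "0 < g" "g < 1" unfolding g_def by (rule gaussian_tail_pos gaussian_tail_less_1)+
    \<comment> \<open>As \<open>c\<close> grows, \<open>rho\<close> tends to
      \<open>1 - \<alpha>\<close>. This limit exceeds \<open>sqrt tau\<close> precisely when
      \<open>1 - \<alpha>\<close> exceeds the tail \<open>g\<close> at \<open>\<beta> = 1\<close>,
      which this choice ensures.\<close>
    define \<alpha> where "\<alpha> = (1 - g) / 2"
    have \<alpha>: "0 < \<alpha>" "\<alpha> < 1" "1 - \<alpha> > g" using g by (auto simp: \<alpha>_def field_simps)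
    have lt: "sqrt (tau \<alpha> 1) < 1 - \<alpha>"
    proof -
      have "tau \<alpha> 1 < (1 - \<alpha>)\<^sup>2"
        unfolding tau_def g_def[symmetric] power2_eq_square using \<alpha> by (intro mult_strict_left_mono) auto
      then show ?thesis using \<alpha> by (simp add: real_less_lsqrt)
    qed
    have "filterlim (\<lambda>c. 1 - c * sqrt \<alpha>) at_bot at_top"
      using \<alpha> by real_asymp
    from filterlim_compose[OF gaussian_tail_at_bot this]
    have "((\<lambda>c. rho \<alpha> 1 c) \<longlongrightarrow> (1 - \<alpha>) * 1) at_top"
      unfolding rho_def by (intro tendsto_intros)
    then have "((\<lambda>c. rho \<alpha> 1 c) \<longlongrightarrow> 1 - \<alpha>) at_top" by simp
    then have "\<forall>\<^sub>F c in at_top. sqrt (tau \<alpha> 1) < rho \<alpha> 1 c"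
      using lt by (rule order_tendstoD)
    then have "\<forall>\<^sub>F c in at_top. 0 < c \<and> sqrt (tau \<alpha> 1) < rho \<alpha> 1 c"
      using eventually_gt_at_top[of 0] by eventually_elim auto
    then obtain c where "0 < c" "sqrt (tau \<alpha> 1) < rho \<alpha> 1 c"
      using eventually_happens'[OF trivial_limit_at_top_linorder] by blast
    then have "\<exists>c>0. rho \<alpha> 1 c \<ge> sqrt (tau \<alpha> 1)" by (blast intro: less_imp_le)
    then have "c_tilde \<alpha> 1 \<in> ?S"
      unfolding mem_Collect_eq using \<alpha> zero_less_one by blast
    then show ?thesis by blast
  qed
  from cInf_lessD[OF this assms[unfolded c0_def]] obtain z where "z \<in> ?S" "z < x" ..
  then obtain \<alpha> \<beta> c where ab: "0 < \<alpha>" "\<alpha> < 1" "0 < \<beta>" and c: "?adm \<alpha> \<beta> c"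
    and z: "c_tilde \<alpha> \<beta> < x" unfolding mem_Collect_eq by blast
  have cont: "continuous_on S (rho \<alpha> \<beta>)" for S
  proof -
    have "isCont (rho \<alpha> \<beta>) c" for c
      unfolding rho_def[abs_def]
      by (intro continuous_intros isCont_o2[OF _ isCont_gaussian_tail])
    then show ?thesis by (simp add: continuous_at_imp_continuous_on)
  qed
  have tau: "0 < tau \<alpha> \<beta>" "tau \<alpha> \<beta> < 1"
  proof -
    show "0 < tau \<alpha> \<beta>" unfolding tau_def using ab gaussian_tail_pos by simp
    have "(1 - \<alpha>) * gaussian_tail \<beta> < 1 * 1"
      using ab gaussian_tail_pos[of \<beta>] gaussian_tail_less_1[of \<beta>] by (intro mult_strict_mono) auto
    then show "tau \<alpha> \<beta> < 1" unfolding tau_def by simp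
  qed
  \<comment> \<open>At \<open>c = 0\<close> the rate equals \<open>tau\<close>, which lies below its
    own square root. Hence the minimum over the closed interval is not attained at 0, as the strict
    \<open>0 < c\<close> in \<open>c_tilde\<close> demands.\<close>
  have rho0: "rho \<alpha> \<beta> 0 < sqrt (tau \<alpha> \<beta>)"
  proof -
    have "tau \<alpha> \<beta> * tau \<alpha> \<beta> < tau \<alpha> \<beta>" using tau by simp
    then have "tau \<alpha> \<beta> < sqrt (tau \<alpha> \<beta>)" by (intro real_less_rsqrt) (simp add: power2_eq_square)
    then show ?thesis by (simp add: rho_def tau_def)
  qed
  \<comment> \<open>Cutting at one admissible \<open>c\<close> makes the set compact, and its
    minimum is the least admissible value overall.\<close>
  define T where "T = {u \<in> {0..c}. rho \<alpha> \<beta> u \<ge> sqrt (tau \<alpha> \<beta>)}"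
  have "compact T"
  proof -
    have "closed {u. rho \<alpha> \<beta> u \<ge> sqrt (tau \<alpha> \<beta>)}"
      by (intro closed_Collect_le cont continuous_on_const)
    then have "compact ({0..c} \<inter> {u. rho \<alpha> \<beta> u \<ge> sqrt (tau \<alpha> \<beta>)})"
      by (intro compact_Int_closed) auto
    also have "{0..c} \<inter> {u. rho \<alpha> \<beta> u \<ge> sqrt (tau \<alpha> \<beta>)} = T" by (auto simp: T_def)
    finally show ?thesis .
  qed
  moreover have "T \<noteq> {}" using c by (auto simp: T_def)
  ultimately obtain m where m: "m \<in> T" "\<And>u. u \<in> T \<Longrightarrow> m \<le> u"
    using compact_attains_inf[of T] by auto
  have "m \<noteq> 0" using m(1) rho0 by (auto simp: T_def)
  then have m0: "?adm \<alpha> \<beta> m" using m(1) by (auto simp: T_def)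
  have "c_tilde \<alpha> \<beta> = m"
    unfolding c_tilde_def
  proof (rule Least_equality)
    fix u assume u: "?adm \<alpha> \<beta> u"
    show "m \<le> u"
    proof (cases "u \<le> c")
      case True
      with u show ?thesis by (intro m(2)) (auto simp: T_def)
    next
      case False
      with m(1) show ?thesis by (auto simp: T_def)
    qed
  qed (use m0 in auto)
  with z have "m < x" by simp
  have "rho \<alpha> \<beta> m < rho \<alpha> \<beta> x"
    unfolding rho_def using ab \<open>m < x\<close>
    by (intro mult_strict_left_mono gaussian_tail_strict_antimono) auto
  then show ?thesis
    using ab m0 \<open>m < x\<close> by (meson le_less_trans less_trans)
qed

section \<open>Pass probabilities of unplanted and planted vertices\<close>

lemma random_sub_const_card:
  assumes "finite A" "0 \<le> p" "p \<le> 1"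
  shows "map_pmf card (random_sub A (\<lambda>_. p)) = binomial_pmf (card A) p"
  unfolding random_sub_def using assms
  by (subst binomial_pmf_altdef'[where A = A and dflt = False]) (auto simp: map_pmf_comp)

lemma prob_random_sub_const:
  assumes "finite A" "0 \<le> p" "p \<le> 1"
  shows "measure_pmf.prob (random_sub A (\<lambda>_. p)) {Y. P (card Y)} =
    measure_pmf.prob (binomial_pmf (card A) p) {j. P j}"
  unfolding random_sub_const_card[OF assms, symmetric] by (simp add: vimage_def)

lemma pass_prob_unplanted:
  fixes p \<beta> \<eta> :: real
  assumes "0 < p" "p < 1" "0 < \<eta>"
  shows "\<forall>\<^sub>F s in sequentially. \<forall>A::'a set. finite A \<longrightarrow> card A = s \<longrightarrow>
    measure_pmf.prob (random_sub A (\<lambda>_. p)) {Y. p * real s + \<beta> * sqrt (p * (1 - p) * real s) \<le> real (card Y)}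
      \<le> gaussian_tail \<beta> + \<eta>"
proof -
  have "\<forall>\<^sub>F s in sequentially. measure_pmf.prob (binomial_pmf s p)
      {j. p * real s + \<beta> * sqrt (p * (1 - p) * real s) \<le> real j} < gaussian_tail \<beta> + \<eta>"
    by (rule order_tendstoD[OF binomial_clt]) (use assms in auto)
  then show ?thesis
  proof eventually_elim
    case (elim s)
    then show ?case
      using assms by (auto simp: prob_random_sub_const[where P = "\<lambda>j. _ \<le> real j"])
  qed
qed

text \<open>The \<open>y * sqrt s\<close> edges of weight \<open>q\<close> raise the mean by
  \<open>y * ((q - p) / sqrt (p * (1 - p)))\<close> standard deviations. By monotonicity
  \<open>H\<close> may be cut down to exactly \<open>b s\<close> elements. Their contribution
  concentrates by Hoeffding, so the limit theorem is applied only to the other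
  \<open>s - b s\<close> edges, all of weight \<open>p\<close>. The threshold for \<open>s\<close>
  is uniform in \<open>A\<close> and \<open>H\<close>.\<close>

lemma pass_prob_planted:
  fixes p q \<beta> \<eta> y :: real
  assumes "0 < p" "p < q" "q < 1" "0 < \<eta>" "0 < y"
  shows "\<forall>\<^sub>F s in sequentially. \<forall>(A::'a set) H. finite A \<longrightarrow> card A = s \<longrightarrow> H \<subseteq> A \<longrightarrow>
    y * sqrt (real s) \<le> real (card H) \<longrightarrow>
    measure_pmf.prob (random_sub A (\<lambda>x. if x \<in> H then q else p))
      {Y. p * real s + \<beta> * sqrt (p * (1 - p) * real s) \<le> real (card Y)}
      \<ge> gaussian_tail (\<beta> - y * ((q - p) / sqrt (p * (1 - p)))) - \<eta>"
proof -
  define \<sigma> where "\<sigma> = sqrt (p * (1 - p))"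
  have \<sigma>: "\<sigma> > 0" using assms by (simp add: \<sigma>_def)
  define x where "x = \<beta> - y * ((q - p) / \<sigma>)"
  have \<sigma>x: "\<beta> * \<sigma> - (q - p) * y = \<sigma> * x" using \<sigma> by (simp add: x_def field_simps)
  \<comment> \<open>Moving from \<open>x\<close> to a slightly larger \<open>z\<close> costs only
    half of \<open>\<eta>\<close> and leaves room for errors of order o(sqrt s) in the
    threshold.\<close>
  obtain z where z: "x < z" "gaussian_tail x - \<eta> / 2 < gaussian_tail z"
  proof -
    have "\<forall>\<^sub>F z in at x. gaussian_tail x - \<eta> / 2 < gaussian_tail z"
      using isCont_gaussian_tail[of x] assms unfolding isCont_def by (intro order_tendstoD) auto
    then have "\<forall>\<^sub>F z in at_right x. gaussian_tail x - \<eta> / 2 < gaussian_tail z"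
      using filter_leD[OF at_le[of "{x<..}" UNIV x]] by simp
    moreover have "\<forall>\<^sub>F z in at_right x. x < z" by (rule eventually_at_right_less)
    ultimately have "\<forall>\<^sub>F z in at_right x. gaussian_tail x - \<eta> / 2 < gaussian_tail z \<and> x < z"
      by eventually_elim auto
    then show ?thesis
      using eventually_happens'[of "at_right x"] that by fastforce
  qed
  define b where "b s = nat \<lceil>y * sqrt (real s)\<rceil>" for s
  have b: "y * sqrt (real s) \<le> real (b s)" "real (b s) \<le> y * sqrt (real s) + 1" for s
  proof -
    have "0 \<le> \<lceil>y * sqrt (real s)\<rceil>" using assms by (simp add: zero_le_ceiling less_le_trans[of _ 0])
    then have "real (b s) = of_int \<lceil>y * sqrt (real s)\<rceil>" by (simp add: b_def)
    then show "y * sqrt (real s) \<le> real (b s)" "real (b s) \<le> y * sqrt (real s) + 1" by linarith+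
  qed
  \<comment> \<open>The exponent 3/4 lies above 1/2, so the Hoeffding failure for \<open>b s\<close>
    edges vanishes. Since \<open>b s\<close> is of order sqrt s, the deviation is of order s powr
    (3/8), negligible against sqrt s. The added 1 keeps the base positive.\<close>
  define t where "t s = (real (b s) + 1) powr (3/4)" for s
  have b_top: "filterlim (\<lambda>s. real (b s)) at_top sequentially"
  proof (rule filterlim_at_top_mono)
    show "filterlim (\<lambda>s. y * sqrt (real s)) at_top sequentially" using assms by real_asymp
  qed (use b in auto)
  have b_lim: "(\<lambda>s. real (b s) / sqrt (real s)) \<longlonglongrightarrow> y"
  proof (rule tendsto_sandwich)
    show "\<forall>\<^sub>F s in sequentially. y \<le> real (b s) / sqrt (real s)"
      using eventually_gt_at_top[of 0] by eventually_elim (use b in \<open>auto simp: field_simps\<close>)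
    show "\<forall>\<^sub>F s in sequentially. real (b s) / sqrt (real s) \<le> y + 1 / sqrt (real s)"
      using eventually_gt_at_top[of 0] by eventually_elim (use b in \<open>auto simp: field_simps\<close>)
    show "(\<lambda>s. y + 1 / sqrt (real s)) \<longlonglongrightarrow> y" by real_asymp
  qed auto
  have bs_lim: "(\<lambda>s. real (b s) / real s) \<longlonglongrightarrow> 0"
  proof (rule tendsto_sandwich)
    show "\<forall>\<^sub>F s in sequentially. 0 \<le> real (b s) / real s" by auto
    show "\<forall>\<^sub>F s in sequentially. real (b s) / real s \<le> (y * sqrt (real s) + 1) / real s"
      using b by (auto intro!: always_eventually divide_right_mono)
    show "(\<lambda>s. (y * sqrt (real s) + 1) / real s) \<longlonglongrightarrow> 0" by real_asymp
  qed auto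
  have t_lim: "(\<lambda>s. t s / sqrt (real s)) \<longlonglongrightarrow> 0"
  proof (rule tendsto_sandwich)
    show "\<forall>\<^sub>F s in sequentially. 0 \<le> t s / sqrt (real s)" by (auto simp: t_def)
    show "\<forall>\<^sub>F s in sequentially. t s / sqrt (real s) \<le> (y * sqrt (real s) + 2) powr (3/4) / sqrt (real s)"
      unfolding t_def
    proof (intro always_eventually allI divide_right_mono powr_mono2)
      fix s show "real (b s) + 1 \<le> y * sqrt (real s) + 2" using b(2)[of s] by linarith
    qed auto
    show "(\<lambda>s. (y * sqrt (real s) + 2) powr (3/4) / sqrt (real s)) \<longlonglongrightarrow> 0"
      using assms by real_asymp
  qed auto
  have N_eq: "real (s - b s) = real s - real (b s)" if "b s \<le> s" for s
    using that by simp
  have ev_b: "\<forall>\<^sub>F s in sequentially. b s \<le> s \<and> 0 < s"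
  proof -
    have "\<forall>\<^sub>F s in sequentially. real (b s) / real s < 1" using bs_lim by (rule order_tendstoD) auto
    then show ?thesis using eventually_gt_at_top[of 0] by eventually_elim (auto simp: field_simps)
  qed
  have N_top: "filterlim (\<lambda>s. s - b s) at_top sequentially"
  proof -
    have "filterlim (\<lambda>s. real s - (y * sqrt (real s) + 1)) at_top sequentially" by real_asymp
    then have "filterlim (\<lambda>s. real (s - b s)) at_top sequentially"
    proof (rule filterlim_at_top_mono)
      show "\<forall>\<^sub>F s in sequentially. real s - (y * sqrt (real s) + 1) \<le> real (s - b s)"
        using ev_b
      proof eventually_elim
        case (elim s)
        then show ?case using b(2)[of s] N_eq[of s] by linarith
      qed
    qed
    then show ?thesis
      using filterlim_sequentially_iff_filterlim_real by blast
  qed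
  \<comment> \<open>After division by \<open>sqrt s\<close>, the right side minus the left side
    tends to \<open>\<sigma> * (z - x)\<close>, which is positive.\<close>
  have thr: "\<forall>\<^sub>F s in sequentially.
     p * real s + \<beta> * (\<sigma> * sqrt (real s)) - q * real (b s) + t s \<le> p * real (s - b s) + z * (\<sigma> * sqrt (real (s - b s)))"
  proof -
    have "(\<lambda>s. z * \<sigma> * sqrt (1 - real (b s) / real s) - (\<beta> * \<sigma> - (q - p) * (real (b s) / sqrt (real s)) + t s / sqrt (real s)))
      \<longlonglongrightarrow> z * \<sigma> * sqrt (1 - 0) - (\<beta> * \<sigma> - (q - p) * y + 0)"
      by (intro tendsto_intros bs_lim b_lim t_lim)
    also have "z * \<sigma> * sqrt (1 - 0) - (\<beta> * \<sigma> - (q - p) * y + 0) = \<sigma> * (z - x)"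
      using \<sigma>x by (simp add: algebra_simps)
    finally have "\<forall>\<^sub>F s in sequentially. 0 < z * \<sigma> * sqrt (1 - real (b s) / real s) - (\<beta> * \<sigma> - (q - p) * (real (b s) / sqrt (real s)) + t s / sqrt (real s))"
      by (rule order_tendstoD) (use z \<sigma> in simp)
    then show ?thesis using ev_b
    proof eventually_elim
      case (elim s)
      then have s: "s > 0" "b s \<le> s" by auto
      have "sqrt (real (s - b s)) = sqrt (real s * (1 - real (b s) / real s))"
        using s by (intro arg_cong[where f = sqrt]) (simp add: field_simps)
      also have "\<dots> = sqrt (real s) * sqrt (1 - real (b s) / real s)" by (rule real_sqrt_mult)
      finally have 1: "sqrt (real (s - b s)) = sqrt (real s) * sqrt (1 - real (b s) / real s)" .
      have 2: "z * \<sigma> * sqrt (real (s - b s)) - (\<beta> * \<sigma> * sqrt (real s) - (q - p) * real (b s) + t s)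
        = sqrt (real s) * (z * \<sigma> * sqrt (1 - real (b s) / real s) - (\<beta> * \<sigma> - (q - p) * (real (b s) / sqrt (real s)) + t s / sqrt (real s)))"
        unfolding 1 using s by (simp add: field_simps)
      have "0 < z * \<sigma> * sqrt (real (s - b s)) - (\<beta> * \<sigma> * sqrt (real s) - (q - p) * real (b s) + t s)"
        unfolding 2 using elim s by (intro mult_pos_pos) auto
      then show ?case unfolding N_eq[OF s(2)] by (simp add: algebra_simps)
    qed
  qed
  have lim1: "\<forall>\<^sub>F s in sequentially. gaussian_tail x - \<eta> / 2 <
    measure_pmf.prob (binomial_pmf (s - b s) p) {j. p * real (s - b s) + z * sqrt (p * (1 - p) * real (s - b s)) \<le> real j}"
  proof (rule order_tendstoD)
    show "(\<lambda>s. measure_pmf.prob (binomial_pmf (s - b s) p)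
       {j. p * real (s - b s) + z * sqrt (p * (1 - p) * real (s - b s)) \<le> real j}) \<longlonglongrightarrow> gaussian_tail z"
      by (rule filterlim_compose[OF binomial_clt[OF assms(1) _ tendsto_const] N_top]) (use assms in auto)
  qed (rule z(2))
  have lim2: "\<forall>\<^sub>F s in sequentially. exp (-2 * (t s)\<^sup>2 / (real (b s) + 1)) < \<eta> / 2"
  proof (rule order_tendstoD)
    have "((\<lambda>u::real. exp (-2 * ((u + 1) powr (3/4))\<^sup>2 / (u + 1))) \<longlongrightarrow> 0) at_top" by real_asymp
    from filterlim_compose[OF this b_top]
    show "(\<lambda>s. exp (-2 * (t s)\<^sup>2 / (real (b s) + 1))) \<longlonglongrightarrow> 0" unfolding t_def .
  qed (use assms in auto)
  from thr lim1 lim2 show ?thesis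
  proof eventually_elim
    case (elim s)
    show ?case
    proof (intro allI impI)
      fix A H :: "'a set"
      assume A: "finite A" "card A = s" "H \<subseteq> A" "y * sqrt (real s) \<le> real (card H)"
      have "b s \<le> card H" using A(4) by (simp add: b_def nat_le_iff ceiling_le_iff)
      then obtain H' where H': "H' \<subseteq> H" "card H' = b s"
        by (meson obtain_subset_with_card_n)
      have fin: "finite H'" "finite (A - H')" using A H' by (auto intro: finite_subset)
      have cd: "card (A - H') = s - b s"
        using A H' fin by (subst card_Diff_subset) auto
      let ?w = "\<lambda>x. if x \<in> H' then q else p"
      let ?T = "p * real s + \<beta> * sqrt (p * (1 - p) * real s)"
      have T: "?T = p * real s + \<beta> * (\<sigma> * sqrt (real s))" by (simp add: \<sigma>_def real_sqrt_mult)
      have "random_sub (H' \<union> (A - H')) ?w =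
        bind_pmf (random_sub H' ?w) (\<lambda>X. map_pmf (\<lambda>Y. X \<union> Y) (random_sub (A - H') ?w))"
        using fin by (intro random_sub_union) auto
      moreover have "H' \<union> (A - H') = A" using A H' by auto
      moreover have "random_sub H' ?w = random_sub H' (\<lambda>_. q)" by (rule random_sub_cong) auto
      moreover have "random_sub (A - H') ?w = random_sub (A - H') (\<lambda>_. p)" by (rule random_sub_cong) auto
      ultimately have split: "random_sub A ?w =
        bind_pmf (random_sub H' (\<lambda>_. q)) (\<lambda>X. map_pmf (\<lambda>Y. X \<union> Y) (random_sub (A - H') (\<lambda>_. p)))"
        by simp
      define \<pi> where "\<pi> = measure_pmf.prob (binomial_pmf (s - b s) p) {j. p * real (s - b s) + z * sqrt (p * (1 - p) * real (s - b s)) \<le> real j}"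
      have "measure_pmf.prob (random_sub A ?w) {Y. ?T \<le> real (card Y)} \<ge>
         1 - exp (-2 * (t s)\<^sup>2 / (real (b s) + 1)) - (1 - \<pi>)"
        unfolding split
      proof (rule prob_bind_pmf_ge)
        have "measure_pmf.prob (random_sub H' (\<lambda>_. q)) {X. real (card X) > sum (\<lambda>_. q) H' - t s}
          \<ge> 1 - exp (-2 * (t s)\<^sup>2 / (real (b s) + 1))"
          by (rule random_sub_card_lower) (use fin H' assms in \<open>auto simp: t_def\<close>)
        then show "1 - exp (-2 * (t s)\<^sup>2 / (real (b s) + 1)) \<le>
           measure_pmf.prob (random_sub H' (\<lambda>_. q)) {X. real (card X) > q * real (b s) - t s}"
          by (simp add: H' mult_ac)
        show "0 \<le> 1 - \<pi>" by (simp add: \<pi>_def)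
        fix X assume X: "X \<in> set_pmf (random_sub H' (\<lambda>_. q))" "X \<in> {X. real (card X) > q * real (b s) - t s}"
        then have XH: "X \<subseteq> H'" by (auto dest: set_random_subD)
        have "\<pi> = measure_pmf.prob (random_sub (A - H') (\<lambda>_. p)) {Y. p * real (s - b s) + z * sqrt (p * (1 - p) * real (s - b s)) \<le> real (card Y)}"
          unfolding \<pi>_def cd[symmetric]
          by (rule prob_random_sub_const[symmetric]) (use fin assms in auto)
        also have "\<dots> \<le> measure_pmf.prob (random_sub (A - H') (\<lambda>_. p)) ((\<lambda>Y. X \<union> Y) -` {Y. ?T \<le> real (card Y)})"
        proof (rule measure_pmf.finite_measure_mono_AE)
          show "AE Y in measure_pmf (random_sub (A - H') (\<lambda>_. p)).
             Y \<in> {Y. p * real (s - b s) + z * sqrt (p * (1 - p) * real (s - b s)) \<le> real (card Y)} \<longrightarrow>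
             Y \<in> (\<lambda>Y. X \<union> Y) -` {Y. ?T \<le> real (card Y)}"
            unfolding AE_measure_pmf_iff
          proof (intro ballI impI)
            fix Y assume Y: "Y \<in> set_pmf (random_sub (A - H') (\<lambda>_. p))"
              "Y \<in> {Y. p * real (s - b s) + z * sqrt (p * (1 - p) * real (s - b s)) \<le> real (card Y)}"
            then have "Y \<subseteq> A - H'" by (auto dest: set_random_subD)
            then have "card (X \<union> Y) = card X + card Y"
              using XH fin by (intro card_Un_disjoint) (auto intro: finite_subset)
            moreover have "z * sqrt (p * (1 - p) * real (s - b s)) = z * (\<sigma> * sqrt (real (s - b s)))"
              by (simp add: \<sigma>_def real_sqrt_mult)
            ultimately show "Y \<in> (\<lambda>Y. X \<union> Y) -` {Y. ?T \<le> real (card Y)}"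
              using X(2) Y(2) elim(1) unfolding T by (simp only: vimage_Collect_eq mem_Collect_eq of_nat_add)
          qed
        qed auto
        finally show "1 - (1 - \<pi>) \<le> measure_pmf.prob (map_pmf (\<lambda>Y. X \<union> Y) (random_sub (A - H') (\<lambda>_. p))) {Y. ?T \<le> real (card Y)}"
          by simp
      qed auto
      moreover have "\<pi> > gaussian_tail x - \<eta> / 2" using elim(2) by (simp add: \<pi>_def)
      ultimately have "measure_pmf.prob (random_sub A ?w) {Y. ?T \<le> real (card Y)} \<ge> gaussian_tail x - \<eta>"
        using elim(3) by linarith
      \<comment> \<open>Going back from \<open>H'\<close> to \<open>H\<close> only raises
        weights.\<close>
      also have "measure_pmf.prob (random_sub A ?w) {Y. ?T \<le> real (card Y)} \<le>
        measure_pmf.prob (random_sub A (\<lambda>x. if x \<in> H then q else p)) {Y. ?T \<le> real (card Y)}"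
        by (rule random_sub_card_mono) (use A H' assms in auto)
      finally show "gaussian_tail (\<beta> - y * ((q - p) / sqrt (p * (1 - p)))) - \<eta> \<le>
        measure_pmf.prob (random_sub A (\<lambda>x. if x \<in> H then q else p)) {Y. ?T \<le> real (card Y)}"
        by (simp add: x_def \<sigma>_def)
    qed
  qed
qed

section \<open>Deferred decisions in phase 1\<close>

definition pairs :: "'a set \<Rightarrow> 'a set set" where
  "pairs V = {e. e \<subseteq> V \<and> card e = 2}"

text \<open>For \<open>v \<in> S\<close> this contains the singleton \<open>{v}\<close>, which is
  not a two-element pair; in exchange \<open>u \<mapsto> {u, v}\<close> is injective on every
  \<open>S\<close>, so \<open>card_star\<close> has no side condition.\<close>

definition star :: "'a \<Rightarrow> 'a set \<Rightarrow> 'a set set" where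
  "star v S = (\<lambda>u. {u, v}) ` S"

definition planted_weight :: "real \<Rightarrow> real \<Rightarrow> 'a set \<Rightarrow> 'a set \<Rightarrow> real" where
  "planted_weight p q K e = (if e \<subseteq> K then q else p)"

lemma finite_pairs [simp]: "finite V \<Longrightarrow> finite (pairs V)"
  unfolding pairs_def by (rule finite_subset[of _ "Pow V"]) auto

lemma pairs_mono: "V \<subseteq> W \<Longrightarrow> pairs V \<subseteq> pairs W"
  by (auto simp: pairs_def)

lemma random_edges_eq: "random_edges n p q K = random_sub (pairs {..<n}) (planted_weight p q K)"
  by (simp add: random_edges_def random_sub_def vertex_pairs_def pairs_def planted_weight_def)

lemma random_subset_eq: "random_subset \<alpha> V = random_sub V (\<lambda>_. \<alpha>)"
  by (simp add: random_subset_def random_sub_def)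

lemma inj_on_star: "inj_on (\<lambda>u. {u, v}) S"
  by (auto simp: inj_on_def doubleton_eq_iff)

lemma finite_star [simp]: "finite S \<Longrightarrow> finite (star v S)"
  by (simp add: star_def)

lemma card_star [simp]: "card (star v S) = card S"
  by (simp add: star_def card_image inj_on_star)

lemma star_mono: "S \<subseteq> T \<Longrightarrow> star v S \<subseteq> star v T"
  by (auto simp: star_def)

lemma star_subset_pairs: "v \<in> V \<Longrightarrow> v \<notin> S \<Longrightarrow> S \<subseteq> V \<Longrightarrow> star v S \<subseteq> pairs V"
  by (auto simp: star_def pairs_def card_insert_if)

lemma star_disjoint: "u \<notin> S \<Longrightarrow> v \<notin> S \<Longrightarrow> u \<noteq> v \<Longrightarrow> star u S \<inter> star v S = {}"
  by (auto simp: star_def doubleton_eq_iff)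

lemma deg_in_star: "deg_in E S v = card (E \<inter> star v S)"
proof -
  have "E \<inter> star v S = (\<lambda>u. {u, v}) ` {u \<in> S. {u, v} \<in> E}"
    by (auto simp: star_def)
  then show ?thesis
    by (simp add: deg_in_def card_image inj_on_star)
qed

lemma deg_in_cong: "E \<inter> star v S = F \<inter> star v S \<Longrightarrow> deg_in E S v = deg_in F S v"
  by (simp add: deg_in_star)

text \<open>A property of the edges seen at one vertex rather than of the vertex, so that it can
  serve as the block event in \<open>random_sub_blocks\<close>.\<close>

definition passes :: "real \<Rightarrow> real \<Rightarrow> nat \<Rightarrow> nat set set \<Rightarrow> bool" where
  "passes p \<beta> s Y \<longleftrightarrow> p * real s + \<beta> * sqrt (p * (1 - p) * real s) \<le> real (card Y)"

lemma refine_eq: "refine p \<beta> E V S = {v \<in> V - S. passes p \<beta> (card S) (E \<inter> star v S)}"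
  by (simp add: refine_def passes_def deg_in_star)

lemma refine_subset: "refine p \<beta> E V S \<subseteq> V - S"
  by (auto simp: refine_def)

lemma refine_cong:
  assumes "\<And>v. v \<in> V - S \<Longrightarrow> E \<inter> star v S = F \<inter> star v S"
  shows "refine p \<beta> E V S = refine p \<beta> F V S"
  using assms by (auto simp: refine_eq)

lemma refine_restrict:
  assumes "S \<subseteq> V"
  shows "refine p \<beta> (E \<inter> pairs V) V S = refine p \<beta> E V S"
proof (rule refine_cong)
  fix v assume "v \<in> V - S"
  then have "star v S \<subseteq> pairs V" using assms by (intro star_subset_pairs) auto
  then show "E \<inter> pairs V \<inter> star v S = E \<inter> star v S" by auto
qed

lemma set_phase1D: "V \<in> set_pmf (phase1 p \<alpha> \<beta> E U t) \<Longrightarrow> V \<subseteq> U"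
proof (induction t arbitrary: V)
  case (Suc t)
  then show ?case using refine_subset by (fastforce simp del: Diff_iff)
qed simp

context
  fixes p \<alpha> \<beta> :: real and w :: "nat set \<Rightarrow> real"
begin

text \<open>Each step draws its own edges, whereas all steps of \<open>phase1\<close> share one edge
  set. The two are reconciled in \<open>phase1_deferred\<close>.\<close>

definition fresh_step :: "nat set \<Rightarrow> nat set pmf" where
  "fresh_step V = do {
     S \<leftarrow> random_subset \<alpha> V;
     F \<leftarrow> random_sub (pairs V) w;
     return_pmf (refine p \<beta> F V S)
   }"

primrec fresh_phase1 :: "nat set \<Rightarrow> nat \<Rightarrow> nat set pmf" where
  "fresh_phase1 U 0 = return_pmf U"
| "fresh_phase1 U (Suc i) = bind_pmf (fresh_phase1 U i) fresh_step"

lemma set_fresh_phase1D: "V \<in> set_pmf (fresh_phase1 U t) \<Longrightarrow> V \<subseteq> U"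
proof (induction t arbitrary: V)
  case (Suc t)
  then show ?case using refine_subset by (fastforce simp: fresh_step_def simp del: Diff_iff)
qed simp

text \<open>The edges inside \<open>V - S\<close> are not looked at by the refinement step, so they can be
  redrawn afterwards.\<close>

lemma refine_deferred:
  assumes "finite V" "S \<subseteq> V"
  shows "map_pmf (\<lambda>F. (refine p \<beta> F V S, F \<inter> pairs (refine p \<beta> F V S))) (random_sub (pairs V) w) =
    bind_pmf (random_sub (pairs V) w) (\<lambda>F. map_pmf (Pair (refine p \<beta> F V S)) (random_sub (pairs (refine p \<beta> F V S)) w))"
    (is "?lhs = ?rhs")
proof -
  \<comment> \<open>\<open>?R1\<close> decides the pairs that meet \<open>S\<close>, and these alone
    determine the refinement (\<open>r\<close>). \<open>?R2\<close> decides the pairs inside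
    \<open>V - S\<close>, and these alone survive the restriction (\<open>i\<close>).\<close>
  let ?R1 = "random_sub (pairs V - pairs (V - S)) w" and ?R2 = "random_sub (pairs (V - S)) w"
  let ?r = "\<lambda>F. refine p \<beta> F V S"
  have "(pairs V - pairs (V - S)) \<union> pairs (V - S) = pairs V"
    using pairs_mono[of "V - S" V] by auto
  with random_sub_union[of "pairs V - pairs (V - S)" "pairs (V - S)" w] assms(1)
  have split: "random_sub (pairs V) w = bind_pmf ?R1 (\<lambda>X. map_pmf (\<lambda>Y. X \<union> Y) ?R2)"
    by auto
  have r: "?r (X \<union> Y) = ?r X" if "Y \<in> set_pmf ?R2" for X Y
  proof (rule refine_cong)
    fix v assume "v \<in> V - S"
    have "Y \<subseteq> pairs (V - S)" using that by (rule set_random_subD)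
    then have "Y \<inter> star v S = {}" by (auto simp: pairs_def star_def)
    then show "(X \<union> Y) \<inter> star v S = X \<inter> star v S" by auto
  qed
  have i: "(X \<union> Y) \<inter> pairs (?r X) = Y \<inter> pairs (?r X)" if "X \<in> set_pmf ?R1" for X Y
  proof -
    have "X \<subseteq> pairs V - pairs (V - S)" using that by (rule set_random_subD)
    moreover have "pairs (?r X) \<subseteq> pairs (V - S)" by (intro pairs_mono refine_subset)
    ultimately show ?thesis by auto
  qed
  have "?lhs = bind_pmf ?R1 (\<lambda>X. map_pmf (\<lambda>Y. (?r (X \<union> Y), (X \<union> Y) \<inter> pairs (?r (X \<union> Y)))) ?R2)"
    unfolding split by (simp add: map_bind_pmf map_pmf_comp)
  also have "\<dots> = bind_pmf ?R1 (\<lambda>X. map_pmf (\<lambda>Y. (?r X, Y \<inter> pairs (?r X))) ?R2)"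
    by (intro bind_pmf_cong refl map_pmf_cong) (simp add: r i)
  also have "\<dots> = bind_pmf ?R1 (\<lambda>X. map_pmf (Pair (?r X)) (map_pmf (\<lambda>Y. Y \<inter> pairs (?r X)) ?R2))"
    by (simp add: map_pmf_comp)
  also have "\<dots> = bind_pmf ?R1 (\<lambda>X. map_pmf (Pair (?r X)) (random_sub (pairs (?r X)) w))"
    using assms by (subst random_sub_restrict) (auto intro!: pairs_mono[OF refine_subset, THEN subsetD])
  \<comment> \<open>Insert a draw from \<open>?R2\<close> that influences nothing, so that both
    draws together form a complete edge set again.\<close>
  also have "\<dots> = bind_pmf ?R1 (\<lambda>X. bind_pmf ?R2 (\<lambda>Y. map_pmf (Pair (?r (X \<union> Y))) (random_sub (pairs (?r (X \<union> Y))) w)))"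
  proof (intro bind_pmf_cong refl)
    fix X
    have "bind_pmf ?R2 (\<lambda>Y. map_pmf (Pair (?r (X \<union> Y))) (random_sub (pairs (?r (X \<union> Y))) w)) =
      bind_pmf ?R2 (\<lambda>Y. map_pmf (Pair (?r X)) (random_sub (pairs (?r X)) w))"
      by (intro bind_pmf_cong refl) (simp add: r)
    then show "map_pmf (Pair (?r X)) (random_sub (pairs (?r X)) w) =
      bind_pmf ?R2 (\<lambda>Y. map_pmf (Pair (?r (X \<union> Y))) (random_sub (pairs (?r (X \<union> Y))) w))"
      by simp
  qed
  also have "\<dots> = ?rhs"
    unfolding split by (simp add: bind_assoc_pmf bind_map_pmf)
  finally show ?thesis .
qed

text \<open>The joint law keeps the edges inside the current vertex set and forgets all others.
  Those inside edges are the only ones that later steps read, and given the vertex set they are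
  still distributed as in the model; this makes the induction close.\<close>

lemma phase1_deferred:
  assumes "finite U"
  shows "do { E \<leftarrow> random_sub (pairs U) w; V \<leftarrow> phase1 p \<alpha> \<beta> E U t; return_pmf (V, E \<inter> pairs V) } =
    do { V \<leftarrow> fresh_phase1 U t; F \<leftarrow> random_sub (pairs V) w; return_pmf (V, F) }"
proof (induction t)
  case 0
  have "E \<inter> pairs U = E" if "E \<in> set_pmf (random_sub (pairs U) w)" for E
    using set_random_subD[OF that] by auto
  then show ?case by (auto simp: bind_return_pmf intro!: bind_pmf_cong)
next
  case (Suc t)
  let ?G = "\<lambda>V. random_sub (pairs V) w"
  let ?r = "\<lambda>F V S. refine p \<beta> F V S"
  let ?k = "\<lambda>(V, F). do { S \<leftarrow> random_subset \<alpha> V; return_pmf (?r F V S, F \<inter> pairs (?r F V S)) }"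
  have "do { E \<leftarrow> ?G U; V \<leftarrow> phase1 p \<alpha> \<beta> E U (Suc t); return_pmf (V, E \<inter> pairs V) } =
    do { E \<leftarrow> ?G U; V \<leftarrow> phase1 p \<alpha> \<beta> E U t; S \<leftarrow> random_subset \<alpha> V; return_pmf (?r E V S, E \<inter> pairs (?r E V S)) }"
    by (simp add: bind_assoc_pmf bind_return_pmf)
  \<comment> \<open>The step reads only edges inside \<open>V\<close>, so it factors through the
    pair to which the induction hypothesis applies.\<close>
  also have "\<dots> = do { E \<leftarrow> ?G U; V \<leftarrow> phase1 p \<alpha> \<beta> E U t; S \<leftarrow> random_subset \<alpha> V;
      return_pmf (?r (E \<inter> pairs V) V S, (E \<inter> pairs V) \<inter> pairs (?r (E \<inter> pairs V) V S)) }"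
  proof (intro bind_pmf_cong refl)
    fix E V S assume "S \<in> set_pmf (random_subset \<alpha> V)"
    then have S: "S \<subseteq> V" by (auto simp: random_subset_eq dest: set_random_subD)
    have "pairs (?r E V S) \<subseteq> pairs V" using refine_subset[of p \<beta> E V S] by (intro pairs_mono) auto
    then show "return_pmf (?r E V S, E \<inter> pairs (?r E V S)) =
       return_pmf (?r (E \<inter> pairs V) V S, (E \<inter> pairs V) \<inter> pairs (?r (E \<inter> pairs V) V S))"
      by (auto simp: refine_restrict[OF S])
  qed
  also have "\<dots> = bind_pmf (do { E \<leftarrow> ?G U; V \<leftarrow> phase1 p \<alpha> \<beta> E U t; return_pmf (V, E \<inter> pairs V) }) ?k"
    by (simp add: bind_assoc_pmf bind_return_pmf)
  also have "\<dots> = bind_pmf (do { V \<leftarrow> fresh_phase1 U t; F \<leftarrow> ?G V; return_pmf (V, F) }) ?k"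
    by (simp only: Suc.IH)
  also have "\<dots> = do { V \<leftarrow> fresh_phase1 U t; F \<leftarrow> ?G V; S \<leftarrow> random_subset \<alpha> V;
      return_pmf (?r F V S, F \<inter> pairs (?r F V S)) }"
    by (simp add: bind_assoc_pmf bind_return_pmf)
  \<comment> \<open>Given \<open>V\<close>, sample and edges are independent and may be drawn in the
    other order; \<open>refine_deferred\<close> needs \<open>S\<close> to be fixed first.\<close>
  also have "\<dots> = do { V \<leftarrow> fresh_phase1 U t; S \<leftarrow> random_subset \<alpha> V;
      map_pmf (\<lambda>F. (?r F V S, F \<inter> pairs (?r F V S))) (?G V) }"
    unfolding map_pmf_def by (intro bind_pmf_cong refl bind_commute_pmf)
  also have "\<dots> = do { V \<leftarrow> fresh_phase1 U t; S \<leftarrow> random_subset \<alpha> V;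
      F \<leftarrow> ?G V; map_pmf (Pair (?r F V S)) (?G (?r F V S)) }"
  proof (intro bind_pmf_cong refl)
    fix V S assume "V \<in> set_pmf (fresh_phase1 U t)" "S \<in> set_pmf (random_subset \<alpha> V)"
    then have "S \<subseteq> V" "finite V"
      using assms by (auto simp: random_subset_eq dest: set_random_subD set_fresh_phase1D finite_subset)
    then show "map_pmf (\<lambda>F. (?r F V S, F \<inter> pairs (?r F V S))) (?G V) =
      do { F \<leftarrow> ?G V; map_pmf (Pair (?r F V S)) (?G (?r F V S)) }"
      by (intro refine_deferred)
  qed
  also have "\<dots> = do { V \<leftarrow> fresh_phase1 U (Suc t); F \<leftarrow> ?G V; return_pmf (V, F) }"
    by (simp add: fresh_step_def bind_assoc_pmf bind_return_pmf map_pmf_def)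
  finally show ?case .
qed

text \<open>Distinct vertices outside \<open>S\<close> have disjoint stars to \<open>S\<close>, so
  their verdicts are independent. \<open>T\<close> will be the planted or the unplanted part of
  \<open>V - S\<close>, which is why the law is given for a restriction.\<close>

lemma refine_law:
  assumes "finite V" "S \<subseteq> V" "T \<subseteq> V - S"
  shows "map_pmf (\<lambda>F. refine p \<beta> F V S \<inter> T) (random_sub (pairs V) w) =
    random_sub T (\<lambda>v. measure_pmf.prob (random_sub (star v S) w) {Y. passes p \<beta> (card S) Y})"
proof -
  have sub: "(\<Union>v\<in>T. star v S) \<subseteq> pairs V"
    using assms by (intro UN_least star_subset_pairs) auto
  have fin: "finite T" "finite S" using assms by (auto intro: finite_subset)
  have "map_pmf (\<lambda>F. refine p \<beta> F V S \<inter> T) (random_sub (pairs V) w) =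
    map_pmf (\<lambda>F. {v \<in> T. passes p \<beta> (card S) (F \<inter> (\<Union>v\<in>T. star v S) \<inter> star v S)}) (random_sub (pairs V) w)"
  proof (intro map_pmf_cong refl)
    fix F
    have "F \<inter> (\<Union>v\<in>T. star v S) \<inter> star v S = F \<inter> star v S" if "v \<in> T" for v
      using that by auto
    then show "refine p \<beta> F V S \<inter> T = {v \<in> T. passes p \<beta> (card S) (F \<inter> (\<Union>v\<in>T. star v S) \<inter> star v S)}"
      using assms by (auto simp: refine_eq)
  qed
  also have "\<dots> = map_pmf (\<lambda>F. {v \<in> T. passes p \<beta> (card S) (F \<inter> star v S)})
      (map_pmf (\<lambda>F. F \<inter> (\<Union>v\<in>T. star v S)) (random_sub (pairs V) w))"
    by (simp add: map_pmf_comp)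
  also have "map_pmf (\<lambda>F. F \<inter> (\<Union>v\<in>T. star v S)) (random_sub (pairs V) w) = random_sub (\<Union>v\<in>T. star v S) w"
    using assms sub by (intro random_sub_restrict) auto
  also have "map_pmf (\<lambda>F. {v \<in> T. passes p \<beta> (card S) (F \<inter> star v S)}) (random_sub (\<Union>v\<in>T. star v S) w) =
    random_sub T (\<lambda>v. measure_pmf.prob (random_sub (star v S) w) {Y. passes p \<beta> (card S) Y})"
  proof (rule random_sub_blocks)
    fix u v assume "u \<in> T" "v \<in> T" "u \<noteq> v"
    then show "star u S \<inter> star v S = {}" using assms(3) by (intro star_disjoint) auto
  qed (use fin in auto)
  finally show ?thesis .
qed

end

section \<open>One step of phase 1\<close>

lemma prob_Int_ge:
  assumes "measure_pmf.prob M A \<ge> 1 - a" "measure_pmf.prob M B \<ge> 1 - b"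
  shows "measure_pmf.prob M (A \<inter> B) \<ge> 1 - (a + b)"
proof -
  have union: "measure_pmf.prob M (- (A \<inter> B)) \<le> measure_pmf.prob M (- A) + measure_pmf.prob M (- B)"
    unfolding Compl_Int by (rule measure_Un_le) auto
  have "measure_pmf.prob M (- C) = 1 - measure_pmf.prob M C" for C :: "'a set"
    by (subst measure_pmf.prob_compl[symmetric]) (auto simp: Compl_eq_Diff_UNIV)
  from this[of A] this[of B] this[of "A \<inter> B"] show ?thesis using assms union by linarith
qed

lemma prob_mono:
  assumes "measure_pmf.prob M A \<ge> r" "\<And>x. x \<in> set_pmf M \<Longrightarrow> x \<in> A \<Longrightarrow> x \<in> B"
  shows "measure_pmf.prob M B \<ge> r"
proof -
  have "measure_pmf.prob M A \<le> measure_pmf.prob M B"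
    by (rule measure_pmf.finite_measure_mono_AE) (use assms(2) in \<open>auto simp: AE_measure_pmf_iff\<close>)
  then show ?thesis using assms(1) by simp
qed

text \<open>The constants depend on the ratio \<open>x\<close> and on the relaxed rates, but not on
  \<open>V\<close>, \<open>M\<close> or \<open>L\<close>, so one application covers arbitrarily many
  steps. The bound of the planted count by \<open>\<gamma> * M\<close> makes planted survivors
  negligible in the count of all survivors. Of the six failure terms, four concern the sample and
  two the passing vertices.\<close>

lemma one_step:
  fixes p q \<alpha> \<beta> x \<rho>\<^sub>1 \<tau>\<^sub>1 :: real
  assumes pq: "0 < p" "p < q" "q < 1" and \<alpha>: "0 < \<alpha>" "\<alpha> < 1" and x: "0 < x"
    and \<rho>\<^sub>1: "0 < \<rho>\<^sub>1" "\<rho>\<^sub>1 < rho' p q \<alpha> \<beta> x"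
    and \<tau>\<^sub>1: "tau \<alpha> \<beta> < \<tau>\<^sub>1"
  shows "\<exists>\<gamma> L\<^sub>0. 0 < \<gamma> \<and> (\<forall>V K M L. finite V \<longrightarrow> real (card V) \<le> M \<longrightarrow> L\<^sub>0 \<le> L \<longrightarrow> L \<le> real (card (V \<inter> K)) \<longrightarrow>
     x * sqrt M \<le> L \<longrightarrow> real (card (V \<inter> K)) \<le> \<gamma> * M \<longrightarrow>
     measure_pmf.prob (fresh_step p \<alpha> \<beta> (planted_weight p q K) V)
       {V'. real (card V') \<le> \<tau>\<^sub>1 * M \<and> \<rho>\<^sub>1 * L \<le> real (card (V' \<inter> K))} \<ge> 1 - 6 * exp (- \<gamma> * L))"
proof -
  define r where "r = (q - p) / sqrt (p * (1 - p))"
  \<comment> \<open>A sample with at least \<open>(\<alpha> - \<delta>) * L\<close> planted vertices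
    and at most \<open>(\<alpha> + \<delta>) * M\<close> vertices in all has ratio at least
    \<open>(\<alpha> - \<delta>) * x / sqrt (\<alpha> + \<delta>)\<close>. At
    \<open>\<delta> = 0\<close> this is \<open>x * sqrt \<alpha>\<close>, the shift in
    \<open>rho'\<close>.\<close>
  define h where "h \<delta> = gaussian_tail (\<beta> - (\<alpha> - \<delta>) * x / sqrt (\<alpha> + \<delta>) * r)" for \<delta>
  \<comment> \<open>One \<open>\<delta>\<close> bounds all relative errors: as it tends to 0 the
    perturbed rates tend to \<open>rho'\<close> and \<open>tau\<close>, which satisfy the desired
    bounds strictly.\<close>
  obtain \<delta> where \<delta>: "0 < \<delta>" "\<delta> < \<alpha>" "\<delta> < 1 - \<alpha>" "\<rho>\<^sub>1 < (1 - \<alpha> - \<delta>) * (h \<delta> - 2 * \<delta>)"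
    "(gaussian_tail \<beta> + \<delta>) * (1 - \<alpha> + \<delta>) + 2 * \<delta> < \<tau>\<^sub>1"
  proof -
    have id: "((\<lambda>\<delta>. \<delta>) \<longlongrightarrow> 0) (at_right (0::real))" by (rule tendsto_ident_at)
    have "((\<lambda>\<delta>. (1 - \<alpha> - \<delta>) * (h \<delta> - 2 * \<delta>)) \<longlongrightarrow>
      (1 - \<alpha> - 0) * (gaussian_tail (\<beta> - (\<alpha> - 0) * x / sqrt (\<alpha> + 0) * r) - 2 * 0)) (at_right 0)"
      unfolding h_def
      by (intro tendsto_intros isCont_tendsto_compose[OF isCont_gaussian_tail] id) (use \<alpha> in auto)
    also have "(1 - \<alpha> - 0) * (gaussian_tail (\<beta> - (\<alpha> - 0) * x / sqrt (\<alpha> + 0) * r) - 2 * 0) = rho' p q \<alpha> \<beta> x"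
    proof -
      have "\<alpha> * x / sqrt \<alpha> = x * sqrt \<alpha>" using \<alpha> by (simp add: field_simps)
      then show ?thesis by (simp add: rho'_def r_def)
    qed
    finally have "\<forall>\<^sub>F \<delta> in at_right 0. \<rho>\<^sub>1 < (1 - \<alpha> - \<delta>) * (h \<delta> - 2 * \<delta>)"
      using \<rho>\<^sub>1(2) by (rule order_tendstoD)
    moreover have "((\<lambda>\<delta>. (gaussian_tail \<beta> + \<delta>) * (1 - \<alpha> + \<delta>) + 2 * \<delta>) \<longlongrightarrow>
      (gaussian_tail \<beta> + 0) * (1 - \<alpha> + 0) + 2 * 0) (at_right 0)"
      by (intro tendsto_intros id)
    then have "\<forall>\<^sub>F \<delta> in at_right 0. (gaussian_tail \<beta> + \<delta>) * (1 - \<alpha> + \<delta>) + 2 * \<delta> < \<tau>\<^sub>1"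
      by (rule order_tendstoD) (use \<tau>\<^sub>1 in \<open>simp add: tau_def mult_ac\<close>)
    moreover have "\<forall>\<^sub>F \<delta> in at_right 0. \<delta> < min \<alpha> (1 - \<alpha>)"
      by (rule order_tendstoD[OF id]) (use \<alpha> in simp)
    moreover have "\<forall>\<^sub>F \<delta> in at_right (0::real). 0 < \<delta>" by (rule eventually_at_right_less)
    ultimately have "\<forall>\<^sub>F \<delta> in at_right 0. 0 < \<delta> \<and> \<delta> < min \<alpha> (1 - \<alpha>) \<and> \<rho>\<^sub>1 < (1 - \<alpha> - \<delta>) * (h \<delta> - 2 * \<delta>)
      \<and> (gaussian_tail \<beta> + \<delta>) * (1 - \<alpha> + \<delta>) + 2 * \<delta> < \<tau>\<^sub>1"
      by eventually_elim auto
    then show ?thesis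
      using eventually_happens'[of "at_right (0::real)"] that by fastforce
  qed
  define y where "y = (\<alpha> - \<delta>) * x / sqrt (\<alpha> + \<delta>)"
  have y: "0 < y" using \<delta> x \<alpha> by (simp add: y_def)
  have hpos: "0 < h \<delta> - 2 * \<delta>"
  proof -
    have "0 < (1 - \<alpha> - \<delta>) * (h \<delta> - 2 * \<delta>)" using \<delta>(4) \<rho>\<^sub>1 by linarith
    then show ?thesis using \<delta> by (simp add: zero_less_mult_iff)
  qed
  define null where "null s \<longleftrightarrow> (\<forall>A::nat set set. finite A \<longrightarrow> card A = s \<longrightarrow>
      measure_pmf.prob (random_sub A (\<lambda>_. p)) {Y. passes p \<beta> s Y} \<le> gaussian_tail \<beta> + \<delta>)" for s
  define plant where "plant s \<longleftrightarrow> (\<forall>(A::nat set set) H. finite A \<longrightarrow> card A = s \<longrightarrow> H \<subseteq> A \<longrightarrow>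
      y * sqrt (real s) \<le> real (card H) \<longrightarrow>
      measure_pmf.prob (random_sub A (\<lambda>e. if e \<in> H then q else p)) {Y. passes p \<beta> s Y} \<ge> h \<delta> - \<delta>)" for s
  have "\<forall>\<^sub>F s in sequentially. null s"
    unfolding null_def passes_def by (rule pass_prob_unplanted) (use pq \<delta> in auto)
  moreover have "\<forall>\<^sub>F s in sequentially. plant s"
    unfolding plant_def passes_def h_def y_def[symmetric] r_def
    by (rule pass_prob_planted) (use pq \<delta> y in auto)
  ultimately have "\<forall>\<^sub>F s in sequentially. null s \<and> plant s" by (rule eventually_conj)
  then obtain s\<^sub>0 where s\<^sub>0: "\<And>s. s \<ge> s\<^sub>0 \<Longrightarrow> null s" "\<And>s. s \<ge> s\<^sub>0 \<Longrightarrow> plant s"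
    unfolding eventually_sequentially by auto
  \<comment> \<open>The bound by \<open>\<delta>\<close> lets planted survivors be charged to
    \<open>\<delta> * M\<close>. The other one is the Hoeffding exponent for the smallest group, the
    at least \<open>(1 - \<alpha> - \<delta>) * L\<close> planted vertices outside the
    sample.\<close>
  define \<gamma> where "\<gamma> = min \<delta> (2 * \<delta>\<^sup>2 * (1 - \<alpha> - \<delta>))"
  have \<gamma>: "0 < \<gamma>" "\<gamma> \<le> \<delta>" "\<gamma> \<le> 2 * \<delta>\<^sup>2 * (1 - \<alpha> - \<delta>)" using \<delta> by (auto simp: \<gamma>_def)
  have \<gamma>2: "\<gamma> \<le> 2 * \<delta>\<^sup>2"
  proof -
    have "2 * \<delta>\<^sup>2 * (1 - \<alpha> - \<delta>) \<le> 2 * \<delta>\<^sup>2 * 1" using \<delta> \<alpha> by (intro mult_left_mono) auto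
    then show ?thesis using \<gamma>(3) by linarith
  qed
  \<comment> \<open>The sample contains at least \<open>(\<alpha> - \<delta>) * L\<close> planted
    vertices, so this makes it large enough for both limit statements.\<close>
  define L\<^sub>0 where "L\<^sub>0 = max 1 (real s\<^sub>0 / (\<alpha> - \<delta>))"
  show ?thesis
  proof (rule exI[of _ \<gamma>], rule exI[of _ L\<^sub>0], intro conjI allI impI)
    show "0 < \<gamma>" by (rule \<gamma>)
    fix V K :: "nat set" and M L :: real
    assume V: "finite V" "real (card V) \<le> M" and L: "L\<^sub>0 \<le> L" "L \<le> real (card (V \<inter> K))"
      and xM: "x * sqrt M \<le> L" and small: "real (card (V \<inter> K)) \<le> \<gamma> * M"
    define \<kappa> where "\<kappa> = real (card (V \<inter> K))"
    define w where "w = planted_weight p q K"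
    have L1: "1 \<le> L" "real s\<^sub>0 \<le> (\<alpha> - \<delta>) * L"
      using L(1) \<delta> by (auto simp: L\<^sub>0_def field_simps)
    have \<kappa>V: "\<kappa> \<le> real (card V)" unfolding \<kappa>_def using V by (simp add: card_mono)
    have ord: "L \<le> \<kappa>" "\<kappa> \<le> M" "0 < \<kappa>" "0 < M" using L1 L V \<kappa>V by (auto simp: \<kappa>_def)
    have ex: "exp (- 2 * (\<delta> * u)\<^sup>2 / u) \<le> exp (- \<gamma> * L)" if "L \<le> u" for u
    proof -
      have "- 2 * (\<delta> * u)\<^sup>2 / u = - (2 * \<delta>\<^sup>2 * u)" using that L1 by (simp add: power2_eq_square)
      moreover have "\<gamma> * L \<le> 2 * \<delta>\<^sup>2 * u" using \<gamma> \<gamma>2 that L1 by (intro mult_mono) auto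
      ultimately show ?thesis by simp
    qed
    have law: "map_pmf (\<lambda>S. S \<inter> T) (random_subset \<alpha> V) = random_sub T (\<lambda>_. \<alpha>)" if "T \<subseteq> V" for T
      unfolding random_subset_eq using V that by (intro random_sub_restrict) auto
    let ?P = "measure_pmf.prob (random_subset \<alpha> V)"
    let ?e = "exp (- \<gamma> * L)"
    have up: "?P {S. real (card (S \<inter> T)) < \<alpha> * real (card T) + \<delta> * u} \<ge> 1 - ?e"
      if "T \<subseteq> V" "real (card T) \<le> u" "L \<le> u" for T u
    proof -
      have "measure_pmf.prob (random_sub T (\<lambda>_. \<alpha>)) {X. real (card X) < sum (\<lambda>_. \<alpha>) T + \<delta> * u}
        \<ge> 1 - exp (- 2 * (\<delta> * u)\<^sup>2 / u)"
        by (rule random_sub_card_upper) (use that V L1 \<delta> \<alpha> finite_subset in auto)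
      with ex[OF that(3)] have "measure_pmf.prob (random_sub T (\<lambda>_. \<alpha>)) {X. real (card X) < sum (\<lambda>_. \<alpha>) T + \<delta> * u} \<ge> 1 - ?e"
        by linarith
      then show ?thesis
        unfolding law[OF that(1), symmetric] by (simp add: vimage_def mult_ac)
    qed
    have lo: "?P {S. real (card (S \<inter> T)) > \<alpha> * real (card T) - \<delta> * u} \<ge> 1 - ?e"
      if "T \<subseteq> V" "real (card T) \<le> u" "L \<le> u" for T u
    proof -
      have "measure_pmf.prob (random_sub T (\<lambda>_. \<alpha>)) {X. real (card X) > sum (\<lambda>_. \<alpha>) T - \<delta> * u}
        \<ge> 1 - exp (- 2 * (\<delta> * u)\<^sup>2 / u)"
        by (rule random_sub_card_lower) (use that V L1 \<delta> \<alpha> finite_subset in auto)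
      with ex[OF that(3)] have "measure_pmf.prob (random_sub T (\<lambda>_. \<alpha>)) {X. real (card X) > sum (\<lambda>_. \<alpha>) T - \<delta> * u} \<ge> 1 - ?e"
        by linarith
      then show ?thesis
        unfolding law[OF that(1), symmetric] by (simp add: vimage_def mult_ac)
    qed
    have VK: "real (card (V - K)) \<le> M" using V card_mono[of V "V - K"] by auto
    \<comment> \<open>Planted vertices are controlled on both sides: enough must be sampled to raise
      degrees, and enough must stay outside to survive. The total sample needs an upper bound for
      the ratio. The last event bounds from above the unplanted vertices left outside.\<close>
    define good where "good = ({S. real (card (S \<inter> (V \<inter> K))) > \<alpha> * \<kappa> - \<delta> * \<kappa>} \<inter>
        {S. real (card (S \<inter> (V \<inter> K))) < \<alpha> * \<kappa> + \<delta> * \<kappa>}) \<inter>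
       ({S. real (card (S \<inter> V)) < \<alpha> * real (card V) + \<delta> * M} \<inter>
        {S. real (card (S \<inter> (V - K))) > \<alpha> * real (card (V - K)) - \<delta> * M})"
    have "?P good \<ge> 1 - ((?e + ?e) + (?e + ?e))"
      unfolding good_def using ord V VK
      by (intro prob_Int_ge up lo lo[of "V \<inter> K" \<kappa>, folded \<kappa>_def] up[of "V \<inter> K" \<kappa>, folded \<kappa>_def]) (auto simp: \<kappa>_def)
    then have good: "?P good \<ge> 1 - 4 * ?e" by simp
    show "measure_pmf.prob (fresh_step p \<alpha> \<beta> (planted_weight p q K) V)
       {V'. real (card V') \<le> \<tau>\<^sub>1 * M \<and> \<rho>\<^sub>1 * L \<le> real (card (V' \<inter> K))} \<ge> 1 - 6 * ?e"
    proof -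
      have "measure_pmf.prob (fresh_step p \<alpha> \<beta> w V)
         {V'. real (card V') \<le> \<tau>\<^sub>1 * M \<and> \<rho>\<^sub>1 * L \<le> real (card (V' \<inter> K))} \<ge> 1 - 4 * ?e - 2 * ?e"
        unfolding fresh_step_def
      proof (rule prob_bind_pmf_ge[OF good])
        fix S assume S: "S \<in> set_pmf (random_subset \<alpha> V)" and Sg: "S \<in> good"
        have SV: "S \<subseteq> V" using S by (auto simp: random_subset_eq dest: set_random_subD)
        then have finS: "finite S" using V finite_subset by auto
        let ?k = "real (card (S \<inter> K))"
        have "S \<inter> (V \<inter> K) = S \<inter> K" "S \<inter> V = S" "S \<inter> (V - K) = S - K" using SV by auto
        with Sg have k: "?k > (\<alpha> - \<delta>) * \<kappa>" "?k < (\<alpha> + \<delta>) * \<kappa>"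
          and s: "real (card S) < \<alpha> * real (card V) + \<delta> * M"
          and nk: "real (card (S - K)) > \<alpha> * real (card (V - K)) - \<delta> * M"
          by (auto simp: good_def algebra_simps)
        have sM: "real (card S) \<le> (\<alpha> + \<delta>) * M"
        proof -
          have "\<alpha> * real (card V) \<le> \<alpha> * M" using V \<alpha> by (intro mult_left_mono) auto
          with s show ?thesis by (simp add: algebra_simps)
        qed
        have kL: "?k \<ge> (\<alpha> - \<delta>) * L"
        proof -
          have "(\<alpha> - \<delta>) * L \<le> (\<alpha> - \<delta>) * \<kappa>" using ord \<delta> by (intro mult_left_mono) auto
          with k show ?thesis by linarith
        qed
        have ky: "?k \<ge> y * sqrt (real (card S))"
        proof -
          have "y * sqrt (real (card S)) \<le> y * sqrt ((\<alpha> + \<delta>) * M)"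
            using sM y by (intro mult_left_mono) auto
          also have "\<dots> = (\<alpha> - \<delta>) * (x * sqrt M)"
          proof -
            have "sqrt ((\<alpha> + \<delta>) * M) = sqrt (\<alpha> + \<delta>) * sqrt M" by (rule real_sqrt_mult)
            moreover have "y * sqrt (\<alpha> + \<delta>) = (\<alpha> - \<delta>) * x" using \<delta> \<alpha> by (simp add: y_def)
            ultimately show ?thesis by (metis mult.assoc)
          qed
          also have "\<dots> \<le> (\<alpha> - \<delta>) * L" using xM \<delta> by (intro mult_left_mono) auto
          finally show ?thesis using kL by linarith
        qed
        have s0: "card S \<ge> s\<^sub>0"
        proof -
          have "?k \<le> real (card S)" using finS by (simp add: card_mono)
          then show ?thesis using kL L1 by linarith
        qed
        define \<pi> where "\<pi> v = measure_pmf.prob (random_sub (star v S) w) {Y. passes p \<beta> (card S) Y}" for v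
        have \<pi>0: "\<pi> v \<le> gaussian_tail \<beta> + \<delta>" if "v \<notin> K" for v
        proof -
          have "random_sub (star v S) w = random_sub (star v S) (\<lambda>_. p)"
            by (rule random_sub_cong) (use that in \<open>auto simp: w_def planted_weight_def star_def\<close>)
          then show ?thesis using s\<^sub>0(1)[OF s0] finS unfolding \<pi>_def null_def by simp
        qed
        have \<pi>1: "\<pi> v \<ge> h \<delta> - \<delta>" if "v \<in> K" for v
        proof -
          have "random_sub (star v S) w = random_sub (star v S) (\<lambda>e. if e \<in> star v (S \<inter> K) then q else p)"
          proof (rule random_sub_cong)
            fix e assume "e \<in> star v S"
            then obtain u where "u \<in> S" "e = {u, v}" by (auto simp: star_def)
            then show "w e = (if e \<in> star v (S \<inter> K) then q else p)"
              using that by (auto simp: w_def planted_weight_def star_def doubleton_eq_iff)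
          qed
          then show ?thesis
            using s\<^sub>0(2)[OF s0] finS ky star_mono[of "S \<inter> K" S v]
            unfolding \<pi>_def plant_def by simp
        qed
        have \<pi>01: "0 \<le> \<pi> v \<and> \<pi> v \<le> 1" for v by (simp add: \<pi>_def)
        let ?G = "random_sub (pairs V) w"
        let ?T0 = "V - S - K" and ?T1 = "(V - S) \<inter> K"
        let ?N1 = "real (card ?T1)"
        have T1: "?N1 \<ge> (1 - \<alpha> - \<delta>) * \<kappa>"
        proof -
          have "card ((V \<inter> K) - (S \<inter> K)) = card (V \<inter> K) - card (S \<inter> K)"
            using SV finS by (intro card_Diff_subset) auto
          moreover have "(V \<inter> K) - (S \<inter> K) = ?T1" by auto
          moreover have "card (S \<inter> K) \<le> card (V \<inter> K)" using SV V by (intro card_mono) auto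
          ultimately have "?N1 = \<kappa> - ?k" by (simp add: \<kappa>_def)
          then show ?thesis using k by (simp add: algebra_simps)
        qed
        have T1L: "?N1 \<ge> (1 - \<alpha> - \<delta>) * L"
          using T1 ord \<delta> mult_left_mono[of L \<kappa> "1 - \<alpha> - \<delta>"] by linarith
        have T1p: "0 < ?N1" 
        proof -
          have "0 < (1 - \<alpha> - \<delta>) * L" using L1 \<delta> by (intro mult_pos_pos) auto
          then show ?thesis using T1L by linarith
        qed
        have T0: "real (card ?T0) \<le> (1 - \<alpha> + \<delta>) * M"
        proof -
          have "card ((V - K) - (S - K)) = card (V - K) - card (S - K)"
            using SV finS by (intro card_Diff_subset) auto
          moreover have "(V - K) - (S - K) = ?T0" by auto
          moreover have "card (S - K) \<le> card (V - K)" using SV V by (intro card_mono) auto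
          ultimately have "real (card ?T0) = real (card (V - K)) - real (card (S - K))" by simp
          also have "\<dots> \<le> (1 - \<alpha>) * real (card (V - K)) + \<delta> * M" using nk by (simp add: algebra_simps)
          also have "\<dots> \<le> (1 - \<alpha>) * M + \<delta> * M" using VK \<alpha> by (intro add_right_mono mult_left_mono) auto
          finally show ?thesis by (simp add: algebra_simps)
        qed
        have T0M: "real (card ?T0) \<le> M"
        proof -
          have "card ?T0 \<le> card V" using V by (intro card_mono) auto
          then show ?thesis using V(2) by linarith
        qed
        have law2: "map_pmf (\<lambda>F. refine p \<beta> F V S \<inter> T) ?G = random_sub T \<pi>" if "T \<subseteq> V - S" for T
          using refine_law[OF V(1) SV that] unfolding \<pi>_def[abs_def] .
        have E0: "measure_pmf.prob ?G {F. real (card (refine p \<beta> F V S \<inter> ?T0)) < sum \<pi> ?T0 + \<delta> * M} \<ge> 1 - ?e"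
        proof -
          have "measure_pmf.prob (random_sub ?T0 \<pi>) {X. real (card X) < sum \<pi> ?T0 + \<delta> * M}
            \<ge> 1 - exp (- 2 * (\<delta> * M)\<^sup>2 / M)"
            by (rule random_sub_card_upper)
              (use V T0M ord \<delta> \<pi>01 in auto)
          with ex[of M] ord have "measure_pmf.prob (random_sub ?T0 \<pi>) {X. real (card X) < sum \<pi> ?T0 + \<delta> * M} \<ge> 1 - ?e"
            by linarith
          then show ?thesis
            unfolding law2[of ?T0, OF Diff_subset, symmetric] by (simp add: vimage_def)
        qed
        have E1: "measure_pmf.prob ?G {F. real (card (refine p \<beta> F V S \<inter> ?T1)) > sum \<pi> ?T1 - \<delta> * ?N1} \<ge> 1 - ?e"
        proof -
          have "measure_pmf.prob (random_sub ?T1 \<pi>) {X. real (card X) > sum \<pi> ?T1 - \<delta> * ?N1}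
            \<ge> 1 - exp (- 2 * (\<delta> * ?N1)\<^sup>2 / ?N1)"
            by (rule random_sub_card_lower) (use V T1p \<delta> \<pi>01 in auto)
          moreover have "exp (- 2 * (\<delta> * ?N1)\<^sup>2 / ?N1) \<le> ?e"
          proof -
            have "- 2 * (\<delta> * ?N1)\<^sup>2 / ?N1 = - (2 * \<delta>\<^sup>2 * ?N1)" using T1p by (simp add: power2_eq_square)
            moreover have "\<gamma> * L \<le> 2 * \<delta>\<^sup>2 * (1 - \<alpha> - \<delta>) * L" using \<gamma> L1 by (intro mult_right_mono) auto
            moreover have "2 * \<delta>\<^sup>2 * ((1 - \<alpha> - \<delta>) * L) \<le> 2 * \<delta>\<^sup>2 * ?N1" using T1L by (intro mult_left_mono) auto
            ultimately show ?thesis by (simp add: mult_ac)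
          qed
          ultimately have "measure_pmf.prob (random_sub ?T1 \<pi>) {X. real (card X) > sum \<pi> ?T1 - \<delta> * ?N1} \<ge> 1 - ?e"
            by linarith
          then show ?thesis
            unfolding law2[of ?T1, OF Int_lower1, symmetric] by (simp add: vimage_def)
        qed
        have "measure_pmf.prob ?G {F. real (card (refine p \<beta> F V S)) \<le> \<tau>\<^sub>1 * M \<and> \<rho>\<^sub>1 * L \<le> real (card (refine p \<beta> F V S \<inter> K))}
          \<ge> 1 - (?e + ?e)"
        proof (rule prob_mono[OF prob_Int_ge[OF E0 E1]])
          fix F
          let ?R = "refine p \<beta> F V S"
          assume "F \<in> {F. real (card (refine p \<beta> F V S \<inter> ?T0)) < sum \<pi> ?T0 + \<delta> * M} \<inter>
            {F. real (card (refine p \<beta> F V S \<inter> ?T1)) > sum \<pi> ?T1 - \<delta> * ?N1}"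
          then have F: "real (card (?R \<inter> ?T0)) < sum \<pi> ?T0 + \<delta> * M" "real (card (?R \<inter> ?T1)) > sum \<pi> ?T1 - \<delta> * ?N1"
            by auto
          have Rsub: "?R \<subseteq> V - S" by (rule refine_subset)
          have R1: "?R \<inter> ?T1 = ?R \<inter> K" and R0: "?R = (?R \<inter> ?T0) \<union> (?R \<inter> K)" using Rsub by auto
          have a1: "real (card ?R) \<le> real (card (?R \<inter> ?T0)) + real (card (?R \<inter> K))"
            using card_Un_le[of "?R \<inter> ?T0" "?R \<inter> K"] unfolding R0[symmetric] by linarith
          \<comment> \<open>Planted vertices may pass at a high rate, but they are so few that all
            of them fit into one of the two terms \<open>\<delta> * M\<close>; the other pays for
            the deviation among unplanted vertices.\<close>
          have "card (?R \<inter> K) \<le> card (V \<inter> K)"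
            using Rsub V by (intro card_mono) auto
          then have a2: "real (card (?R \<inter> K)) \<le> \<delta> * M"
            using small \<gamma> ord mult_right_mono[of \<gamma> \<delta> M] by linarith
          have "sum \<pi> ?T0 \<le> (gaussian_tail \<beta> + \<delta>) * real (card ?T0)"
            using sum_bounded_above[of ?T0 \<pi> "gaussian_tail \<beta> + \<delta>"] \<pi>0 by (auto simp: mult_ac)
          also have "\<dots> \<le> (gaussian_tail \<beta> + \<delta>) * ((1 - \<alpha> + \<delta>) * M)"
            using T0 gaussian_tail_pos[of \<beta>] \<delta> by (intro mult_left_mono) auto
          finally have a3: "real (card (?R \<inter> ?T0)) \<le> (gaussian_tail \<beta> + \<delta>) * ((1 - \<alpha> + \<delta>) * M) + \<delta> * M"
            using F(1) by linarith
          have "(gaussian_tail \<beta> + \<delta>) * ((1 - \<alpha> + \<delta>) * M) + \<delta> * M + \<delta> * M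
            = ((gaussian_tail \<beta> + \<delta>) * (1 - \<alpha> + \<delta>) + 2 * \<delta>) * M" by (simp add: algebra_simps)
          also have "\<dots> \<le> \<tau>\<^sub>1 * M" using \<delta> ord by (intro mult_right_mono) auto
          finally have A: "real (card ?R) \<le> \<tau>\<^sub>1 * M" using a1 a2 a3 by linarith
          have "\<rho>\<^sub>1 * L \<le> (1 - \<alpha> - \<delta>) * (h \<delta> - 2 * \<delta>) * L" using \<delta> L1 by (intro mult_right_mono) auto
          also have "\<dots> = (h \<delta> - 2 * \<delta>) * ((1 - \<alpha> - \<delta>) * L)" by simp
          also have "\<dots> \<le> (h \<delta> - 2 * \<delta>) * ?N1" using T1L hpos by (intro mult_left_mono) auto
          also have "\<dots> = (h \<delta> - \<delta>) * ?N1 - \<delta> * ?N1" by (simp add: algebra_simps)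
          finally have b1: "\<rho>\<^sub>1 * L \<le> (h \<delta> - \<delta>) * ?N1 - \<delta> * ?N1" .
          have "(h \<delta> - \<delta>) * ?N1 \<le> sum \<pi> ?T1"
            using sum_bounded_below[of ?T1 "h \<delta> - \<delta>" \<pi>] \<pi>1 by (auto simp: mult_ac)
          with b1 have B: "\<rho>\<^sub>1 * L \<le> real (card (?R \<inter> K))" using F(2) unfolding R1 by linarith
          from A B show "F \<in> {F. real (card (refine p \<beta> F V S)) \<le> \<tau>\<^sub>1 * M \<and> \<rho>\<^sub>1 * L \<le> real (card (refine p \<beta> F V S \<inter> K))}"
            by simp
        qed
        then show "1 - 2 * ?e \<le> measure_pmf.prob (?G \<bind> (\<lambda>F. return_pmf (refine p \<beta> F V S)))
          {V'. real (card V') \<le> \<tau>\<^sub>1 * M \<and> \<rho>\<^sub>1 * L \<le> real (card (V' \<inter> K))}"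
          by (simp add: map_pmf_def[symmetric] vimage_def)
      qed auto
      then show ?thesis by (simp add: w_def)
    qed
  qed
qed

section \<open>Typical planted graphs\<close>

lemma prob_Ball_ge:
  assumes "finite I" "\<And>i. i \<in> I \<Longrightarrow> measure_pmf.prob M {x. P i x} \<ge> 1 - a" "real (card I) \<le> N" "0 \<le> a"
  shows "measure_pmf.prob M {x. \<forall>i\<in>I. P i x} \<ge> 1 - N * a"
proof -
  have compl: "measure_pmf.prob M {x. \<not> Q x} = 1 - measure_pmf.prob M {x. Q x}" for Q
    using measure_pmf.prob_compl[of "{x. Q x}" M] by (simp add: Collect_neg_eq Compl_eq_Diff_UNIV)
  have "measure_pmf.prob M {x. \<not> (\<forall>i\<in>I. P i x)} = measure_pmf.prob M (\<Union>i\<in>I. {x. \<not> P i x})"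
    by (rule arg_cong[where f = "measure M" for M]) auto
  also have "\<dots> \<le> (\<Sum>i\<in>I. measure_pmf.prob M {x. \<not> P i x})"
    by (rule measure_UNION_le) (use assms in auto)
  also have "\<dots> \<le> (\<Sum>i\<in>I. a)"
  proof (rule sum_mono)
    fix i assume "i \<in> I"
    from assms(2)[OF this] show "measure_pmf.prob M {x. \<not> P i x} \<le> a" unfolding compl by linarith
  qed
  also have "\<dots> \<le> N * a" using assms by (simp add: mult_right_mono)
  finally show ?thesis unfolding compl by linarith
qed

lemma
  fixes w :: "'a \<Rightarrow> real"
  assumes "finite B" "D \<subseteq> B" "real (card D) \<le> N" "N > 0"
    and "\<And>x. x \<in> D \<Longrightarrow> 0 \<le> w x \<and> w x \<le> 1" "t \<ge> 0"
  shows random_sub_inter_upper: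
      "measure_pmf.prob (random_sub B w) {X. real (card (X \<inter> D)) < sum w D + t} \<ge> 1 - exp (-2 * t\<^sup>2 / N)"
    and random_sub_inter_lower:
      "measure_pmf.prob (random_sub B w) {X. real (card (X \<inter> D)) > sum w D - t} \<ge> 1 - exp (-2 * t\<^sup>2 / N)"
  using random_sub_card_upper[of D N w t] random_sub_card_lower[of D N w t] assms finite_subset[of D B]
  unfolding random_sub_restrict[OF assms(1,2), symmetric] by (auto simp: vimage_def)

lemma deg_in_mono: "finite T \<Longrightarrow> S \<subseteq> T \<Longrightarrow> deg_in E S v \<le> deg_in E T v"
  unfolding deg_in_def by (intro card_mono) auto

lemma deg_in_le: "finite S \<Longrightarrow> finite T \<Longrightarrow> deg_in E S v \<le> deg_in E T v + card (S - T)"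
proof -
  assume fin: "finite S" "finite T"
  have "deg_in E S v \<le> card ({u \<in> T. {u, v} \<in> E} \<union> (S - T))"
    unfolding deg_in_def using fin by (intro card_mono) auto
  also have "\<dots> \<le> deg_in E T v + card (S - T)"
    unfolding deg_in_def by (rule card_Un_le)
  finally show ?thesis .
qed

lemma sum_deg_in:
  assumes "finite B" "finite A" "A \<inter> B = {}"
  shows "(\<Sum>v\<in>B. deg_in E A v) = card (E \<inter> (\<Union>v\<in>B. star v A))"
    and "card (\<Union>v\<in>B. star v A) = card A * card B"
proof -
  have disj: "star u A \<inter> star v A = {}" if "u \<in> B" "v \<in> B" "u \<noteq> v" for u v
    using that assms(3) by (intro star_disjoint) auto
  have "card (\<Union>v\<in>B. E \<inter> star v A) = (\<Sum>v\<in>B. card (E \<inter> star v A))"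
    using assms disj by (intro card_UN_disjoint) auto
  then show "(\<Sum>v\<in>B. deg_in E A v) = card (E \<inter> (\<Union>v\<in>B. star v A))"
    by (simp add: deg_in_star)
  have "card (\<Union>v\<in>B. star v A) = (\<Sum>v\<in>B. card (star v A))"
    using assms disj by (intro card_UN_disjoint) auto
  then show "card (\<Union>v\<in>B. star v A) = card A * card B" by (simp add: mult.commute)
qed

text \<open>\<open>l\<close> is the least size of a test set and \<open>s\<close> bounds the
  exceptions. Quantifying over all \<open>A\<close> allows sets that depend on the edges. For
  \<open>A = K\<close> no exception is tolerated, because the output has to be exact.\<close>

definition typical :: "nat \<Rightarrow> real \<Rightarrow> real \<Rightarrow> nat set \<Rightarrow> real \<Rightarrow> real \<Rightarrow> nat \<Rightarrow> nat set set \<Rightarrow> bool" where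
  "typical n p q K \<epsilon> l s E \<longleftrightarrow>
     (\<forall>A\<subseteq>K. l \<le> real (card A) \<longrightarrow>
        card {v \<in> K. real (deg_in E A v) < (q - \<epsilon>) * real (card A)} < s \<and>
        card {v \<in> {..<n} - K. real (deg_in E A v) > (p + \<epsilon>) * real (card A)} < s) \<and>
     (\<forall>v\<in>K. real (deg_in E K v) \<ge> (q - \<epsilon>) * real (card K)) \<and>
     (\<forall>v\<in>{..<n} - K. real (deg_in E K v) \<le> (p + \<epsilon>) * real (card K))"

lemma subset_of_bad:
  assumes "\<not> card {v \<in> X. P v} < s"
  shows "\<exists>B. B \<subseteq> X \<and> card B = s \<and> (\<forall>v\<in>B. P v)"
proof -
  from assms obtain B where "B \<subseteq> {v \<in> X. P v}" "card B = s"
    by (meson not_less obtain_subset_with_card_n)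
  then show ?thesis by blast
qed

text \<open>With \<open>s\<close> exceptional vertices \<open>B\<close> for a set \<open>A\<close>,
  the number of edges between them is atypical by a multiple of \<open>card A * s\<close>, which
  Hoeffding bounds exponentially in \<open>l * s\<close>. At most \<open>2 ^ card K * n ^ s\<close>
  pairs \<open>(A, B)\<close> have to be excluded. The sets \<open>A = K\<close> with single
  vertices give the second term.\<close>

lemma prob_typical:
  fixes p q \<epsilon> l :: real
  assumes pq: "0 < p" "p < q" "q < 1" and K: "K \<subseteq> {..<n}" and \<epsilon>: "0 < \<epsilon>"
    and s: "0 < s" "real s \<le> \<epsilon> / 2 * l" and l: "1 \<le> l" "2 \<le> \<epsilon> * real (card K)"
  shows "measure_pmf.prob (random_edges n p q K) {E. typical n p q K \<epsilon> l s E} \<ge>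
    1 - (2 * 2 ^ card K * real n ^ s * exp (- (\<epsilon>\<^sup>2 / 2 * l * real s)) + 2 * real n * exp (- (\<epsilon>\<^sup>2 / 2 * real (card K))))"
proof -
  define w where "w = planted_weight p q K"
  define k where "k = card K"
  let ?G = "random_sub (pairs {..<n}) w"
  let ?P = "measure_pmf.prob ?G"
  define I where "I = {A. A \<subseteq> K \<and> l \<le> real (card A)} \<times> {B. B \<subseteq> {..<n} \<and> card B = s}"
  let ?a = "exp (- (\<epsilon>\<^sup>2 / 2 * l * real s))" and ?b = "exp (- (\<epsilon>\<^sup>2 / 2 * real k))"
  have finK: "finite K" using K finite_subset by blast
  have w01: "0 \<le> w e \<and> w e \<le> 1" for e using pq by (auto simp: w_def planted_weight_def)
  have finI: "finite I" unfolding I_def using finK by auto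
  have cardI: "real (card I) \<le> 2 ^ k * real n ^ s"
  proof -
    have "card I \<le> card (Pow K \<times> {B. B \<subseteq> {..<n} \<and> card B = s})"
      unfolding I_def using finK by (intro card_mono) auto
    also have "\<dots> = 2 ^ k * (n choose s)"
      using finK by (simp add: card_cartesian_product card_Pow k_def n_subsets)
    also have "\<dots> \<le> 2 ^ k * n ^ s" 
    proof -
      have "n choose s \<le> n ^ s" by (cases "s \<le> n") (auto intro: binomial_le_pow simp: binomial_eq_0)
      then show ?thesis by simp
    qed
    finally have "real (card I) \<le> real (2 ^ k * n ^ s)" by (rule of_nat_mono)
    then show ?thesis by simp
  qed
  define bad1 where "bad1 = (\<lambda>(A, B) E. B \<subseteq> K \<and> (\<forall>v\<in>B. real (deg_in E A v) < (q - \<epsilon>) * real (card A)))"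
  define bad2 where "bad2 = (\<lambda>(A, B) E. B \<inter> K = {} \<and> (\<forall>v\<in>B. real (deg_in E A v) > (p + \<epsilon>) * real (card A)))"
  have A1: "?P {E. \<forall>i\<in>I. \<not> bad1 i E} \<ge> 1 - 2 ^ k * real n ^ s * ?a"
  proof (rule prob_Ball_ge[OF finI _ cardI])
    fix i assume "i \<in> I"
    then obtain A B where i: "i = (A, B)" and A: "A \<subseteq> K" "l \<le> real (card A)"
      and B: "B \<subseteq> {..<n}" "card B = s" by (auto simp: I_def)
    show "?P {E. \<not> bad1 i E} \<ge> 1 - ?a"
    proof (cases "B \<subseteq> K")
      case False
      then have "{E. \<not> bad1 i E} = UNIV" by (auto simp: bad1_def i)
      then show ?thesis by simp
    next
      case True
      have fin: "finite A" "finite B" using A True finK finite_subset by auto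
      \<comment> \<open>Inside \<open>K\<close> the sets \<open>A\<close> and \<open>B\<close> may
        overlap, and then the stars would share edges. Removing \<open>B\<close> restores
        disjointness and loses at most \<open>s\<close> vertices of \<open>A\<close>.\<close>
      define A' where "A' = A - B"
      have finA': "finite A'" using fin by (simp add: A'_def)
      let ?D = "\<Union>v\<in>B. star v A'"
      have disj: "A' \<inter> B = {}" by (auto simp: A'_def)
      have sub: "?D \<subseteq> pairs {..<n}"
        using A K B by (intro UN_least star_subset_pairs) (auto simp: A'_def)
      have "card A - card B \<le> card A'" unfolding A'_def by (rule diff_card_le_card_Diff) (rule fin)
      then have cA': "real (card A) - real s \<le> real (card A')" using B by linarith
      have "card A' \<le> card A" unfolding A'_def using fin by (intro card_mono) auto
      then have cA'2: "real (card A') * real s \<le> real (card A) * real s" by (intro mult_right_mono) auto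
      have cD: "real (card ?D) = real (card A') * real s"
        using sum_deg_in(2)[OF fin(2) finA' disj] B by simp
      have "sum w ?D = (\<Sum>e\<in>?D. q)"
      proof (rule sum.cong[OF refl])
        fix e assume "e \<in> ?D"
        then show "w e = q" using A True by (auto simp: w_def planted_weight_def star_def A'_def)
      qed
      then have sw: "sum w ?D = q * (real (card A') * real s)" using cD by simp
      \<comment> \<open>Half of the margin \<open>\<epsilon>\<close> goes to the deviation; the
        other half covers the loss of \<open>s\<close> vertices, by
        \<open>real s \<le> \<epsilon> / 2 * l\<close>.\<close>
      define t where "t = \<epsilon> / 2 * real (card A) * real s"
      have "?P {E. real (card (E \<inter> ?D)) > sum w ?D - t} \<ge> 1 - exp (- 2 * t\<^sup>2 / (real (card A) * real s))"
        by (rule random_sub_inter_lower)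
          (use sub w01 s l A \<epsilon> cD cA'2 in \<open>auto simp: t_def intro!: mult_pos_pos\<close>)
      moreover have "exp (- 2 * t\<^sup>2 / (real (card A) * real s)) \<le> ?a"
      proof -
        have "- 2 * t\<^sup>2 / (real (card A) * real s) = - (\<epsilon>\<^sup>2 / 2 * real (card A) * real s)"
          using A l s by (simp add: t_def power2_eq_square field_simps)
        moreover have "\<epsilon>\<^sup>2 / 2 * l * real s \<le> \<epsilon>\<^sup>2 / 2 * real (card A) * real s"
          using A by (intro mult_right_mono mult_left_mono) auto
        ultimately show ?thesis by simp
      qed
      ultimately have "?P {E. real (card (E \<inter> ?D)) > sum w ?D - t} \<ge> 1 - ?a" by linarith
      then show ?thesis
      proof (rule prob_mono, unfold mem_Collect_eq)
        fix E assume E: "real (card (E \<inter> ?D)) > sum w ?D - t"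
        show "\<not> bad1 i E"
        proof
          assume "bad1 i E"
          then have bad: "real (deg_in E A v) < (q - \<epsilon>) * real (card A)" if "v \<in> B" for v
            using that by (auto simp: bad1_def i)
          have "real (card (E \<inter> ?D)) = (\<Sum>v\<in>B. real (deg_in E A' v))"
            unfolding of_nat_sum[symmetric] using sum_deg_in(1)[OF fin(2) finA' disj, of E] by simp
          also have "\<dots> \<le> (\<Sum>v\<in>B. (q - \<epsilon>) * real (card A))"
          proof (rule sum_mono)
            fix v assume "v \<in> B"
            have "deg_in E A' v \<le> deg_in E A v" using fin by (intro deg_in_mono) (auto simp: A'_def)
            with bad[OF \<open>v \<in> B\<close>] show "real (deg_in E A' v) \<le> (q - \<epsilon>) * real (card A)" by linarith
          qed
          also have "\<dots> = (q - \<epsilon>) * real (card A) * real s" using B by simp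
          finally have up: "real (card (E \<inter> ?D)) \<le> (q - \<epsilon>) * real (card A) * real s" .
          have "q * ((real (card A) - real s) * real s) \<le> q * (real (card A') * real s)"
            using cA' pq by (intro mult_left_mono mult_right_mono) auto
          moreover have "q * (real s * real s) \<le> 1 * (real s * real s)" using pq by (intro mult_right_mono) auto
          moreover have "real s * real s \<le> \<epsilon> / 2 * real (card A) * real s"
          proof (rule mult_right_mono)
            have "\<epsilon> / 2 * l \<le> \<epsilon> / 2 * real (card A)" using A \<epsilon> by (intro mult_left_mono) auto
            then show "real s \<le> \<epsilon> / 2 * real (card A)" using s by linarith
          qed auto
          ultimately have "(q - \<epsilon>) * real (card A) * real s \<le> sum w ?D - t"
            unfolding sw t_def by (simp add: algebra_simps)
          with up E show False by linarith
        qed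
      qed
    qed
  qed auto
  have A2: "?P {E. \<forall>i\<in>I. \<not> bad2 i E} \<ge> 1 - 2 ^ k * real n ^ s * ?a"
  proof (rule prob_Ball_ge[OF finI _ cardI])
    fix i assume "i \<in> I"
    then obtain A B where i: "i = (A, B)" and A: "A \<subseteq> K" "l \<le> real (card A)"
      and B: "B \<subseteq> {..<n}" "card B = s" by (auto simp: I_def)
    show "?P {E. \<not> bad2 i E} \<ge> 1 - ?a"
    proof (cases "B \<inter> K = {}")
      case False
      then have "{E. \<not> bad2 i E} = UNIV" by (auto simp: bad2_def i)
      then show ?thesis by simp
    next
      case True
      have fin: "finite A" "finite B" using A B finK finite_subset by auto
      let ?D = "\<Union>v\<in>B. star v A"
      have disj: "A \<inter> B = {}" using True A by auto
      have sub: "?D \<subseteq> pairs {..<n}"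
        using A K B disj by (intro UN_least star_subset_pairs) auto
      have cD: "real (card ?D) = real (card A) * real s"
        using sum_deg_in(2)[OF fin(2,1) disj] B by simp
      have "sum w ?D = (\<Sum>e\<in>?D. p)"
      proof (rule sum.cong[OF refl])
        fix e assume "e \<in> ?D"
        then show "w e = p" using True by (auto simp: w_def planted_weight_def star_def)
      qed
      then have sw: "sum w ?D = p * (real (card A) * real s)" using cD by simp
      define t where "t = \<epsilon> * real (card A) * real s"
      have "?P {E. real (card (E \<inter> ?D)) < sum w ?D + t} \<ge> 1 - exp (- 2 * t\<^sup>2 / (real (card A) * real s))"
        by (rule random_sub_inter_upper)
          (use sub w01 s l A \<epsilon> cD in \<open>auto simp: t_def intro!: mult_pos_pos\<close>)
      moreover have "exp (- 2 * t\<^sup>2 / (real (card A) * real s)) \<le> ?a"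
      proof -
        have "- 2 * t\<^sup>2 / (real (card A) * real s) = - (2 * \<epsilon>\<^sup>2 * (real (card A) * real s))"
          using A l s by (simp add: t_def power2_eq_square field_simps)
        moreover have "\<epsilon>\<^sup>2 / 2 * (l * real s) \<le> 2 * \<epsilon>\<^sup>2 * (real (card A) * real s)"
          using A l by (intro mult_mono) auto
        ultimately show ?thesis by (simp add: mult_ac)
      qed
      ultimately have "?P {E. real (card (E \<inter> ?D)) < sum w ?D + t} \<ge> 1 - ?a" by linarith
      then show ?thesis
      proof (rule prob_mono, unfold mem_Collect_eq)
        fix E assume E: "real (card (E \<inter> ?D)) < sum w ?D + t"
        show "\<not> bad2 i E"
        proof
          assume "bad2 i E"
          then have bad: "real (deg_in E A v) > (p + \<epsilon>) * real (card A)" if "v \<in> B" for v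
            using that by (auto simp: bad2_def i)
          have "real (card (E \<inter> ?D)) = (\<Sum>v\<in>B. real (deg_in E A v))"
            unfolding of_nat_sum[symmetric] using sum_deg_in(1)[OF fin(2,1) disj, of E] by simp
          moreover have "\<dots> \<ge> (\<Sum>v\<in>B. (p + \<epsilon>) * real (card A))"
            using bad by (intro sum_mono less_imp_le)
          moreover have "(\<Sum>v\<in>B. (p + \<epsilon>) * real (card A)) = sum w ?D + t"
            using B by (simp add: sw t_def algebra_simps)
          ultimately show False using E by linarith
        qed
      qed
    qed
  qed auto
  have kpos: "0 < real k" using l \<epsilon> by (auto simp: k_def intro: ccontr)
  have kn: "real (card K) \<le> real n" using card_mono[OF _ K] by simp
  have nn: "real (card ({..<n} - K)) \<le> real n" using card_mono[of "{..<n}" "{..<n} - K"] by simp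
  have A3: "?P {E. \<forall>v\<in>K. (q - \<epsilon>) * real k \<le> real (deg_in E K v)} \<ge> 1 - real n * ?b"
  proof (rule prob_Ball_ge[OF finK _ kn])
    fix v assume v: "v \<in> K"
    \<comment> \<open>A vertex is not its own neighbour, so only \<open>k - 1\<close> pairs count;
      \<open>2 \<le> \<epsilon> * card K\<close> absorbs the missing one.\<close>
    let ?D = "star v (K - {v})"
    have sub: "?D \<subseteq> pairs {..<n}" using v K by (intro star_subset_pairs) auto
    have "card (K - {v}) = k - 1" using v finK by (simp add: k_def)
    then have cD: "real (card ?D) = real k - 1" using kpos by simp
    have "sum w ?D = (\<Sum>e\<in>?D. q)"
      by (rule sum.cong) (use v in \<open>auto simp: w_def planted_weight_def star_def\<close>)
    then have sw: "sum w ?D = q * (real k - 1)" using cD by simp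
    define t where "t = \<epsilon> / 2 * real k"
    have "?P {E. real (card (E \<inter> ?D)) > sum w ?D - t} \<ge> 1 - exp (- 2 * t\<^sup>2 / real k)"
      by (rule random_sub_inter_lower) (use sub w01 \<epsilon> cD kpos in \<open>auto simp: t_def\<close>)
    moreover have "- 2 * t\<^sup>2 / real k = - (\<epsilon>\<^sup>2 / 2 * real k)" using kpos by (simp add: t_def power2_eq_square)
    ultimately have "?P {E. real (card (E \<inter> ?D)) > sum w ?D - t} \<ge> 1 - ?b" by (simp only:)
    then show "?P {E. (q - \<epsilon>) * real k \<le> real (deg_in E K v)} \<ge> 1 - ?b"
    proof (rule prob_mono, unfold mem_Collect_eq)
      fix E assume "real (card (E \<inter> ?D)) > sum w ?D - t"
      then have "real (deg_in E (K - {v}) v) > q * (real k - 1) - t" by (simp add: deg_in_star sw)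
      moreover have "deg_in E (K - {v}) v \<le> deg_in E K v" using finK by (intro deg_in_mono) auto
      moreover have "q + t \<le> \<epsilon> * real k" using l(2) pq unfolding t_def k_def[symmetric] by linarith
      ultimately show "(q - \<epsilon>) * real k \<le> real (deg_in E K v)" by (simp add: algebra_simps)
    qed
  qed auto
  have A4: "?P {E. \<forall>v\<in>{..<n} - K. real (deg_in E K v) \<le> (p + \<epsilon>) * real k} \<ge> 1 - real n * ?b"
  proof (rule prob_Ball_ge[OF _ _ nn])
    fix v assume v: "v \<in> {..<n} - K"
    let ?D = "star v K"
    have sub: "?D \<subseteq> pairs {..<n}" using v K by (intro star_subset_pairs) auto
    have cD: "real (card ?D) = real k" by (simp add: k_def)
    have "sum w ?D = (\<Sum>e\<in>?D. p)"
      by (rule sum.cong) (use v in \<open>auto simp: w_def planted_weight_def star_def\<close>)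
    then have sw: "sum w ?D = p * real k" using cD by simp
    define t where "t = \<epsilon> * real k"
    have "?P {E. real (card (E \<inter> ?D)) < sum w ?D + t} \<ge> 1 - exp (- 2 * t\<^sup>2 / real k)"
      by (rule random_sub_inter_upper) (use sub w01 \<epsilon> cD kpos in \<open>auto simp: t_def\<close>)
    moreover have "exp (- 2 * t\<^sup>2 / real k) \<le> ?b" using kpos \<epsilon> by (simp add: t_def power2_eq_square)
    ultimately have "?P {E. real (card (E \<inter> ?D)) < sum w ?D + t} \<ge> 1 - ?b" by linarith
    then show "?P {E. real (deg_in E K v) \<le> (p + \<epsilon>) * real k} \<ge> 1 - ?b"
      by (rule prob_mono) (auto simp: deg_in_star sw t_def algebra_simps)
  qed auto
  have "?P (({E. \<forall>i\<in>I. \<not> bad1 i E} \<inter> {E. \<forall>i\<in>I. \<not> bad2 i E}) \<inter>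
     ({E. \<forall>v\<in>K. (q - \<epsilon>) * real k \<le> real (deg_in E K v)} \<inter>
      {E. \<forall>v\<in>{..<n} - K. real (deg_in E K v) \<le> (p + \<epsilon>) * real k})) \<ge>
     1 - ((2 ^ k * real n ^ s * ?a + 2 ^ k * real n ^ s * ?a) + (real n * ?b + real n * ?b))"
    by (intro prob_Int_ge A1 A2 A3 A4)
  then have "?P {E. typical n p q K \<epsilon> l s E} \<ge> 1 - ((2 ^ k * real n ^ s * ?a + 2 ^ k * real n ^ s * ?a) + (real n * ?b + real n * ?b))"
  proof (rule prob_mono)
    fix E assume "E \<in> ({E. \<forall>i\<in>I. \<not> bad1 i E} \<inter> {E. \<forall>i\<in>I. \<not> bad2 i E}) \<inter>
     ({E. \<forall>v\<in>K. (q - \<epsilon>) * real k \<le> real (deg_in E K v)} \<inter>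
      {E. \<forall>v\<in>{..<n} - K. real (deg_in E K v) \<le> (p + \<epsilon>) * real k})"
    then have E: "\<And>i. i \<in> I \<Longrightarrow> \<not> bad1 i E" "\<And>i. i \<in> I \<Longrightarrow> \<not> bad2 i E"
      "\<forall>v\<in>K. (q - \<epsilon>) * real k \<le> real (deg_in E K v)"
      "\<forall>v\<in>{..<n} - K. real (deg_in E K v) \<le> (p + \<epsilon>) * real k" by auto
    have "card {v \<in> K. real (deg_in E A v) < (q - \<epsilon>) * real (card A)} < s"
      if A: "A \<subseteq> K" "l \<le> real (card A)" for A
    proof (rule ccontr)
      assume "\<not> ?thesis"
      from subset_of_bad[OF this] obtain B
        where B: "B \<subseteq> K" "card B = s" "\<forall>v\<in>B. real (deg_in E A v) < (q - \<epsilon>) * real (card A)"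
        by blast
      then have "bad1 (A, B) E" by (auto simp: bad1_def)
      moreover have "(A, B) \<in> I" using A B K by (auto simp: I_def)
      ultimately show False using E(1) by blast
    qed
    moreover have "card {v \<in> {..<n} - K. real (deg_in E A v) > (p + \<epsilon>) * real (card A)} < s"
      if A: "A \<subseteq> K" "l \<le> real (card A)" for A
    proof (rule ccontr)
      assume "\<not> ?thesis"
      from subset_of_bad[OF this] obtain B
        where B: "B \<subseteq> {..<n} - K" "card B = s" "\<forall>v\<in>B. real (deg_in E A v) > (p + \<epsilon>) * real (card A)"
        by blast
      then have "bad2 (A, B) E" by (auto simp: bad2_def)
      moreover have "(A, B) \<in> I" using A B K by (auto simp: I_def)
      ultimately show False using E(2) by blast
    qed
    ultimately show "E \<in> {E. typical n p q K \<epsilon> l s E}"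
      using E(3,4) by (simp add: typical_def k_def)
  qed
  then show ?thesis by (simp add: random_edges_eq w_def k_def mult_ac)
qed

section \<open>Phases 2 and 3\<close>

definition separated :: "nat set \<Rightarrow> nat set \<Rightarrow> nat set set \<Rightarrow> bool" where
  "separated K V E \<longleftrightarrow> (\<forall>v\<in>V \<inter> K. \<forall>u\<in>V - K. deg_in E V u < deg_in E V v)"

text \<open>Separation is an event of the edges inside \<open>V\<close>, so it can be evaluated on
  the redrawn edges. \<open>E \<subseteq> pairs U\<close> excludes the singleton \<open>{v}\<close>,
  which lies in \<open>star v V\<close> but not in \<open>pairs V\<close>.\<close>

lemma deg_in_restrict_pairs:
  assumes "E \<subseteq> pairs U" "v \<in> V"
  shows "deg_in (E \<inter> pairs V) V v = deg_in E V v"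
proof (rule deg_in_cong)
  have "E \<inter> star v V \<subseteq> pairs V"
  proof
    fix e assume e: "e \<in> E \<inter> star v V"
    then have "card e = 2" using assms(1) by (auto simp: pairs_def)
    then show "e \<in> pairs V" using e assms(2) by (auto simp: pairs_def star_def)
  qed
  then show "E \<inter> pairs V \<inter> star v V = E \<inter> star v V" by auto
qed

lemma separated_restrict_pairs:
  "E \<subseteq> pairs U \<Longrightarrow> separated K V (E \<inter> pairs V) \<longleftrightarrow> separated K V E"
  by (simp add: separated_def deg_in_restrict_pairs)

text \<open>Expected degrees differ by at least a multiple of \<open>L\<close>, while fluctuations
  are of order \<open>sqrt M\<close>. The bound is thus useful once \<open>L\<^sup>2 / M\<close> is
  a positive power of n, which is what phase 1 achieves.\<close>

lemma prob_separated:
  fixes p q M L :: real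
  assumes pq: "0 < p" "p < q" "q < 1" and V: "finite V" "real (card V) \<le> M"
    and L: "2 \<le> L" "L \<le> real (card (V \<inter> K))"
  shows "measure_pmf.prob (random_sub (pairs V) (planted_weight p q K)) {F. separated K V F} \<ge>
    1 - 2 * M * exp (- ((q - p)\<^sup>2 * L\<^sup>2 / (8 * M)))"
proof -
  define w where "w = planted_weight p q K"
  let ?P = "measure_pmf.prob (random_sub (pairs V) w)"
  define m where "m = real (card V) - 1"
  define \<kappa> where "\<kappa> = real (card (V \<inter> K))"
  have \<kappa>V: "\<kappa> \<le> real (card V)" using V by (simp add: \<kappa>_def card_mono)
  have Mpos: "0 < M" and ord: "L \<le> \<kappa>" using L V \<kappa>V by (auto simp: \<kappa>_def)
  have w01: "0 \<le> w e \<and> w e \<le> 1" for e using pq by (auto simp: w_def planted_weight_def)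
  \<comment> \<open>The cut \<open>p * m + t\<close> is at distance at least \<open>t\<close> from
    both means: \<open>2 \<le> L\<close> gives \<open>L / 2 \<le> \<kappa> - 1\<close>, so
    \<open>2 * t\<close> is at most the gap \<open>(q - p) * (\<kappa> - 1)\<close>.\<close>
  define t where "t = (q - p) * L / 4"
  have t0: "0 \<le> t" using pq L by (simp add: t_def)
  have t2: "2 * t \<le> (q - p) * (\<kappa> - 1)"
  proof -
    have "2 * t = (q - p) * (L / 2)" by (simp add: t_def)
    also have "\<dots> \<le> (q - p) * (\<kappa> - 1)" using pq ord L by (intro mult_left_mono) auto
    finally show ?thesis .
  qed
  let ?e = "exp (- ((q - p)\<^sup>2 * L\<^sup>2 / (8 * M)))"
  have e: "exp (- 2 * t\<^sup>2 / M) = ?e" by (simp add: t_def power2_eq_square)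
  have star: "star v (V - {v}) \<subseteq> pairs V" "real (card (star v (V - {v}))) = m"
    "real (card (star v (V - {v}))) \<le> M" if "v \<in> V" for v
  proof -
    show "star v (V - {v}) \<subseteq> pairs V" using that by (intro star_subset_pairs) auto
    have "card (V - {v}) = card V - 1" "0 < card V" using that V by (auto simp: card_gt_0_iff)
    then show 1: "real (card (star v (V - {v}))) = m" by (simp add: m_def)
    then show "real (card (star v (V - {v}))) \<le> M" using V by (simp add: m_def)
  qed
  have deg: "deg_in F V v = card (F \<inter> star v (V - {v}))" if "v \<in> V" "F \<subseteq> pairs V" for F v
  proof -
    have "F \<inter> star v V = F \<inter> star v (V - {v})"
      using that by (auto simp: star_def pairs_def)
    then show ?thesis by (simp add: deg_in_star)
  qed
  have A: "?P {F. \<forall>v\<in>V \<inter> K. p * m + t < real (deg_in F V v)} \<ge> 1 - M * ?e"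
  proof (rule prob_Ball_ge)
    fix v assume v: "v \<in> V \<inter> K"
    let ?D = "star v (V - {v})"
    have s1: "star v (V \<inter> K - {v}) \<subseteq> ?D" by (intro star_mono) auto
    have "sum w ?D = (\<Sum>e\<in>?D. p + (if e \<in> star v (V \<inter> K - {v}) then q - p else 0))"
      by (rule sum.cong) (use v in \<open>auto simp: w_def planted_weight_def star_def doubleton_eq_iff\<close>)
    also have "\<dots> = p * m + (\<Sum>e\<in>?D. if e \<in> star v (V \<inter> K - {v}) then q - p else 0)"
      using star(2)[of v] v by (simp add: sum.distrib mult_ac)
    also have "(\<Sum>e\<in>?D. if e \<in> star v (V \<inter> K - {v}) then q - p else 0) = (q - p) * real (card (V \<inter> K - {v}))"
      using V s1 by (subst sum.inter_restrict[symmetric]) (auto simp: Int_absorb1 mult_ac)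
    also have "card (V \<inter> K - {v}) = card (V \<inter> K) - 1" using v by simp
    also have "real (card (V \<inter> K) - 1) = \<kappa> - 1" using ord L by (simp add: \<kappa>_def)
    finally have sw: "sum w ?D = p * m + (q - p) * (\<kappa> - 1)" .
    have "?P {F. real (card (F \<inter> ?D)) > sum w ?D - t} \<ge> 1 - exp (- 2 * t\<^sup>2 / M)"
      by (rule random_sub_inter_lower) (use V star v w01 Mpos t0 in auto)
    then show "?P {F. p * m + t < real (deg_in F V v)} \<ge> 1 - ?e"
      unfolding e
    proof (rule prob_mono, unfold mem_Collect_eq)
      fix F assume F: "F \<in> set_pmf (random_sub (pairs V) w)" "real (card (F \<inter> ?D)) > sum w ?D - t"
      have "deg_in F V v = card (F \<inter> ?D)" using v F(1) by (intro deg) (auto dest: set_random_subD)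
      then show "p * m + t < real (deg_in F V v)" using F(2) t2 unfolding sw by linarith
    qed
  qed (use V \<kappa>V in \<open>auto simp: \<kappa>_def\<close>)
  have B: "?P {F. \<forall>u\<in>V - K. real (deg_in F V u) < p * m + t} \<ge> 1 - M * ?e"
  proof (rule prob_Ball_ge)
    fix v assume v: "v \<in> V - K"
    let ?D = "star v (V - {v})"
    have "sum w ?D = (\<Sum>e\<in>?D. p)"
      by (rule sum.cong) (use v in \<open>auto simp: w_def planted_weight_def star_def\<close>)
    then have sw: "sum w ?D = p * m" using star(2)[of v] v by (simp add: mult_ac)
    have "?P {F. real (card (F \<inter> ?D)) < sum w ?D + t} \<ge> 1 - exp (- 2 * t\<^sup>2 / M)"
      by (rule random_sub_inter_upper) (use V star v w01 Mpos t0 in auto)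
    then show "?P {F. real (deg_in F V v) < p * m + t} \<ge> 1 - ?e"
      unfolding e
    proof (rule prob_mono, unfold mem_Collect_eq)
      fix F assume F: "F \<in> set_pmf (random_sub (pairs V) w)" "real (card (F \<inter> ?D)) < sum w ?D + t"
      have "deg_in F V v = card (F \<inter> ?D)" using v F(1) by (intro deg) (auto dest: set_random_subD)
      then show "real (deg_in F V v) < p * m + t" using F(2) unfolding sw by linarith
    qed
  next
    have "card (V - K) \<le> card V" using V by (intro card_mono) auto
    then show "real (card (V - K)) \<le> M" using V by linarith
  qed (use V in auto)
  have "?P {F. separated K V F} \<ge> 1 - (M * ?e + M * ?e)"
  proof (rule prob_mono[OF prob_Int_ge[OF A B]])
    fix F assume "F \<in> {F. \<forall>v\<in>V \<inter> K. p * m + t < real (deg_in F V v)} \<inter> {F. \<forall>u\<in>V - K. real (deg_in F V u) < p * m + t}"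
    then have F: "\<forall>v\<in>V \<inter> K. p * m + t < real (deg_in F V v)" "\<forall>u\<in>V - K. real (deg_in F V u) < p * m + t"
      by auto
    show "F \<in> {F. separated K V F}"
      unfolding separated_def mem_Collect_eq
    proof (intro ballI)
      fix v u assume "v \<in> V \<inter> K" "u \<in> V - K"
      then have "real (deg_in F V u) < real (deg_in F V v)" using F less_trans by blast
      then show "deg_in F V u < deg_in F V v" by simp
    qed
  qed
  then show ?thesis by (simp add: w_def)
qed

lemma largest_degree_planted:
  assumes "largest_degree E V m W" "separated K V E" "finite V" "m \<le> card (V \<inter> K)"
  shows "W \<subseteq> V \<inter> K" "card W = m"
proof -
  have "card (V \<inter> K) \<le> card V" using assms by (intro card_mono) auto
  then show cW: "card W = m" using assms by (simp add: largest_degree_def)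
  have WV: "W \<subseteq> V" using assms by (simp add: largest_degree_def)
  show "W \<subseteq> V \<inter> K"
  proof (rule ccontr)
    assume "\<not> ?thesis"
    then obtain u where u: "u \<in> W" "u \<in> V - K" using WV by auto
    have "\<not> V \<inter> K \<subseteq> W"
    proof
      assume "V \<inter> K \<subseteq> W"
      then have "V \<inter> K \<subset> W" using u by auto
      then have "card (V \<inter> K) < card W" using WV assms(3) by (intro psubset_card_mono) (auto intro: finite_subset)
      then show False using cW assms(4) by simp
    qed
    then obtain v where v: "v \<in> V \<inter> K" "v \<notin> W" by auto
    then have "deg_in E V v \<le> deg_in E V u" using assms(1) u by (auto simp: largest_degree_def)
    moreover have "deg_in E V u < deg_in E V v" using assms(2) u v by (auto simp: separated_def)
    ultimately show False by simp
  qed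
qed

section \<open>Deterministic analysis of phases 2 and 3\<close>

text \<open>With \<open>\<epsilon>\<close> a quarter of \<open>q - p\<close>, typical densities stay
  at distance at least \<open>\<epsilon>\<close> from the threshold \<open>(p + q) / 2\<close>. Each
  set used for testing differs from a subset of \<open>K\<close> by at most \<open>2 * s\<close>
  vertices, fewer than \<open>\<epsilon> * l\<close>, so no typical vertex is misjudged, and each
  test has fewer than \<open>s\<close> exceptions on either side.\<close>

lemma phases23_recover:
  fixes p q \<epsilon> l r :: real
  assumes pq: "0 < p" "p < q" "q < 1" and \<epsilon>: "\<epsilon> = (q - p) / 4"
    and K: "K \<subseteq> {..<n}" "card K = k" and V: "V \<subseteq> {..<n}"
    and typc: "typical n p q K \<epsilon> l s E" and sel: "selection_rule sel"
    and sep: "separated K V E"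
    and s: "0 < s" "2 * real s < \<epsilon> * l" and l: "1 \<le> \<epsilon> * l" "l + 1 \<le> r"
    and r: "r \<le> real (card (V \<inter> K))" "l + real s \<le> real (card (V \<inter> K))"
  shows "phase3 n p q k E (phase2 sel p q r E V) = K"
proof -
  define c where "c = (p + q) / 2"
  have cq: "q - \<epsilon> = c + \<epsilon>" "p + \<epsilon> = c - \<epsilon>" by (simp_all add: \<epsilon> c_def field_simps)
  have \<epsilon>0: "0 < \<epsilon>" and c1: "0 < c" "c < 1" using pq by (auto simp: \<epsilon> c_def)
  have l0: "0 < l" 
  proof -
    have "0 < \<epsilon> * l" using l(1) by linarith
    then show ?thesis using \<epsilon>0 by (simp add: zero_less_mult_iff)
  qed
  have fin: "finite K" "finite V" using K V finite_subset by auto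
  have few: "card {v \<in> K. real (deg_in E A v) < (c + \<epsilon>) * real (card A)} < s"
    "card {v \<in> {..<n} - K. real (deg_in E A v) > (c - \<epsilon>) * real (card A)} < s"
    if "A \<subseteq> K" "l \<le> real (card A)" for A
    using typc that unfolding typical_def cq by blast+
  have typK: "\<And>v. v \<in> K \<Longrightarrow> real (deg_in E K v) \<ge> (c + \<epsilon>) * real k"
    "\<And>v. v \<in> {..<n} - K \<Longrightarrow> real (deg_in E K v) \<le> (c - \<epsilon>) * real k"
    using typc K(2) unfolding typical_def cq by blast+
  \<comment> \<open>The selection has \<open>m\<close> vertices while the threshold uses
    \<open>r\<close>; the rounding error below 1 is covered by
    \<open>1 \<le> \<epsilon> * l\<close>.\<close>
  define m where "m = nat \<lfloor>r\<rfloor>"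
  have "0 \<le> \<lfloor>r\<rfloor>" using l l0 by (simp add: zero_le_floor)
  then have "real m = of_int \<lfloor>r\<rfloor>" by (simp add: m_def)
  then have m: "real m \<le> r" "r - 1 \<le> real m" by linarith+
  have lm: "l \<le> real m" using m l by linarith
  have "m \<le> card (V \<inter> K)" using m r by linarith
  moreover have "largest_degree E V m (sel E V m)" using sel fin by (simp add: selection_rule_def)
  ultimately have K': "sel E V m \<subseteq> V \<inter> K" "card (sel E V m) = m"
    using largest_degree_planted[OF _ sep fin(2)] by auto
  define K' where "K' = sel E V m"
  have K'K: "K' \<subseteq> K" "card K' = m" using K' by (auto simp: K'_def)
  have em: "\<epsilon> * l \<le> \<epsilon> * real m" using lm \<epsilon>0 by (intro mult_left_mono) auto
  define Kt where "Kt = phase2 sel p q r E V"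
  have Kt: "Kt = {v \<in> V. c * r \<le> real (deg_in E K' v)}"
    by (simp add: Kt_def phase2_def Let_def K'_def m_def c_def)
  have cr: "c * r \<le> (c + \<epsilon>) * real m" "(c - \<epsilon>) * real m < c * r"
  proof -
    have "c * (r - real m) \<le> 1 * 1" using c1 m by (intro mult_mono) auto
    moreover have "c * real m \<le> c * r" using c1 m by (intro mult_left_mono) auto
    ultimately show "c * r \<le> (c + \<epsilon>) * real m" "(c - \<epsilon>) * real m < c * r"
      using em l(1) by (simp_all add: algebra_simps)
  qed
  have lost: "card ((V \<inter> K) - Kt) < s"
  proof -
    have "(V \<inter> K) - Kt \<subseteq> {v \<in> K. real (deg_in E K' v) < (c + \<epsilon>) * real (card K')}"
      using cr(1) by (auto simp: Kt K'K(2))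
    then have "card ((V \<inter> K) - Kt) \<le> card {v \<in> K. real (deg_in E K' v) < (c + \<epsilon>) * real (card K')}"
      using fin by (intro card_mono) auto
    also have "\<dots> < s" using K'K lm by (intro few) auto
    finally show ?thesis .
  qed
  have extra: "card (Kt - K) < s"
  proof -
    have "Kt - K \<subseteq> {v \<in> {..<n} - K. real (deg_in E K' v) > (c - \<epsilon>) * real (card K')}"
      using cr(2) V by (auto simp: Kt K'K(2))
    then have "card (Kt - K) \<le> card {v \<in> {..<n} - K. real (deg_in E K' v) > (c - \<epsilon>) * real (card K')}"
      by (intro card_mono) auto
    also have "\<dots> < s" using K'K lm by (intro few) auto
    finally show ?thesis .
  qed
  have finKt: "finite Kt" using fin by (simp add: Kt)
  have KtV: "Kt \<subseteq> V" by (auto simp: Kt)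
  \<comment> \<open>Typicality speaks only of subsets of \<open>K\<close>, so \<open>Kt\<close> is
    compared with its planted part, still of size at least \<open>l\<close>.\<close>
  define A where "A = Kt \<inter> K"
  have AK: "A \<subseteq> K" by (auto simp: A_def)
  have finA: "finite A" using finKt by (simp add: A_def)
  have lA: "l \<le> real (card A)"
  proof -
    have "card (V \<inter> K) \<le> card (A \<union> ((V \<inter> K) - Kt))"
      using fin finKt by (intro card_mono) (auto simp: A_def)
    also have "\<dots> \<le> card A + card ((V \<inter> K) - Kt)" by (rule card_Un_le)
    finally show ?thesis using lost r(2) by linarith
  qed
  have eA: "\<epsilon> * l \<le> \<epsilon> * real (card A)" using lA \<epsilon>0 by (intro mult_left_mono) auto
  have "Kt = A \<union> (Kt - K)" by (auto simp: A_def)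
  then have "card Kt \<le> card A + card (Kt - K)" by (metis card_Un_le)
  moreover have "card A \<le> card Kt" using finKt by (intro card_mono) (auto simp: A_def)
  ultimately have cKt: "card Kt \<le> card A + card (Kt - K)" "card A \<le> card Kt" by auto
  define K'' where "K'' = Kt \<union> {v \<in> {..<n}. real (deg_in E Kt v) \<ge> c * real (card Kt)}"
  have finK'': "finite K''" using finKt by (simp add: K''_def)
  have miss: "card (K - K'') < s"
  proof -
    have "K - K'' \<subseteq> {v \<in> K. real (deg_in E A v) < (c + \<epsilon>) * real (card A)}"
    proof
      fix v assume v: "v \<in> K - K''"
      then have "v \<in> {..<n}" using K by auto
      with v have "real (deg_in E Kt v) < c * real (card Kt)" by (auto simp: K''_def)
      moreover have "deg_in E A v \<le> deg_in E Kt v" using finKt by (intro deg_in_mono) (auto simp: A_def)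
      moreover have "c * real (card Kt) \<le> c * (real (card A) + real s)"
        using cKt extra c1 by (intro mult_left_mono) auto
      moreover have "c * real s \<le> 1 * real s" using c1 by (intro mult_right_mono) auto
      ultimately have "real (deg_in E A v) < (c + \<epsilon>) * real (card A)"
        using s eA unfolding ring_distribs by linarith
      then show "v \<in> {v \<in> K. real (deg_in E A v) < (c + \<epsilon>) * real (card A)}" using v by auto
    qed
    then have "card (K - K'') \<le> card {v \<in> K. real (deg_in E A v) < (c + \<epsilon>) * real (card A)}"
      using fin by (intro card_mono) auto
    also have "\<dots> < s" using AK lA by (intro few) auto
    finally show ?thesis .
  qed
  \<comment> \<open>Unplanted vertices enter \<open>K''\<close> either through \<open>Kt\<close> or
    as exceptions for \<open>A\<close>, fewer than \<open>s\<close> each.\<close>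
  have surplus: "card (K'' - K) < 2 * s"
  proof -
    have "K'' - K \<subseteq> (Kt - K) \<union> {v \<in> {..<n} - K. real (deg_in E A v) > (c - \<epsilon>) * real (card A)}"
    proof
      fix v assume v: "v \<in> K'' - K"
      show "v \<in> (Kt - K) \<union> {v \<in> {..<n} - K. real (deg_in E A v) > (c - \<epsilon>) * real (card A)}"
      proof (cases "v \<in> Kt")
        case False
        with v have n: "v \<in> {..<n}" "real (deg_in E Kt v) \<ge> c * real (card Kt)" by (auto simp: K''_def)
        have "Kt - A = Kt - K" by (auto simp: A_def)
        then have "deg_in E Kt v \<le> deg_in E A v + card (Kt - K)" using deg_in_le[OF finKt finA, of E v] by simp
        moreover have "c * real (card A) \<le> c * real (card Kt)" using cKt c1 by (intro mult_left_mono) auto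
        ultimately have "real (deg_in E A v) > (c - \<epsilon>) * real (card A)"
          using s eA extra n unfolding ring_distribs by linarith
        then show ?thesis using v n by auto
      qed (use v in auto)
    qed
    then have "card (K'' - K) \<le> card ((Kt - K) \<union> {v \<in> {..<n} - K. real (deg_in E A v) > (c - \<epsilon>) * real (card A)})"
      using finKt by (intro card_mono) auto
    also have "\<dots> \<le> card (Kt - K) + card {v \<in> {..<n} - K. real (deg_in E A v) > (c - \<epsilon>) * real (card A)}"
      by (rule card_Un_le)
    also have "\<dots> < s + s" using extra few(2)[OF AK lA] by (rule add_strict_mono)
    finally show ?thesis by simp
  qed
  have "card A \<le> k" using AK K fin by (auto intro: card_mono)
  then have ek: "\<epsilon> * l \<le> \<epsilon> * real k" using lA \<epsilon>0 by (intro mult_left_mono) auto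
  have "phase3 n p q k E Kt = {v \<in> {..<n}. c * real k \<le> real (deg_in E K'' v)}"
    by (simp add: phase3_def Let_def K''_def c_def)
  \<comment> \<open>The last test set is close to \<open>K\<close> itself, where typicality has no
    exceptions; hence every vertex is judged correctly.\<close>
  also have "\<dots> = K"
  proof (intro equalityI subsetI)
    fix v assume v: "v \<in> {v \<in> {..<n}. c * real k \<le> real (deg_in E K'' v)}"
    show "v \<in> K"
    proof (rule ccontr)
      assume "v \<notin> K"
      then have "real (deg_in E K v) \<le> (c - \<epsilon>) * real k" using v by (intro typK) auto
      moreover have "deg_in E K'' v \<le> deg_in E K v + card (K'' - K)" using fin finK'' by (intro deg_in_le)
      ultimately show False using v[unfolded mem_Collect_eq] surplus s ek unfolding ring_distribs by linarith
    qed
  next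
    fix v assume v: "v \<in> K"
    have "deg_in E K v \<le> deg_in E K'' v + card (K - K'')" using fin finK'' by (intro deg_in_le)
    with typK(1)[OF v] have "c * real k \<le> real (deg_in E K'' v)"
      using miss s ek unfolding ring_distribs by linarith
    then show "v \<in> {v \<in> {..<n}. c * real k \<le> real (deg_in E K'' v)}" using v K by auto
  qed
  finally show ?thesis by (simp add: Kt_def)
qed

section \<open>Recovery of the planted set\<close>

lemma rho'_strict_mono:
  assumes "0 < p" "p < q" "q < 1" "0 < \<alpha>" "\<alpha> < 1" "x < y"
  shows "rho' p q \<alpha> \<beta> x < rho' p q \<alpha> \<beta> y"
  unfolding rho'_def using assms
  by (intro mult_strict_left_mono gaussian_tail_strict_antimono diff_strict_left_mono mult_strict_right_mono) auto

lemma isCont_rho': "isCont (rho' p q \<alpha> \<beta>) x"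
  unfolding rho'_def[abs_def] by (intro continuous_intros isCont_o2[OF _ isCont_gaussian_tail])

lemma rho'_bounds:
  assumes "0 < \<alpha>" "\<alpha> < 1"
  shows "0 < rho' p q \<alpha> \<beta> x" "rho' p q \<alpha> \<beta> x < 1" "0 < tau \<alpha> \<beta>"
proof -
  show "0 < rho' p q \<alpha> \<beta> x" "0 < tau \<alpha> \<beta>"
    unfolding rho'_def tau_def using assms gaussian_tail_pos by auto
  have "rho' p q \<alpha> \<beta> x < 1 * 1"
    unfolding rho'_def using assms gaussian_tail_less_1 gaussian_tail_pos
    by (intro mult_strict_mono) (auto intro: less_imp_le)
  then show "rho' p q \<alpha> \<beta> x < 1" by simp
qed

text \<open>The first step of phase 1 gains a constant factor in the ratio of the number of planted vertices
  to the square root of the number of all vertices, so that all later steps have slack.\<close>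

lemma step_parameters:
  fixes p q \<alpha> \<beta> c :: real
  assumes pq: "0 < p" "p < q" "q < 1" and \<alpha>: "0 < \<alpha>" "\<alpha> < 1" and c: "0 < c"
    and gap: "tau \<alpha> \<beta> < (rho' p q \<alpha> \<beta> c)\<^sup>2"
  obtains \<tau>\<^sub>1 x\<^sub>a \<rho>\<^sub>a x\<^sub>b \<rho>\<^sub>b where
    "tau \<alpha> \<beta> < \<tau>\<^sub>1" "\<tau>\<^sub>1 < (rho' p q \<alpha> \<beta> c)\<^sup>2" "0 < x\<^sub>a" "x\<^sub>a < c"
    "0 < \<rho>\<^sub>a" "\<rho>\<^sub>a < rho' p q \<alpha> \<beta> x\<^sub>a" "x\<^sub>b * sqrt \<tau>\<^sub>1 = \<rho>\<^sub>a * x\<^sub>a" "0 < x\<^sub>b"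
    "rho' p q \<alpha> \<beta> c < \<rho>\<^sub>b" "\<rho>\<^sub>b < rho' p q \<alpha> \<beta> x\<^sub>b" "\<rho>\<^sub>a < \<rho>\<^sub>b"
proof -
  define R where "R = rho' p q \<alpha> \<beta> c"
  have R: "0 < R" and T: "0 < tau \<alpha> \<beta>" unfolding R_def using rho'_bounds \<alpha> by auto
  define \<tau>\<^sub>1 where "\<tau>\<^sub>1 = (tau \<alpha> \<beta> + R\<^sup>2) / 2"
  have \<tau>: "tau \<alpha> \<beta> < \<tau>\<^sub>1" "\<tau>\<^sub>1 < R\<^sup>2" "0 < \<tau>\<^sub>1" using gap T by (auto simp: \<tau>\<^sub>1_def R_def)
  have sq: "sqrt \<tau>\<^sub>1 < R" using \<tau> R by (simp add: real_less_lsqrt)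
  \<comment> \<open>Rounding \<open>c * sqrt n\<close> down makes the initial ratio slightly smaller
    than \<open>c\<close>. Continuity provides \<open>x\<^sub>a < c\<close> at which one step still
    lifts the ratio above \<open>c\<close>.\<close>
  have "isCont (\<lambda>x. rho' p q \<alpha> \<beta> x * x) c"
    by (intro continuous_intros isCont_rho')
  then have "((\<lambda>x. rho' p q \<alpha> \<beta> x * x) \<longlongrightarrow> R * c) (at c)" by (simp add: isCont_def R_def)
  moreover have "c * sqrt \<tau>\<^sub>1 < R * c" using sq c by simp
  ultimately have "\<forall>\<^sub>F x in at c. c * sqrt \<tau>\<^sub>1 < rho' p q \<alpha> \<beta> x * x" by (rule order_tendstoD)
  then have "\<forall>\<^sub>F x in at_left c. c * sqrt \<tau>\<^sub>1 < rho' p q \<alpha> \<beta> x * x"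
    using filter_leD[OF at_le[of "{..<c}" UNIV c]] by simp
  moreover have "\<forall>\<^sub>F x in at_left c. x < c" by (simp add: eventually_at_filter)
  moreover have "\<forall>\<^sub>F x in at_left c. 0 < x"
    by (rule order_tendstoD[OF tendsto_ident_at c])
  ultimately have "\<forall>\<^sub>F x in at_left c. 0 < x \<and> x < c \<and> c * sqrt \<tau>\<^sub>1 < rho' p q \<alpha> \<beta> x * x"
    by eventually_elim auto
  from eventually_happens'[OF trivial_limit_at_left_real this]
  obtain x\<^sub>a where xa: "0 < x\<^sub>a" "x\<^sub>a < c" "c * sqrt \<tau>\<^sub>1 < rho' p q \<alpha> \<beta> x\<^sub>a * x\<^sub>a"
    by blast
  \<comment> \<open>The survival rate at which a step from ratio \<open>x\<^sub>a\<close> with total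
    rate \<open>\<tau>\<^sub>1\<close> ends exactly at ratio \<open>c\<close>. Any
    \<open>\<rho>\<^sub>a\<close> above it gives \<open>x\<^sub>b > c\<close>.\<close>
  define u where "u = c * sqrt \<tau>\<^sub>1 / x\<^sub>a"
  have u: "0 < u" "u < rho' p q \<alpha> \<beta> x\<^sub>a" using xa c \<tau> by (auto simp: u_def field_simps)
  define \<rho>\<^sub>a where "\<rho>\<^sub>a = (u + rho' p q \<alpha> \<beta> x\<^sub>a) / 2"
  have \<rho>a: "0 < \<rho>\<^sub>a" "u < \<rho>\<^sub>a" "\<rho>\<^sub>a < rho' p q \<alpha> \<beta> x\<^sub>a" using u by (auto simp: \<rho>\<^sub>a_def)
  define x\<^sub>b where "x\<^sub>b = \<rho>\<^sub>a * x\<^sub>a / sqrt \<tau>\<^sub>1"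
  have "c * sqrt \<tau>\<^sub>1 < \<rho>\<^sub>a * x\<^sub>a" using \<rho>a(2) xa by (simp add: u_def field_simps)
  then have xb: "c < x\<^sub>b" using \<tau> by (simp add: x\<^sub>b_def field_simps)
  have mono: "R < rho' p q \<alpha> \<beta> x\<^sub>b" "rho' p q \<alpha> \<beta> x\<^sub>a < R"
    unfolding R_def using rho'_strict_mono pq \<alpha> xb xa by auto
  show ?thesis
  \<comment> \<open>As \<open>x\<^sub>b\<close> exceeds \<open>c\<close>, its rate exceeds
    \<open>R\<close>; the midpoint \<open>\<rho>\<^sub>b\<close> is strictly between the
    two.\<close>
  proof (rule that[of \<tau>\<^sub>1 x\<^sub>a \<rho>\<^sub>a x\<^sub>b "(R + rho' p q \<alpha> \<beta> x\<^sub>b) / 2", folded R_def])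
    show "x\<^sub>b * sqrt \<tau>\<^sub>1 = \<rho>\<^sub>a * x\<^sub>a" using \<tau> by (simp add: x\<^sub>b_def)
  qed (use \<tau> xa \<rho>a xb c mono in auto)
qed

lemma prob_fresh_phase1:
  fixes M L :: "nat \<Rightarrow> real"
  assumes "real (card U) \<le> M 0" "L 0 \<le> real (card (U \<inter> K))" "0 \<le> b"
    and step: "\<And>i V. i < t \<Longrightarrow> V \<subseteq> U \<Longrightarrow> real (card V) \<le> M i \<Longrightarrow> L i \<le> real (card (V \<inter> K)) \<Longrightarrow>
      measure_pmf.prob (fresh_step p \<alpha> \<beta> w V) {V'. real (card V') \<le> M (Suc i) \<and> L (Suc i) \<le> real (card (V' \<inter> K))} \<ge> 1 - b"
  shows "measure_pmf.prob (fresh_phase1 p \<alpha> \<beta> w U t) {V. real (card V) \<le> M t \<and> L t \<le> real (card (V \<inter> K))} \<ge> 1 - real t * b"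
  using step
proof (induction t)
  case 0
  then show ?case using assms by simp
next
  case (Suc t)
  have "measure_pmf.prob (fresh_phase1 p \<alpha> \<beta> w U (Suc t)) {V. real (card V) \<le> M (Suc t) \<and> L (Suc t) \<le> real (card (V \<inter> K))}
    \<ge> 1 - real t * b - b"
    unfolding fresh_phase1.simps
  proof (rule prob_bind_pmf_ge)
    show "1 - real t * b \<le> measure_pmf.prob (fresh_phase1 p \<alpha> \<beta> w U t) {V. real (card V) \<le> M t \<and> L t \<le> real (card (V \<inter> K))}"
      by (rule Suc.IH) (use Suc.prems in auto)
    fix V assume "V \<in> set_pmf (fresh_phase1 p \<alpha> \<beta> w U t)" "V \<in> {V. real (card V) \<le> M t \<and> L t \<le> real (card (V \<inter> K))}"
    then show "1 - b \<le> measure_pmf.prob (fresh_step p \<alpha> \<beta> w V) {V'. real (card V') \<le> M (Suc t) \<and> L (Suc t) \<le> real (card (V' \<inter> K))}"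
      by (intro Suc.prems) (auto dest: set_fresh_phase1D)
  qed (use assms in auto)
  then show ?case by (simp add: algebra_simps)
qed

section \<open>From one planted set to the success probability\<close>

text \<open>Typicality is an event of the full edge set; sizes and separation are known through the
  law with redrawn edges. Both become events of the joint law \<open>?J\<close> of edges and final
  vertex set, where a union bound needs no independence.\<close>

lemma prob_recover:
  fixes p q \<alpha> \<beta> \<epsilon> l c :: real and M L :: "nat \<Rightarrow> real"
  assumes pq: "0 < p" "p < q" "q < 1" and \<epsilon>: "\<epsilon> = (q - p) / 4"
    and K: "K \<subseteq> {..<n}" "card K = k" and sel: "selection_rule sel"
    and s: "0 < s" "2 * real s < \<epsilon> * l" and l: "1 \<le> \<epsilon> * l" "1 \<le> l" "2 \<le> \<epsilon> * real k"
    and r: "r = rho' p q \<alpha> \<beta> c ^ t * real k" "l + 1 \<le> r" "r \<le> L t" "l + real s \<le> L t" "2 \<le> L t"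
    and bnds: "real n \<le> M 0" "L 0 \<le> real k" "0 \<le> b" "0 \<le> M t"
    and step: "\<And>i V. i < t \<Longrightarrow> V \<subseteq> {..<n} \<Longrightarrow> real (card V) \<le> M i \<Longrightarrow> L i \<le> real (card (V \<inter> K)) \<Longrightarrow>
      measure_pmf.prob (fresh_step p \<alpha> \<beta> (planted_weight p q K) V)
        {V'. real (card V') \<le> M (Suc i) \<and> L (Suc i) \<le> real (card (V' \<inter> K))} \<ge> 1 - b"
  shows "measure_pmf.prob (bind_pmf (random_edges n p q K) (dense_graph_alg sel n p q c k \<alpha> \<beta> t)) {K} \<ge>
    1 - (2 * 2 ^ k * real n ^ s * exp (- (\<epsilon>\<^sup>2 / 2 * l * real s)) + 2 * real n * exp (- (\<epsilon>\<^sup>2 / 2 * real k))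
      + (real t * b + 2 * M t * exp (- ((q - p)\<^sup>2 * (L t)\<^sup>2 / (8 * M t)))))"
proof -
  define w where "w = planted_weight p q K"
  let ?G = "random_sub (pairs {..<n}) w"
  let ?J = "do { E \<leftarrow> ?G; V \<leftarrow> phase1 p \<alpha> \<beta> E {..<n} t; return_pmf (E, V) }"
  let ?a1 = "2 * 2 ^ k * real n ^ s * exp (- (\<epsilon>\<^sup>2 / 2 * l * real s)) + 2 * real n * exp (- (\<epsilon>\<^sup>2 / 2 * real k))"
  let ?a2 = "2 * M t * exp (- ((q - p)\<^sup>2 * (L t)\<^sup>2 / (8 * M t)))"
  let ?good = "\<lambda>V. real (card V) \<le> M t \<and> L t \<le> real (card (V \<inter> K))"
  have UK: "card ({..<n} \<inter> K) = k" using K by (simp add: Int_absorb1)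
  have \<epsilon>0: "0 < \<epsilon>" using pq \<epsilon> by simp
  have J: "E \<subseteq> pairs {..<n} \<and> V \<subseteq> {..<n}" if "(E, V) \<in> set_pmf ?J" for E V
    using that by (auto dest: set_random_subD set_phase1D)
  have T: "measure_pmf.prob ?J {(E, V). typical n p q K \<epsilon> l s E} \<ge> 1 - ?a1"
  proof -
    have "map_pmf fst ?J = ?G" by (simp add: map_bind_pmf bind_return_pmf')
    moreover have "measure_pmf.prob ?G {E. typical n p q K \<epsilon> l s E} \<ge> 1 - ?a1"
      using prob_typical[OF pq K(1) \<epsilon>0 s(1), of l] s(2) l K(2) unfolding random_edges_eq w_def[symmetric] by simp
    ultimately have "measure_pmf.prob (map_pmf fst ?J) {E. typical n p q K \<epsilon> l s E} \<ge> 1 - ?a1" by simp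
    then show ?thesis by (simp add: vimage_def case_prod_beta')
  qed
  have S: "measure_pmf.prob ?J {(E, V). ?good V \<and> separated K V E} \<ge> 1 - (real t * b + ?a2)"
  proof -
    have "do { E \<leftarrow> ?G; V \<leftarrow> phase1 p \<alpha> \<beta> E {..<n} t; return_pmf (V, E \<inter> pairs V) } =
      map_pmf (\<lambda>(E, V). (V, E \<inter> pairs V)) ?J"
      by (simp add: map_bind_pmf)
    then have law: "map_pmf (\<lambda>(E, V). (V, E \<inter> pairs V)) ?J =
      do { V \<leftarrow> fresh_phase1 p \<alpha> \<beta> w {..<n} t; F \<leftarrow> random_sub (pairs V) w; return_pmf (V, F) }"
      using phase1_deferred[of "{..<n}" w p \<alpha> \<beta> t] by simp
    have "measure_pmf.prob (do { V \<leftarrow> fresh_phase1 p \<alpha> \<beta> w {..<n} t; F \<leftarrow> random_sub (pairs V) w; return_pmf (V, F) })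
       {(V, F). ?good V \<and> separated K V F} \<ge> 1 - real t * b - ?a2"
    proof (rule prob_bind_pmf_ge)
      show "measure_pmf.prob (fresh_phase1 p \<alpha> \<beta> w {..<n} t) {V. ?good V} \<ge> 1 - real t * b"
        by (rule prob_fresh_phase1[where U = "{..<n}"]) (use bnds UK step w_def in auto)
      fix V assume V: "V \<in> set_pmf (fresh_phase1 p \<alpha> \<beta> w {..<n} t)" "V \<in> {V. ?good V}"
      then have "finite V" by (auto dest!: set_fresh_phase1D finite_subset)
      with V(2) have "measure_pmf.prob (random_sub (pairs V) w) {F. separated K V F} \<ge> 1 - ?a2"
        unfolding w_def by (intro prob_separated pq r) auto
      then have "measure_pmf.prob (map_pmf (Pair V) (random_sub (pairs V) w)) {(V, F). ?good V \<and> separated K V F} \<ge> 1 - ?a2"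
        using V(2) by (simp add: vimage_def)
      then show "1 - ?a2 \<le> measure_pmf.prob (random_sub (pairs V) w \<bind> (\<lambda>F. return_pmf (V, F))) {(V, F). ?good V \<and> separated K V F}"
        by (simp add: map_pmf_def)
    qed (use bnds in auto)
    then have "measure_pmf.prob (map_pmf (\<lambda>(E, V). (V, E \<inter> pairs V)) ?J) {(V, F). ?good V \<and> separated K V F} \<ge> 1 - (real t * b + ?a2)"
      unfolding law by simp
    then have "measure_pmf.prob ?J {(E, V). ?good V \<and> separated K V (E \<inter> pairs V)} \<ge> 1 - (real t * b + ?a2)"
      by (simp add: vimage_def case_prod_beta')
    then show ?thesis
    proof (rule prob_mono)
      fix z assume z: "z \<in> set_pmf ?J" "z \<in> {(E, V). ?good V \<and> separated K V (E \<inter> pairs V)}"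
      obtain E V where zEV: "z = (E, V)" by (cases z)
      then have "E \<subseteq> pairs {..<n}" using z(1) J by blast
      then show "z \<in> {(E, V). ?good V \<and> separated K V E}"
        using z(2) zEV by (simp add: separated_restrict_pairs)
    qed
  qed
  have "measure_pmf.prob ?J {(E, V). phase3 n p q k E (phase2 sel p q r E V) = K} \<ge> 1 - (?a1 + (real t * b + ?a2))"
  proof (rule prob_mono[OF prob_Int_ge[OF T S]])
    fix z assume z: "z \<in> set_pmf ?J" "z \<in> {(E, V). typical n p q K \<epsilon> l s E} \<inter> {(E, V). ?good V \<and> separated K V E}"
    obtain E V where zEV: "z = (E, V)" by (cases z)
    have "phase3 n p q k E (phase2 sel p q r E V) = K"
      by (rule phases23_recover[where \<epsilon> = \<epsilon> and l = l and s = s])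
        (use pq \<epsilon> K sel s l r z J[of E V] zEV in auto)
    then show "z \<in> {(E, V). phase3 n p q k E (phase2 sel p q r E V) = K}" using zEV by simp
  qed
  also have "measure_pmf.prob ?J {(E, V). phase3 n p q k E (phase2 sel p q r E V) = K} =
    measure_pmf.prob (map_pmf (\<lambda>(E, V). phase3 n p q k E (phase2 sel p q r E V)) ?J) {K}"
    by (simp add: vimage_def case_prod_beta')
  also have "map_pmf (\<lambda>(E, V). phase3 n p q k E (phase2 sel p q r E V)) ?J =
    bind_pmf (random_edges n p q K) (dense_graph_alg sel n p q c k \<alpha> \<beta> t)"
    unfolding random_edges_eq w_def[symmetric] dense_graph_alg_def[abs_def] r(1)
    by (simp add: map_bind_pmf)
  finally show ?thesis .
qed

lemma success_prob_ge:
  assumes "k \<le> n" "0 \<le> a"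
    and "\<And>K. K \<subseteq> {..<n} \<Longrightarrow> card K = k \<Longrightarrow>
      measure_pmf.prob (bind_pmf (random_edges n p q K) (dense_graph_alg sel n p q c k \<alpha> \<beta> t)) {K} \<ge> 1 - a"
  shows "success_prob sel n p q c k \<alpha> \<beta> t \<ge> 1 - a"
proof -
  let ?S = "{K. K \<subseteq> {..<n} \<and> card K = k}"
  have "finite ?S" by (rule finite_subset[of _ "Pow {..<n}"]) auto
  moreover have "?S \<noteq> {}"
    using obtain_subset_with_card_n[of k "{..<n}"] assms(1) by auto
  ultimately have set: "set_pmf (pmf_of_set ?S) = ?S" by (simp add: set_pmf_of_set)
  have eq: "(do {
          (K, E) \<leftarrow> planted_graph n p k q;
          K_out \<leftarrow> dense_graph_alg sel n p q c k \<alpha> \<beta> t E;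
          return_pmf (K, K_out)
        }) = bind_pmf (pmf_of_set ?S) (\<lambda>K. map_pmf (Pair K) (bind_pmf (random_edges n p q K) (dense_graph_alg sel n p q c k \<alpha> \<beta> t)))"
    by (simp add: planted_graph_def bind_assoc_pmf bind_return_pmf map_pmf_def)
  have "success_prob sel n p q c k \<alpha> \<beta> t \<ge> 1 - 0 - a"
    unfolding success_prob_def eq
  proof (rule prob_bind_pmf_ge)
    show "1 - 0 \<le> measure_pmf.prob (pmf_of_set ?S) UNIV" by simp
    fix K assume "K \<in> set_pmf (pmf_of_set ?S)"
    then have "K \<subseteq> {..<n}" "card K = k" unfolding set by auto
    moreover have "Pair K -` {(K, K_out). K_out = K} = {K}" by auto
    ultimately show "1 - a \<le> measure_pmf.prob (map_pmf (Pair K) (bind_pmf (random_edges n p q K) (dense_graph_alg sel n p q c k \<alpha> \<beta> t))) {(K, K_out). K_out = K}"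
      using assms(3)[of K] by simp
  qed (use assms in auto)
  then show ?thesis by simp
qed

section \<open>Asymptotics\<close>

lemma eventually_exp_decay:
  fixes A C \<theta> \<epsilon> :: real
  assumes "0 < A" "0 < C" "0 < \<epsilon>" "\<epsilon> < \<theta>"
  shows "\<forall>\<^sub>F n::nat in sequentially. A * real n * exp (- (C * real n powr \<theta>)) \<le> exp (- (real n powr \<epsilon>)) / 4"
  using assms by real_asymp

text \<open>The negative exponent has order n powr (11/16), as 7/16 + 1/4 = 11/16. It dominates the
  order sqrt n from the subsets of \<open>K\<close> and n powr (1/4) * ln n from the exceptional
  sets.\<close>

lemma eventually_union_bound_small:
  fixes c D :: real
  assumes "0 < c" "0 < D"
  shows "\<forall>\<^sub>F n::nat in sequentially. 2 * (exp (c * sqrt (real n)) * exp ((real n powr (1/4) + 1) * ln (real n)) *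
    exp (- (D * (real n powr (7/16) * real n powr (1/4))))) \<le> exp (- (real n powr (1/8))) / 4"
  using assms by real_asymp

text \<open>Geometric decay over logarithmically many steps costs only a power of n; a small
  \<open>\<kappa>\<close> makes the loss exponent as small as desired.\<close>

lemma power_ge_powr:
  fixes u \<kappa> \<delta> :: real
  assumes "0 < u" "u < 1" "\<kappa> * (- ln u) \<le> \<delta>" "real i \<le> \<kappa> * ln (real n)" "1 \<le> n"
  shows "real n powr (- \<delta>) \<le> u ^ i"
proof -
  have "- \<delta> * ln (real n) \<le> \<kappa> * ln u * ln (real n)"
    using assms by (intro mult_right_mono) auto
  also have "\<dots> = (\<kappa> * ln (real n)) * ln u" by simp
  also have "\<dots> \<le> real i * ln u"
    using assms by (intro mult_right_mono_neg) auto
  finally have "exp (- \<delta> * ln (real n)) \<le> exp (real i * ln u)" by simp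
  also have "exp (real i * ln u) = u ^ i" using assms by (simp add: exp_of_nat_mult)
  finally show ?thesis using assms by (simp add: powr_def)
qed

text \<open>\<open>one_step\<close> is used for two ratios only: \<open>x\<^sub>a\<close> in the
  first step and \<open>x\<^sub>b\<close> in all later ones. This gives a single
  \<open>\<gamma>\<close> and a single threshold for n, although the number of steps grows with
  n.\<close>

lemma phase1_sizes:
  fixes p q \<alpha> \<beta> c R \<kappa> :: real
  assumes pq: "0 < p" "p < q" "q < 1" and \<alpha>: "0 < \<alpha>" "\<alpha> < 1" and c: "0 < c"
    and steps: "tau \<alpha> \<beta> < \<tau>\<^sub>1" "0 < x\<^sub>a" "x\<^sub>a < c"
    "0 < \<rho>\<^sub>a" "\<rho>\<^sub>a < rho' p q \<alpha> \<beta> x\<^sub>a" "x\<^sub>b * sqrt \<tau>\<^sub>1 = \<rho>\<^sub>a * x\<^sub>a" "0 < x\<^sub>b"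
    "R < \<rho>\<^sub>b" "\<rho>\<^sub>b < rho' p q \<alpha> \<beta> x\<^sub>b" "\<rho>\<^sub>a < \<rho>\<^sub>b"
    and R: "0 < R" "R < 1" "\<tau>\<^sub>1 < R\<^sup>2"
    and \<kappa>: "0 < \<kappa>" "\<kappa> * (- ln R) \<le> 1 / 16" "\<kappa> * (- ln \<tau>\<^sub>1) \<le> 1 / 16"
  defines "k \<equiv> \<lambda>n. nat \<lfloor>c * sqrt (real n)\<rfloor>"
    and "M \<equiv> \<lambda>n i. \<tau>\<^sub>1 ^ i * real n"
    and "L \<equiv> \<lambda>n i. (if i = 0 then real (nat \<lfloor>c * sqrt (real n)\<rfloor>) else \<rho>\<^sub>a * \<rho>\<^sub>b ^ (i - 1) * real (nat \<lfloor>c * sqrt (real n)\<rfloor>))"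
  shows "\<exists>\<gamma>>0. \<forall>\<^sub>F n in sequentially. \<forall>t K i V. real t \<le> \<kappa> * ln (real n) \<longrightarrow> K \<subseteq> {..<n} \<longrightarrow> card K = k n \<longrightarrow>
     i < t \<longrightarrow> V \<subseteq> {..<n} \<longrightarrow> real (card V) \<le> M n i \<longrightarrow> L n i \<le> real (card (V \<inter> K)) \<longrightarrow>
     measure_pmf.prob (fresh_step p \<alpha> \<beta> (planted_weight p q K) V)
       {V'. real (card V') \<le> M n (Suc i) \<and> L n (Suc i) \<le> real (card (V' \<inter> K))}
       \<ge> 1 - 6 * exp (- (\<gamma> * real n powr (7/16)))"
proof -
  have \<tau>0: "0 < \<tau>\<^sub>1" using steps(1) rho'_bounds(3)[OF \<alpha>, of \<beta>] by linarith
  have \<tau>1: "\<tau>\<^sub>1 < 1"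
  proof -
    have "R\<^sup>2 < 1" using R by (simp add: power_less_one_iff abs_square_less_1)
    then show ?thesis using R by linarith
  qed
  have \<rho>b: "0 < \<rho>\<^sub>b" using steps R by linarith
  define P where "P x \<rho> \<gamma> L\<^sub>0 \<longleftrightarrow> (\<forall>V K M L. finite V \<longrightarrow> real (card V) \<le> M \<longrightarrow> L\<^sub>0 \<le> L \<longrightarrow> L \<le> real (card (V \<inter> K)) \<longrightarrow>
     x * sqrt M \<le> L \<longrightarrow> real (card (V \<inter> K)) \<le> \<gamma> * M \<longrightarrow>
     measure_pmf.prob (fresh_step p \<alpha> \<beta> (planted_weight p q K) V)
       {V'. real (card V') \<le> \<tau>\<^sub>1 * M \<and> \<rho> * L \<le> real (card (V' \<inter> K))} \<ge> 1 - 6 * exp (- \<gamma> * L))"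
    for x \<rho> \<gamma> L\<^sub>0 :: real
  obtain \<gamma>a La where a: "0 < \<gamma>a" "P x\<^sub>a \<rho>\<^sub>a \<gamma>a La"
    using one_step[OF pq \<alpha> steps(2,4,5,1)] unfolding P_def by blast
  obtain \<gamma>b Lb where b: "0 < \<gamma>b" "P x\<^sub>b \<rho>\<^sub>b \<gamma>b Lb"
    using one_step[OF pq \<alpha> steps(7) \<rho>b steps(9,1)] unfolding P_def by blast
  define \<gamma> where "\<gamma> = min \<gamma>a \<gamma>b"
  have \<gamma>: "0 < \<gamma>" "\<gamma> \<le> \<gamma>a" "\<gamma> \<le> \<gamma>b" using a b by (auto simp: \<gamma>_def)
  define C where "C = \<rho>\<^sub>a / \<rho>\<^sub>b * (c / 2)"
  have C: "0 < C" using steps c \<rho>b by (simp add: C_def)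
  show ?thesis
  proof (intro exI[of _ "\<gamma> * C"] conjI)
    show "0 < \<gamma> * C" using \<gamma> C by simp
    have "\<forall>\<^sub>F n::nat in sequentially. max La Lb \<le> C * real n powr (7/16)"
      using C by real_asymp
    \<comment> \<open>At most \<open>c * sqrt n\<close> vertices are planted, while the bound
      \<open>M n i\<close> stays at least n powr (15/16); so the planted part is below
      \<open>\<gamma> * M n i\<close> in every step.\<close>
    moreover have "\<forall>\<^sub>F n::nat in sequentially. c * sqrt (real n) \<le> \<gamma> * (real n powr (-1/16) * real n)"
      using c \<gamma>(1) by real_asymp
    moreover have "\<forall>\<^sub>F n::nat in sequentially. x\<^sub>a * sqrt (real n) \<le> c * sqrt (real n) - 1"
      using steps(2,3) by real_asymp
    moreover have "\<forall>\<^sub>F n::nat in sequentially. c / 2 * sqrt (real n) \<le> c * sqrt (real n) - 1"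
      using c by real_asymp
    ultimately show "\<forall>\<^sub>F n in sequentially. \<forall>t K i V. real t \<le> \<kappa> * ln (real n) \<longrightarrow> K \<subseteq> {..<n} \<longrightarrow> card K = k n \<longrightarrow>
     i < t \<longrightarrow> V \<subseteq> {..<n} \<longrightarrow> real (card V) \<le> M n i \<longrightarrow> L n i \<le> real (card (V \<inter> K)) \<longrightarrow>
     measure_pmf.prob (fresh_step p \<alpha> \<beta> (planted_weight p q K) V)
       {V'. real (card V') \<le> M n (Suc i) \<and> L n (Suc i) \<le> real (card (V' \<inter> K))}
       \<ge> 1 - 6 * exp (- (\<gamma> * C * real n powr (7/16)))"
      using eventually_ge_at_top[of 1]
    proof eventually_elim
      case (elim n)
      show ?case
      proof (intro allI impI)
        fix t K i V
        assume t: "real t \<le> \<kappa> * ln (real n)" and K: "K \<subseteq> {..<n}" "card K = k n" and i: "i < t"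
          and V: "V \<subseteq> {..<n}" "real (card V) \<le> M n i" "L n i \<le> real (card (V \<inter> K))"
        have finK: "finite K" and finV: "finite V" using K V finite_subset by auto
        have kL: "L n 0 = real (k n)" by (simp add: L_def k_def)
        have Lpos: "L n (Suc j) = \<rho>\<^sub>a * \<rho>\<^sub>b ^ j * real (k n)" for j by (simp add: L_def k_def)
        have "0 \<le> c * sqrt (real n)" using c by simp
        then have "0 \<le> \<lfloor>c * sqrt (real n)\<rfloor>" by (simp add: zero_le_floor)
        then have "real (k n) = of_int \<lfloor>c * sqrt (real n)\<rfloor>" by (simp add: k_def)
        then have kb: "real (k n) \<le> c * sqrt (real n)" "c * sqrt (real n) - 1 \<le> real (k n)" by linarith+
        have it: "real i \<le> \<kappa> * ln (real n)" using i t by linarith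
        have Ri: "real n powr (- (1/16)) \<le> R ^ i"
          by (rule power_ge_powr[OF R(1,2) \<kappa>(2) it elim(5)])
        have \<tau>i: "real n powr (- (1/16)) \<le> \<tau>\<^sub>1 ^ i"
          by (rule power_ge_powr[OF \<tau>0 \<tau>1 \<kappa>(3) it elim(5)])
        have n716: "real n powr (- (1/16)) * sqrt (real n) = real n powr (7/16)"
          using elim(5) by (simp add: powr_half_sqrt[symmetric] powr_add[symmetric])
        have Lge: "C * real n powr (7/16) \<le> L n i"
        proof -
          \<comment> \<open>The factor \<open>\<rho>\<^sub>a / \<rho>\<^sub>b\<close> corrects for
            the different first rate. For \<open>i = 0\<close> it is merely a loss, as
            \<open>\<rho>\<^sub>a < \<rho>\<^sub>b\<close>.\<close>
          have 1: "\<rho>\<^sub>a / \<rho>\<^sub>b * (\<rho>\<^sub>b ^ i * real (k n)) \<le> L n i"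
          proof (cases i)
            case 0
            have "\<rho>\<^sub>a / \<rho>\<^sub>b * real (k n) \<le> 1 * real (k n)"
              using steps \<rho>b by (intro mult_right_mono) auto
            then show ?thesis using 0 kL by simp
          next
            case (Suc j)
            then show ?thesis using \<rho>b by (simp add: Lpos)
          qed
          have 2: "c / 2 * real n powr (7/16) \<le> \<rho>\<^sub>b ^ i * real (k n)"
          proof -
            have "c / 2 * real n powr (7/16) = real n powr (- (1/16)) * (c / 2 * sqrt (real n))"
              unfolding n716[symmetric] by simp
            also have "\<dots> \<le> R ^ i * real (k n)"
              using Ri elim kb c R by (intro mult_mono) auto
            also have "\<dots> \<le> \<rho>\<^sub>b ^ i * real (k n)"
              using R steps by (intro mult_right_mono power_mono) auto
            finally show ?thesis .
          qed
          have "C * real n powr (7/16) = \<rho>\<^sub>a / \<rho>\<^sub>b * (c / 2 * real n powr (7/16))" by (simp add: C_def)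
          also have "\<dots> \<le> \<rho>\<^sub>a / \<rho>\<^sub>b * (\<rho>\<^sub>b ^ i * real (k n))"
            using 2 steps \<rho>b by (intro mult_left_mono) auto
          finally show ?thesis using 1 by linarith
        qed
        have L0: "La \<le> L n i" "Lb \<le> L n i" using Lge elim(1) by linarith+
        have cVK: "real (card (V \<inter> K)) \<le> \<gamma> * M n i"
        proof -
          have "card (V \<inter> K) \<le> card K" using finK by (intro card_mono) auto
          then have "real (card (V \<inter> K)) \<le> real (k n)" using K by simp
          also have "\<dots> \<le> \<gamma> * (real n powr (-1/16) * real n)" using kb elim(2) by linarith
          also have "\<dots> \<le> \<gamma> * M n i"
            unfolding M_def using \<tau>i \<gamma> by (intro mult_left_mono mult_right_mono) auto
          finally show ?thesis .
        qed
        have M0: "0 \<le> M n i" using \<tau>0 by (simp add: M_def)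
        have ex: "1 - 6 * exp (- (\<gamma> * C * real n powr (7/16))) \<le> 1 - 6 * exp (- g * L n i)" if "\<gamma> \<le> g" for g
        proof -
          have "\<gamma> * (C * real n powr (7/16)) \<le> g * L n i"
            using that \<gamma> Lge C by (intro mult_mono) auto
          then show ?thesis by (simp add: mult.assoc)
        qed
        have Msuc: "M n (Suc i) = \<tau>\<^sub>1 * M n i" by (simp add: M_def)
        show "measure_pmf.prob (fresh_step p \<alpha> \<beta> (planted_weight p q K) V)
         {V'. real (card V') \<le> M n (Suc i) \<and> L n (Suc i) \<le> real (card (V' \<inter> K))}
         \<ge> 1 - 6 * exp (- (\<gamma> * C * real n powr (7/16)))"
        proof (cases i)
          case 0
          have Ls: "L n (Suc i) = \<rho>\<^sub>a * L n i" using 0 by (simp add: Lpos kL)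
          have "x\<^sub>a * sqrt (M n i) \<le> L n i" using 0 kL kb elim(3) by (simp add: M_def)
          moreover have "real (card (V \<inter> K)) \<le> \<gamma>a * M n i"
            using cVK \<gamma> M0 mult_right_mono[of \<gamma> \<gamma>a "M n i"] by linarith
          ultimately show ?thesis
            using a(2)[unfolded P_def, rule_format, of V "M n i" "L n i" K] finV V L0(1) ex[OF \<gamma>(2)]
            unfolding Msuc Ls by linarith
        next
          case (Suc j)
          have Ls: "L n (Suc i) = \<rho>\<^sub>b * L n i" using Suc by (simp add: Lpos)
          \<comment> \<open>The ratio reaches \<open>x\<^sub>b\<close> after the first step by the
            equation between \<open>x\<^sub>b\<close> and \<open>x\<^sub>a\<close>. It never falls
            again, because \<open>sqrt \<tau>\<^sub>1 < R < \<rho>\<^sub>b\<close>.\<close>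
          have "x\<^sub>b * sqrt (M n (Suc j)) \<le> L n (Suc j)" for j
          proof (induction j)
            case 0
            have "x\<^sub>b * sqrt (M n (Suc 0)) = \<rho>\<^sub>a * (x\<^sub>a * sqrt (real n))"
              using steps(6) by (simp add: M_def real_sqrt_mult)
            also have "\<dots> \<le> \<rho>\<^sub>a * real (k n)" using elim(3) kb steps by (intro mult_left_mono) auto
            finally show ?case by (simp add: Lpos)
          next
            case (Suc j)
            have "x\<^sub>b * sqrt (M n (Suc (Suc j))) = sqrt \<tau>\<^sub>1 * (x\<^sub>b * sqrt (M n (Suc j)))"
              by (simp add: M_def real_sqrt_mult)
            also have "\<dots> \<le> sqrt \<tau>\<^sub>1 * L n (Suc j)" using Suc \<tau>0 by (intro mult_left_mono) auto
            also have "\<dots> \<le> \<rho>\<^sub>b * L n (Suc j)"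
            proof (rule mult_right_mono)
              have "sqrt \<tau>\<^sub>1 < R" using R by (simp add: real_less_lsqrt)
              then show "sqrt \<tau>\<^sub>1 \<le> \<rho>\<^sub>b" using steps by linarith
            qed (use steps \<rho>b in \<open>simp add: Lpos\<close>)
            finally show ?case by (simp add: Lpos mult_ac)
          qed
          then have "x\<^sub>b * sqrt (M n i) \<le> L n i" using Suc by simp
          moreover have "real (card (V \<inter> K)) \<le> \<gamma>b * M n i"
            using cVK \<gamma> M0 mult_right_mono[of \<gamma> \<gamma>b "M n i"] by linarith
          ultimately show ?thesis
            using b(2)[unfolded P_def, rule_format, of V "M n i" "L n i" K] finV V L0(2) ex[OF \<gamma>(3)]
            unfolding Msuc Ls by linarith
        qed
      qed
    qed
  qed
qed

lemma success_prob_asymptotics: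
  fixes p q \<alpha> \<beta> c :: real
  assumes pq: "0 < p" "p < q" "q < 1" and \<alpha>: "0 < \<alpha>" "\<alpha> < 1" and c: "0 < c"
    and gap: "tau \<alpha> \<beta> < (rho' p q \<alpha> \<beta> c)\<^sup>2"
  shows "\<exists>\<epsilon>\<^sub>4 \<epsilon>\<^sub>0 :: real. 0 < \<epsilon>\<^sub>4 \<and> 0 < \<epsilon>\<^sub>0 \<and>
    (\<forall>\<^sub>F n in sequentially. \<forall>sel. selection_rule sel \<longrightarrow>
       success_prob sel n p q c (nat \<lfloor>c * sqrt (real n)\<rfloor>) \<alpha> \<beta> (num_iterations \<epsilon>\<^sub>4 p q \<alpha> \<beta> c n)
         \<ge> 1 - exp (- (real n powr \<epsilon>\<^sub>0)))"
proof -
  define R where "R = rho' p q \<alpha> \<beta> c"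
  define T where "T = tau \<alpha> \<beta>"
  have R: "0 < R" "R < 1" and T: "0 < T" unfolding R_def T_def by (rule rho'_bounds[OF \<alpha>])+
  have gap': "T < R\<^sup>2" using gap by (simp add: R_def T_def)
  from step_parameters[OF pq \<alpha> c gap]
  obtain \<tau>\<^sub>1 x\<^sub>a \<rho>\<^sub>a x\<^sub>b \<rho>\<^sub>b where steps: "tau \<alpha> \<beta> < \<tau>\<^sub>1" "0 < x\<^sub>a" "x\<^sub>a < c"
    "0 < \<rho>\<^sub>a" "\<rho>\<^sub>a < rho' p q \<alpha> \<beta> x\<^sub>a" "x\<^sub>b * sqrt \<tau>\<^sub>1 = \<rho>\<^sub>a * x\<^sub>a" "0 < x\<^sub>b"
    "R < \<rho>\<^sub>b" "\<rho>\<^sub>b < rho' p q \<alpha> \<beta> x\<^sub>b" "\<rho>\<^sub>a < \<rho>\<^sub>b" and \<tau>R: "\<tau>\<^sub>1 < R\<^sup>2"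
    unfolding R_def by metis
  have \<tau>0: "0 < \<tau>\<^sub>1" using steps(1) T by (simp add: T_def)
  have R2: "R\<^sup>2 < 1" using R by (simp add: power_less_one_iff abs_square_less_1)
  have \<tau>1: "\<tau>\<^sub>1 < 1" using \<tau>R R2 by linarith
  have \<rho>b: "0 < \<rho>\<^sub>b" using steps R by linarith
  define \<Lambda> where "\<Lambda> = ln (R\<^sup>2 / T)"
  have \<Lambda>: "0 < \<Lambda>" unfolding \<Lambda>_def by (rule ln_gt_zero) (use gap' T in simp)
  \<comment> \<open>Small enough that over \<open>\<kappa> * ln n\<close> steps neither
    \<open>R\<close> nor \<open>\<tau>\<^sub>1\<close> loses more than a factor n powr
    (1/16).\<close>
  define \<kappa> where "\<kappa> = 1 / (16 * (- ln R - ln \<tau>\<^sub>1))"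
  have lns: "0 < - ln R" "0 < - ln \<tau>\<^sub>1" using R \<tau>0 \<tau>1 by auto
  have \<kappa>: "0 < \<kappa>" "\<kappa> * (- ln R) \<le> 1 / 16" "\<kappa> * (- ln \<tau>\<^sub>1) \<le> 1 / 16"
    using lns by (auto simp: \<kappa>_def field_simps)
  \<comment> \<open>Cancels the logarithm in the denominator of \<open>num_iterations\<close>, so
    that the number of steps is \<open>\<kappa> * ln n\<close> rounded down.\<close>
  define \<epsilon>\<^sub>4 where "\<epsilon>\<^sub>4 = \<kappa> * \<Lambda>"
  have \<epsilon>4: "0 < \<epsilon>\<^sub>4" using \<kappa> \<Lambda> by (simp add: \<epsilon>\<^sub>4_def)
  define k where "k n = nat \<lfloor>c * sqrt (real n)\<rfloor>" for n
  define M where "M n i = \<tau>\<^sub>1 ^ i * real n" for n i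
  define L where "L n i = (if i = 0 then real (k n) else \<rho>\<^sub>a * \<rho>\<^sub>b ^ (i - 1) * real (k n))" for n i
  define t where "t n = num_iterations \<epsilon>\<^sub>4 p q \<alpha> \<beta> c n" for n
  have t_eq: "t n = nat \<lfloor>\<kappa> * ln (real n)\<rfloor>" for n
  proof -
    have "\<epsilon>\<^sub>4 * log 2 (real n) / log 2 (R\<^sup>2 / T) = \<kappa> * ln (real n)"
      using \<Lambda> by (simp add: \<epsilon>\<^sub>4_def log_def \<Lambda>_def[symmetric])
    then show ?thesis by (simp add: t_def num_iterations_def R_def T_def)
  qed
  have tb: "real (t n) \<le> \<kappa> * ln (real n)" "\<kappa> * ln (real n) - 1 \<le> real (t n)" if "1 \<le> n" for n
  proof -
    have "0 \<le> \<lfloor>\<kappa> * ln (real n)\<rfloor>" using \<kappa> that by (simp add: zero_le_floor)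
    then have "real (t n) = of_int \<lfloor>\<kappa> * ln (real n)\<rfloor>" by (simp add: t_eq)
    then show "real (t n) \<le> \<kappa> * ln (real n)" "\<kappa> * ln (real n) - 1 \<le> real (t n)" by linarith+
  qed
  obtain \<gamma> where \<gamma>: "0 < \<gamma>" and sizes: "\<forall>\<^sub>F n in sequentially. \<forall>t K i V. real t \<le> \<kappa> * ln (real n) \<longrightarrow> K \<subseteq> {..<n} \<longrightarrow> card K = k n \<longrightarrow>
     i < t \<longrightarrow> V \<subseteq> {..<n} \<longrightarrow> real (card V) \<le> M n i \<longrightarrow> L n i \<le> real (card (V \<inter> K)) \<longrightarrow>
     measure_pmf.prob (fresh_step p \<alpha> \<beta> (planted_weight p q K) V)
       {V'. real (card V') \<le> M n (Suc i) \<and> L n (Suc i) \<le> real (card (V' \<inter> K))}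
       \<ge> 1 - 6 * exp (- (\<gamma> * real n powr (7/16)))"
    using phase1_sizes[OF pq \<alpha> c steps R \<tau>R \<kappa>] unfolding k_def M_def L_def by blast
  \<comment> \<open>A lower bound for the growth per step of the squared planted count over the
    total count; over all steps it accumulates to order \<open>n powr \<theta>\<close>, the exponent
    in the failure bound for separation.\<close>
  define g where "g = R\<^sup>2 / \<tau>\<^sub>1"
  have g: "1 < g" using \<tau>R \<tau>0 by (simp add: g_def)
  define \<theta> where "\<theta> = \<kappa> * ln g"
  have \<theta>: "0 < \<theta>" using \<kappa> g by (simp add: \<theta>_def)
  define C where "C = (q - p)\<^sup>2 / 8 * ((\<rho>\<^sub>a / \<rho>\<^sub>b)\<^sup>2 * (c / 2)\<^sup>2 / g)"
  have C: "0 < C" using pq steps \<rho>b c g by (simp add: C_def)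
  \<comment> \<open>Smaller than \<open>\<theta>\<close> and at most 1/8, so that each of the four
    failure terms is eventually at most a quarter of the target.\<close>
  define \<epsilon>\<^sub>0 where "\<epsilon>\<^sub>0 = min \<theta> (1/4) / 2"
  have \<epsilon>0: "0 < \<epsilon>\<^sub>0" "\<epsilon>\<^sub>0 < \<theta>" "\<epsilon>\<^sub>0 < 1/2" "\<epsilon>\<^sub>0 < 7/16" "\<epsilon>\<^sub>0 \<le> 1/8"
    using \<theta> by (auto simp: \<epsilon>\<^sub>0_def min_def)
  define \<epsilon> where "\<epsilon> = (q - p) / 4"
  have \<epsilon>: "0 < \<epsilon>" using pq by (simp add: \<epsilon>_def)
  define l where "l n = c / 4 * real n powr (7/16)" for n :: nat
  define s where "s n = nat \<lceil>real n powr (1/4)\<rceil>" for n :: nat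
  \<comment> \<open>The first step may retain fewer planted vertices than rate \<open>R\<close>
    prescribes. After \<open>N\<close> steps at the better rate \<open>\<rho>\<^sub>b\<close> the
    deficit is made up, so at least \<open>R ^ t * k\<close> planted vertices remain, the number on
    which phase 2 relies.\<close>
  have "1 < \<rho>\<^sub>b / R" using steps R by simp
  then obtain N where N: "\<rho>\<^sub>b / \<rho>\<^sub>a < (\<rho>\<^sub>b / R) ^ N"
    using real_arch_pow by blast
  have "\<forall>\<^sub>F n::nat in sequentially. 2 * (exp (c * sqrt (real n)) * exp ((real n powr (1/4) + 1) * ln (real n)) *
      exp (- (\<epsilon>\<^sup>2 / 2 * (c / 4) * (real n powr (7/16) * real n powr (1/4))))) \<le> exp (- (real n powr (1/8))) / 4"
    by (rule eventually_union_bound_small) (use \<epsilon> c in auto)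
  moreover have "\<forall>\<^sub>F n::nat in sequentially. 2 * real n * exp (- (\<epsilon>\<^sup>2 / 2 * (c / 2) * real n powr (1/2))) \<le> exp (- (real n powr \<epsilon>\<^sub>0)) / 4"
    by (rule eventually_exp_decay) (use \<epsilon> c \<epsilon>0 in auto)
  moreover have "\<forall>\<^sub>F n::nat in sequentially. 6 * real n * exp (- (\<gamma> * real n powr (7/16))) \<le> exp (- (real n powr \<epsilon>\<^sub>0)) / 4"
    by (rule eventually_exp_decay) (use \<gamma> \<epsilon>0 in auto)
  moreover have "\<forall>\<^sub>F n::nat in sequentially. 2 * real n * exp (- (C * real n powr \<theta>)) \<le> exp (- (real n powr \<epsilon>\<^sub>0)) / 4"
    by (rule eventually_exp_decay) (use C \<epsilon>0 in auto)
  moreover have "\<forall>\<^sub>F n::nat in sequentially. 2 * (real n powr (1/4) + 1) < \<epsilon> * (c / 4 * real n powr (7/16))"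
    using \<epsilon> c by real_asymp
  moreover have "\<forall>\<^sub>F n::nat in sequentially. max 2 (1 / \<epsilon>) \<le> c / 4 * real n powr (7/16)"
    using c by real_asymp
  moreover have "\<forall>\<^sub>F n::nat in sequentially. max (c / 2 * sqrt (real n)) (2 / \<epsilon>) \<le> c * sqrt (real n) - 1"
    using c by real_asymp
  moreover have "\<forall>\<^sub>F n::nat in sequentially. real N + 1 \<le> \<kappa> * ln (real n) - 1"
    using \<kappa>(1) by real_asymp
  moreover have "\<forall>\<^sub>F n::nat in sequentially. \<kappa> * ln (real n) \<le> real n"
    using \<kappa>(1) by real_asymp
  moreover have "\<forall>\<^sub>F n::nat in sequentially. c * sqrt (real n) \<le> real n"
    using c by real_asymp
  ultimately have "\<forall>\<^sub>F n in sequentially. \<forall>sel. selection_rule sel \<longrightarrow>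
       success_prob sel n p q c (k n) \<alpha> \<beta> (t n) \<ge> 1 - exp (- (real n powr \<epsilon>\<^sub>0))"
    using sizes eventually_ge_at_top[of 1]
  proof eventually_elim
    case (elim n)
    note n1 = elim(12)
    have "0 \<le> c * sqrt (real n)" using c by simp
    then have "0 \<le> \<lfloor>c * sqrt (real n)\<rfloor>" by (simp add: zero_le_floor)
    then have "real (k n) = of_int \<lfloor>c * sqrt (real n)\<rfloor>" by (simp add: k_def)
    then have kb: "real (k n) \<le> c * sqrt (real n)" "c * sqrt (real n) - 1 \<le> real (k n)" by linarith+
    have kn: "k n \<le> n" using kb elim(10) by linarith
    have k2: "c / 2 * sqrt (real n) \<le> real (k n)" "2 \<le> \<epsilon> * real (k n)"
    proof -
      show "c / 2 * sqrt (real n) \<le> real (k n)" using kb elim(7) by linarith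
      have "2 / \<epsilon> \<le> real (k n)" using kb elim(7) by linarith
      then show "2 \<le> \<epsilon> * real (k n)" using \<epsilon> by (simp add: field_simps)
    qed
    have sb: "real n powr (1/4) \<le> real (s n)" "real (s n) \<le> real n powr (1/4) + 1"
    proof -
      have "0 \<le> \<lceil>real n powr (1/4)\<rceil>" by (simp add: zero_le_ceiling less_le_trans[of _ 0])
      then have "real (s n) = of_int \<lceil>real n powr (1/4)\<rceil>" by (simp add: s_def)
      then show "real n powr (1/4) \<le> real (s n)" "real (s n) \<le> real n powr (1/4) + 1" by linarith+
    qed
    have s0: "0 < s n"
    proof -
      have "0 < real n powr (1/4)" using n1 by simp
      then show ?thesis using sb by linarith
    qed
    have s2: "2 * real (s n) < \<epsilon> * l n" using sb elim(5) by (simp add: l_def)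
    have l: "1 \<le> \<epsilon> * l n" "2 \<le> l n"
    proof -
      show "2 \<le> l n" using elim(6) by (simp add: l_def)
      have "1 / \<epsilon> \<le> l n" using elim(6) by (simp add: l_def)
      then show "1 \<le> \<epsilon> * l n" using \<epsilon> by (simp add: field_simps)
    qed
    have sl: "real (s n) \<le> l n"
    proof -
      have "\<epsilon> * l n \<le> 1 * l n" using pq l by (intro mult_right_mono) (auto simp: \<epsilon>_def)
      then show ?thesis using s2 by linarith
    qed
    have n716: "real n powr (- (1/16)) * sqrt (real n) = real n powr (7/16)"
      using n1 by (simp add: powr_half_sqrt[symmetric] powr_add[symmetric])
    define r where "r = R ^ t n * real (k n)"
    have r2: "2 * l n \<le> r"
    proof -
      have Rt: "real n powr (- (1/16)) \<le> R ^ t n"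
        by (rule power_ge_powr[OF R \<kappa>(2) tb(1)[OF n1] n1])
      have "2 * l n = real n powr (- (1/16)) * (c / 2 * sqrt (real n))"
        unfolding l_def n716[symmetric] by simp
      also have "\<dots> \<le> r"
        unfolding r_def using Rt k2 c R by (intro mult_mono) auto
      finally show ?thesis .
    qed
    have tN: "N \<le> t n" "0 < t n" using tb(2)[OF n1] elim(8) by linarith+
    have Lt: "L n (t n) = \<rho>\<^sub>a / \<rho>\<^sub>b * (\<rho>\<^sub>b ^ t n * real (k n))"
      using tN(2) \<rho>b by (simp add: L_def power_eq_if)
    have rL: "r \<le> L n (t n)"
    proof -
      have "(\<rho>\<^sub>b / R) ^ N \<le> (\<rho>\<^sub>b / R) ^ t n" using tN steps R by (intro power_increasing) auto
      with N have "\<rho>\<^sub>b / \<rho>\<^sub>a \<le> \<rho>\<^sub>b ^ t n / R ^ t n" by (simp add: power_divide)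
      then have "R ^ t n \<le> \<rho>\<^sub>a / \<rho>\<^sub>b * \<rho>\<^sub>b ^ t n" using R steps \<rho>b by (simp add: field_simps)
      then have "R ^ t n * real (k n) \<le> \<rho>\<^sub>a / \<rho>\<^sub>b * \<rho>\<^sub>b ^ t n * real (k n)" by (rule mult_right_mono) simp
      then show ?thesis by (simp add: r_def Lt mult.assoc)
    qed
    have M0: "0 < M n (t n)" "M n (t n) \<le> real n"
    proof -
      show "0 < M n (t n)" using \<tau>0 n1 by (simp add: M_def)
      have "\<tau>\<^sub>1 ^ t n \<le> 1" using \<tau>0 \<tau>1 by (intro power_le_one) auto
      then have "\<tau>\<^sub>1 ^ t n * real n \<le> 1 * real n" by (rule mult_right_mono) simp
      then show "M n (t n) \<le> real n" by (simp add: M_def)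
    qed
    define b where "b = 6 * exp (- (\<gamma> * real n powr (7/16)))"
    define F1 where "F1 = 2 * 2 ^ k n * real n ^ s n * exp (- (\<epsilon>\<^sup>2 / 2 * l n * real (s n)))"
    define F2 where "F2 = 2 * real n * exp (- (\<epsilon>\<^sup>2 / 2 * real (k n)))"
    define F4 where "F4 = 2 * M n (t n) * exp (- ((q - p)\<^sup>2 * (L n (t n))\<^sup>2 / (8 * M n (t n))))"
    let ?e = "exp (- (real n powr \<epsilon>\<^sub>0))"
    have e18: "exp (- (real n powr (1/8))) \<le> ?e"
      using n1 \<epsilon>0 by (simp add: powr_mono)
    have B1: "F1 \<le> ?e / 4"
    proof -
      have "(2::real) ^ k n \<le> exp (c * sqrt (real n))"
      proof -
        have "(2::real) ^ k n \<le> exp 1 ^ k n" using exp_ge_add_one_self[of 1] by (intro power_mono) auto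
        also have "\<dots> = exp (real (k n))" by (simp add: exp_of_nat_mult[symmetric])
        finally show ?thesis using kb(1) by (meson exp_le_cancel_iff order_trans)
      qed
      moreover have "real n ^ s n \<le> exp ((real n powr (1/4) + 1) * ln (real n))"
      proof -
        have "real n ^ s n = exp (real (s n) * ln (real n))" using n1 by (simp add: exp_of_nat_mult)
        also have "\<dots> \<le> exp ((real n powr (1/4) + 1) * ln (real n))"
          using sb n1 by (simp add: mult_right_mono)
        finally show ?thesis .
      qed
      moreover have "exp (- (\<epsilon>\<^sup>2 / 2 * l n * real (s n))) \<le> exp (- (\<epsilon>\<^sup>2 / 2 * (c / 4) * (real n powr (7/16) * real n powr (1/4))))"
      proof -
        have "\<epsilon>\<^sup>2 / 2 * (c / 4) * (real n powr (7/16) * real n powr (1/4)) = \<epsilon>\<^sup>2 / 2 * l n * real n powr (1/4)"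
          by (simp add: l_def)
        also have "\<dots> \<le> \<epsilon>\<^sup>2 / 2 * l n * real (s n)"
          using sb l by (intro mult_left_mono) auto
        finally show ?thesis by simp
      qed
      ultimately have "2 ^ k n * real n ^ s n * exp (- (\<epsilon>\<^sup>2 / 2 * l n * real (s n))) \<le>
        exp (c * sqrt (real n)) * exp ((real n powr (1/4) + 1) * ln (real n)) *
        exp (- (\<epsilon>\<^sup>2 / 2 * (c / 4) * (real n powr (7/16) * real n powr (1/4))))"
        by (intro mult_mono) auto
      then show ?thesis using elim(1) e18 unfolding F1_def by linarith
    qed
    have B2: "F2 \<le> ?e / 4"
    proof -
      have "\<epsilon>\<^sup>2 / 2 * (c / 2) * real n powr (1/2) = \<epsilon>\<^sup>2 / 2 * (c / 2 * sqrt (real n))"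
        by (simp add: powr_half_sqrt)
      also have "\<dots> \<le> \<epsilon>\<^sup>2 / 2 * real (k n)" using k2 by (intro mult_left_mono) auto
      finally have "2 * real n * exp (- (\<epsilon>\<^sup>2 / 2 * real (k n))) \<le> 2 * real n * exp (- (\<epsilon>\<^sup>2 / 2 * (c / 2) * real n powr (1/2)))"
        by (intro mult_left_mono) auto
      then show ?thesis using elim(2) unfolding F2_def by linarith
    qed
    have B3: "real (t n) * b \<le> ?e / 4"
    proof -
      have "real (t n) * b \<le> real n * b"
        using tb(1)[OF n1] elim(9) by (intro mult_right_mono) (auto simp: b_def)
      also have "\<dots> = 6 * real n * exp (- (\<gamma> * real n powr (7/16)))" by (simp add: b_def)
      finally show ?thesis using elim(3) by linarith
    qed
    have B4: "F4 \<le> ?e / 4"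
    proof -
      \<comment> \<open>The division by \<open>g\<close> pays for rounding the number of steps
        down.\<close>
      have gt: "real n powr \<theta> / g \<le> g ^ t n"
      proof -
        have "real n powr \<theta> / g = exp ((\<kappa> * ln (real n) - 1) * ln g)"
        proof -
          have "(\<kappa> * ln (real n) - 1) * ln g = \<theta> * ln (real n) - ln g" by (simp add: \<theta>_def algebra_simps)
          then show ?thesis using n1 g by (simp add: powr_def exp_diff)
        qed
        also have "\<dots> \<le> exp (real (t n) * ln g)"
          using tb(2)[OF n1] g by (simp add: mult_right_mono)
        also have "\<dots> = g ^ t n" using g by (simp add: exp_of_nat_mult)
        finally show ?thesis .
      qed
      have "C * real n powr \<theta> = (q - p)\<^sup>2 / 8 * ((\<rho>\<^sub>a / \<rho>\<^sub>b)\<^sup>2 * ((c / 2)\<^sup>2 * (real n powr \<theta> / g)))"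
        by (simp add: C_def)
      also have "\<dots> \<le> (q - p)\<^sup>2 / 8 * ((\<rho>\<^sub>a / \<rho>\<^sub>b)\<^sup>2 * ((real (k n))\<^sup>2 / real n * (\<rho>\<^sub>b\<^sup>2 / \<tau>\<^sub>1) ^ t n))"
      proof (intro mult_left_mono mult_mono)
        have "(c / 2 * sqrt (real n))\<^sup>2 \<le> (real (k n))\<^sup>2" using k2 c by (intro power_mono) auto
        then show "(c / 2)\<^sup>2 \<le> (real (k n))\<^sup>2 / real n" using n1 by (simp add: power_mult_distrib field_simps)
        have "g ^ t n \<le> (\<rho>\<^sub>b\<^sup>2 / \<tau>\<^sub>1) ^ t n"
          unfolding g_def using R steps \<tau>0 by (intro power_mono divide_right_mono) auto
        then show "real n powr \<theta> / g \<le> (\<rho>\<^sub>b\<^sup>2 / \<tau>\<^sub>1) ^ t n" using gt by linarith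
      qed (use g in auto)
      also have "\<dots> = (q - p)\<^sup>2 * (L n (t n))\<^sup>2 / (8 * M n (t n))"
        by (simp add: Lt M_def power_mult_distrib power_divide power_mult[symmetric] mult_ac)
      finally have "F4 \<le> 2 * M n (t n) * exp (- (C * real n powr \<theta>))"
        unfolding F4_def using M0 by (intro mult_left_mono) auto
      also have "\<dots> \<le> 2 * real n * exp (- (C * real n powr \<theta>))" using M0 by (intro mult_right_mono) auto
      finally show ?thesis using elim(4) by linarith
    qed
    show ?case
    proof (intro allI impI)
      fix sel assume sel: "selection_rule sel"
      have "success_prob sel n p q c (k n) \<alpha> \<beta> (t n) \<ge> 1 - (F1 + F2 + (real (t n) * b + F4))"
      proof (rule success_prob_ge[OF kn])
        show "0 \<le> F1 + F2 + (real (t n) * b + F4)"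
          unfolding F1_def F2_def F4_def b_def using M0 by (intro add_nonneg_nonneg mult_nonneg_nonneg) auto
        have init: "real n \<le> M n 0" "L n 0 \<le> real (k n)" "0 \<le> b" by (simp_all add: M_def L_def b_def)
        fix K assume K: "K \<subseteq> {..<n}" "card K = k n"
        show "1 - (F1 + F2 + (real (t n) * b + F4)) \<le>
          measure_pmf.prob (bind_pmf (random_edges n p q K) (dense_graph_alg sel n p q c (k n) \<alpha> \<beta> (t n))) {K}"
          unfolding F1_def F2_def F4_def
        proof (rule prob_recover[where L = "L n" and M = "M n", OF pq \<epsilon>_def K sel s0 s2 l(1) _ k2(2) r_def[unfolded R_def] _ rL])
          fix i V assume "i < t n" "V \<subseteq> {..<n}" "real (card V) \<le> M n i" "L n i \<le> real (card (V \<inter> K))"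
          then show "1 - b \<le> measure_pmf.prob (fresh_step p \<alpha> \<beta> (planted_weight p q K) V)
             {V'. real (card V') \<le> M n (Suc i) \<and> L n (Suc i) \<le> real (card (V' \<inter> K))}"
            using elim(11) tb(1)[OF n1] K unfolding b_def by blast
        qed (use l r2 rL sl M0 init in auto)
      qed
      then show "success_prob sel n p q c (k n) \<alpha> \<beta> (t n) \<ge> 1 - ?e"
        using B1 B2 B3 B4 by linarith
    qed
  qed
  then show ?thesis using \<epsilon>4 \<epsilon>0(1) unfolding k_def t_def by blast
qed

theorem theorem20:
  fixes p q c :: real
  assumes "0 < p" and "p < q" and "q < 1"
    and "c > c0 * (sqrt (p * (1 - p)) / (q - p))"
  shows "\<exists>\<alpha> \<beta> \<epsilon>\<^sub>4 :: real. 0 < \<alpha> \<and> \<alpha> < 1 \<and> 0 < \<beta> \<and> 0 < \<epsilon>\<^sub>4 \<and>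
           (rho' p q \<alpha> \<beta> c)\<^sup>2 > tau \<alpha> \<beta> \<and>
           (\<exists>(\<epsilon>\<^sub>0 :: real) (f :: nat \<Rightarrow> real).
              0 < \<epsilon>\<^sub>0 \<and> f \<in> \<Theta>(\<lambda>n. real n powr \<epsilon>\<^sub>0) \<and> (\<forall>n. 0 \<le> f n) \<and>
              (\<forall>\<^sub>F n in sequentially. \<forall>sel. selection_rule sel \<longrightarrow>
                 success_prob sel n p q c (nat \<lfloor>c * sqrt (real n)\<rfloor>) \<alpha> \<beta>
                     (num_iterations \<epsilon>\<^sub>4 p q \<alpha> \<beta> c n)
                   \<ge> 1 - exp (- f n)))"
proof -
  define \<sigma> where "\<sigma> = sqrt (p * (1 - p))"
  have \<sigma>: "0 < \<sigma>" using assms by (simp add: \<sigma>_def)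
  \<comment> \<open>In this scale \<open>rho'\<close> at \<open>c\<close> is \<open>rho\<close> at
    \<open>x\<close>, and the hypothesis on \<open>c\<close> reads \<open>c0 < x\<close>.\<close>
  define x where "x = c * ((q - p) / \<sigma>)"
  have "c0 < x"
    using assms \<sigma> unfolding x_def \<sigma>_def[symmetric] by (simp add: field_simps)
  from rho_gt_sqrt_tau_exists[OF this] obtain \<alpha> \<beta> where
    \<alpha>: "0 < \<alpha>" "\<alpha> < 1" "0 < \<beta>" and "0 < x" and gap: "sqrt (tau \<alpha> \<beta>) < rho \<alpha> \<beta> x" by blast
  have c: "0 < c" using \<open>0 < x\<close> \<sigma> assms(2) by (simp add: x_def zero_less_mult_iff zero_less_divide_iff)
  have "rho \<alpha> \<beta> x = rho' p q \<alpha> \<beta> c"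
    by (simp add: rho_def rho'_def x_def \<sigma>_def mult_ac)
  then have gap': "tau \<alpha> \<beta> < (rho' p q \<alpha> \<beta> c)\<^sup>2"
    using gap rho'_bounds[OF \<alpha>(1,2)] by (metis less_le real_sqrt_less_iff real_sqrt_abs abs_of_pos)
  from success_prob_asymptotics[OF assms(1-3) \<alpha>(1,2) c gap']
  obtain \<epsilon>\<^sub>4 \<epsilon>\<^sub>0 :: real where e: "0 < \<epsilon>\<^sub>4" "0 < \<epsilon>\<^sub>0"
    and succ: "\<forall>\<^sub>F n in sequentially. \<forall>sel. selection_rule sel \<longrightarrow>
       success_prob sel n p q c (nat \<lfloor>c * sqrt (real n)\<rfloor>) \<alpha> \<beta> (num_iterations \<epsilon>\<^sub>4 p q \<alpha> \<beta> c n)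
         \<ge> 1 - exp (- (real n powr \<epsilon>\<^sub>0))" by blast
  have "\<exists>(\<epsilon>\<^sub>0 :: real) (f :: nat \<Rightarrow> real).
              0 < \<epsilon>\<^sub>0 \<and> f \<in> \<Theta>(\<lambda>n. real n powr \<epsilon>\<^sub>0) \<and> (\<forall>n. 0 \<le> f n) \<and>
              (\<forall>\<^sub>F n in sequentially. \<forall>sel. selection_rule sel \<longrightarrow>
                 success_prob sel n p q c (nat \<lfloor>c * sqrt (real n)\<rfloor>) \<alpha> \<beta>
                     (num_iterations \<epsilon>\<^sub>4 p q \<alpha> \<beta> c n)
                   \<ge> 1 - exp (- f n))"
    by (rule exI[of _ \<epsilon>\<^sub>0], rule exI[of _ "\<lambda>n. real n powr \<epsilon>\<^sub>0"]) (use e succ in auto)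
  then show ?thesis using \<alpha> e(1) gap' by blast
qed

end
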